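(* Let $X$ be a metric space and let $U:\mathcal P(\Sigma_G^{\mathbb N})\to X$ be continuous with respect to the weak topology. Let $C\subseteq X$ be a subset of $X$. Fix a continuous function $\varphi:\Sigma_G^{\mathbb N}\to\mathbb R$. (1) We have $$\lim_{r\searrow 0}\underline P^{U}_{B(C,r)}(\varphi)=\lim_{r\searrow 0}\overline P^{U}_{B(C,r)}(\varphi)=\sup_{\mu\in\mathcal P_S(\Sigma_G^{\mathbb N}),\ U\mu\in\overline C}\Big(h(\mu)+\int\varphi\,d\mu\Big).$$ (2) We have $$\lim_{r\searrow 0}-\log\sigma_{\mathrm{rad}}\big(\zeta^{\mathrm{dyn},U}_{B(C,r)}(\varphi;\cdot)\big)=\sup_{\mu\in\mathcal P_S(\Sigma_G^{\mathbb N}),\ U\mu\in\overline C}\Big(h(\mu)+\int\varphi\,d\mu\Big).$$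
   Context: $G=(V,E)$ is a fixed finite directed multigraph (vertex set $V$, edge set $E$), assumed strongly connected. For $e\in E$, $\mathrm i(e)$ and $\mathrm t(e)$ are its initial and terminal vertices. $\Sigma_G^n$ is the set of strings $e_1\ldots e_n$ of edges with $\mathrm t(e_k)=\mathrm i(e_{k+1})$ for $1\le k<n$, and $\Sigma_G^{\mathbb N}$ is the set of infinite strings $e_1e_2\ldots$ with $\mathrm t(e_k)=\mathrm i(e_{k+1})$ for all $k\ge1$, with the product topology (discrete factors). For $\mathbf u=e_1e_2\ldots\in\Sigma_G^{\mathbb N}$, $\mathbf u|n=e_1\ldots e_n$; for $\mathbf i\in\Sigma_G^n$, the cylinder is $[\mathbf i]=\{\mathbf u\in\Sigma_G^{\mathbb N}:\mathbf u|n=\mathbf i\}$. $S(e_1e_2\ldots)=e_2e_3\ldots$ is the shift. $\mathcal P(\Sigma_G^{\mathbb N})$ (resp. $\mathcal P_S(\Sigma_G^{\mathbb N})$) is the set of Borel (resp. shift-invariant Borel) probability measures on $\Sigma_G^{\mathbb N}$, with the weak topology; $h(\mu)$ is the (Kolmogorov–Sinai) entropy of $\mu\in\mathcal P_S(\Sigma_G^{\mathbb N})$ with respect to $S$. $L_n:\Sigma_G^{\mathbb N}\to\mathcal P(\Sigma_G^{\mathbb N})$ is $L_n\mathbf u=\frac1n\sum_{k=0}^{n-1}\delta_{S^k\mathbf u}$, and $UL_n[\mathbf i]=\{U(L_n\mathbf u):\mathbf u\in[\mathbf i]\}$. For $D\subseteq X$ put $$Z_n(D)=\sum_{\mathbf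 i\in\Sigma_G^n,\ UL_n[\mathbf i]\subseteq D}\ \sup_{\mathbf u\in[\mathbf i]}\exp\sum_{k=0}^{n-1}\varphi(S^k\mathbf u).$$ The lower and upper multifractal pressures are $\underline P^U_D(\varphi)=\liminf_n\frac1n\log Z_n(D)$ and $\overline P^U_D(\varphi)=\limsup_n\frac1n\log Z_n(D)$, and the dynamical multifractal zeta-function is the power series $\zeta^{\mathrm{dyn},U}_D(\varphi;z)=\sum_n\frac{z^n}{n}Z_n(D)$. $\sigma_{\mathrm{rad}}(f)\in[0,\infty]$ is the radius of convergence of a power series $f$. $B(C,r)=\{x\in X:\operatorname{dist}(x,C)<r\}$. Conventions: $\log0=-\infty$, $\log\infty=\infty$, $\sup\varnothing=-\infty$. *)

theory Defs
  imports
    "HOL-Probability.Probability"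
    "Graph_Theory.Graph_Theory"
begin

section \<open>Path spaces of directed multigraphs\<close>

text \<open>
  A multigraph is a \<^typ>\<open>('v, 'e) pre_digraph\<close>, with \<^const>\<open>tail\<close> and \<^const>\<open>head\<close> for
  the initial and terminal vertex of an edge. Sequences are indexed from \<open>0\<close>, so
  \<open>u k\<close> is the edge \<open>e\<^sub>k\<^sub>+\<^sub>1\<close> of the usual notation \<open>u = e\<^sub>1 e\<^sub>2 \<dots>\<close>.
\<close>

definition finite_paths :: "('v, 'e) pre_digraph \<Rightarrow> nat \<Rightarrow> 'e list set" where
  "finite_paths G n =
     {w. length w = n \<and> set w \<subseteq> arcs G \<and>
         (\<forall>k. Suc k < n \<longrightarrow> head G (w ! k) = tail G (w ! Suc k))}"

definition infinite_paths :: "('v, 'e) pre_digraph \<Rightarrow> (nat \<Rightarrow> 'e) set" where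
  "infinite_paths G =
     {u. (\<forall>k. u k \<in> arcs G) \<and> (\<forall>k. head G (u k) = tail G (u (Suc k)))}"

definition path_topology :: "('v, 'e) pre_digraph \<Rightarrow> (nat \<Rightarrow> 'e) topology" where
  "path_topology G =
     subtopology (product_topology (\<lambda>_. discrete_topology (arcs G)) UNIV) (infinite_paths G)"

definition cylinder :: "('v, 'e) pre_digraph \<Rightarrow> 'e list \<Rightarrow> (nat \<Rightarrow> 'e) set" where
  "cylinder G w = {u \<in> infinite_paths G. map u [0..<length w] = w}"

definition shift_map :: "(nat \<Rightarrow> 'e) \<Rightarrow> nat \<Rightarrow> 'e" where
  "shift_map u = (\<lambda>k. u (Suc k))"


section \<open>Borel probability measures and the weak topology\<close>

definition borel_of :: "'a topology \<Rightarrow> 'a measure" where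
  "borel_of T = sigma (topspace T) {A. openin T A}"

definition borel_probs :: "'a topology \<Rightarrow> 'a measure set" where
  "borel_probs T = {\<mu>. prob_space \<mu> \<and> sets \<mu> = sets (borel_of T)}"

text \<open>The coarsest topology for which \<open>\<mu> \<mapsto> \<integral>f d\<mu>\<close> is continuous for all bounded continuous \<open>f\<close>.\<close>

definition weak_topology :: "'a topology \<Rightarrow> 'a measure topology" where
  "weak_topology T = topology_generated_by
     {{\<mu> \<in> borel_probs T. (\<integral>x. f x \<partial>\<mu>) \<in> V} | f V.
        continuous_map T euclideanreal f \<and> bounded (f ` topspace T) \<and> open V}"

definition invariant_probs :: "'a topology \<Rightarrow> ('a \<Rightarrow> 'a) \<Rightarrow> 'a measure set" where
  "invariant_probs T S =
     {\<mu> \<in> borel_probs T. \<forall>A\<in>sets \<mu>. emeasure \<mu> (S -` A \<inter> space \<mu>) = emeasure \<mu> A}"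


section \<open>Kolmogorov--Sinai entropy\<close>

definition measurable_partition :: "'a measure \<Rightarrow> 'a set set \<Rightarrow> bool" where
  "measurable_partition \<mu> \<xi> \<longleftrightarrow> finite \<xi> \<and> \<xi> \<subseteq> sets \<mu> \<and> partition_on (space \<mu>) \<xi>"

definition partition_entropy :: "'a measure \<Rightarrow> 'a set set \<Rightarrow> real" where
  "partition_entropy \<mu> \<xi> = - (\<Sum>A\<in>\<xi>. measure \<mu> A * ln (measure \<mu> A))"

text \<open>The common refinement of \<open>S\<^sup>-\<^sup>k \<xi>\<close> for \<open>k < n\<close>.\<close>

definition iterated_join :: "'a measure \<Rightarrow> ('a \<Rightarrow> 'a) \<Rightarrow> 'a set set \<Rightarrow> nat \<Rightarrow> 'a set set" where
  "iterated_join \<mu> S \<xi> n =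
     {space \<mu> \<inter> (\<Inter>k<n. (S ^^ k) -` A k) | A. \<forall>k<n. A k \<in> \<xi>} - {{}}"

definition ks_entropy :: "('a \<Rightarrow> 'a) \<Rightarrow> 'a measure \<Rightarrow> ereal" where
  "ks_entropy S \<mu> =
     (SUP \<xi>\<in>{\<xi>. measurable_partition \<mu> \<xi>}.
        ereal (lim (\<lambda>n. 1 / real n * partition_entropy \<mu> (iterated_join \<mu> S \<xi> n))))"


section \<open>Multifractal pressures and zeta-functions\<close>

text \<open>The empirical measure \<open>L\<^sub>n u\<close>, the average of the Dirac measures at \<open>S\<^sup>k u\<close> for \<open>k < n\<close>.\<close>

definition empirical_measure ::
    "('v, 'e) pre_digraph \<Rightarrow> nat \<Rightarrow> (nat \<Rightarrow> 'e) \<Rightarrow> (nat \<Rightarrow> 'e) measure" where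
  "empirical_measure G n u =
     (let B = borel_of (path_topology G) in
        measure_of (space B) (sets B)
          (\<lambda>A. (\<Sum>k<n. emeasure (return B ((shift_map ^^ k) u)) A) / of_nat n))"

text \<open>
  For a strongly connected finite graph and continuous \<open>\<phi>\<close>, every cylinder of a finite path of
  positive length is nonempty and \<open>\<phi>\<close> is bounded, so the real suprema below are genuine.
\<close>

definition Z_sum ::
    "('v, 'e) pre_digraph \<Rightarrow> ((nat \<Rightarrow> 'e) measure \<Rightarrow> 'x) \<Rightarrow> ((nat \<Rightarrow> 'e) \<Rightarrow> real) \<Rightarrow> 'x set \<Rightarrow> nat \<Rightarrow> real"
  where
  "Z_sum G U \<phi> D n =
     (\<Sum>w\<in>{w \<in> finite_paths G n. (\<lambda>u. U (empirical_measure G n u)) ` cylinder G w \<subseteq> D}.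
        SUP u\<in>cylinder G w. exp (\<Sum>k<n. \<phi> ((shift_map ^^ k) u)))"

text \<open>The logarithm on \<open>[0, \<infinity>]\<close> with \<open>log 0 = -\<infinity>\<close> and \<open>log \<infinity> = \<infinity>\<close>.\<close>

definition ext_log :: "ereal \<Rightarrow> ereal" where
  "ext_log x = (if x = 0 then -\<infinity> else if x = \<infinity> then \<infinity> else ereal (ln (real_of_ereal x)))"

definition lower_pressure ::
    "('v, 'e) pre_digraph \<Rightarrow> ((nat \<Rightarrow> 'e) measure \<Rightarrow> 'x) \<Rightarrow> ((nat \<Rightarrow> 'e) \<Rightarrow> real) \<Rightarrow> 'x set \<Rightarrow> ereal"
  where
  "lower_pressure G U \<phi> D =
     liminf (\<lambda>n. ereal (1 / real n) * ext_log (ereal (Z_sum G U \<phi> D n)))"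

definition upper_pressure ::
    "('v, 'e) pre_digraph \<Rightarrow> ((nat \<Rightarrow> 'e) measure \<Rightarrow> 'x) \<Rightarrow> ((nat \<Rightarrow> 'e) \<Rightarrow> real) \<Rightarrow> 'x set \<Rightarrow> ereal"
  where
  "upper_pressure G U \<phi> D =
     limsup (\<lambda>n. ereal (1 / real n) * ext_log (ereal (Z_sum G U \<phi> D n)))"

text \<open>The power series starts at \<open>n = 1\<close>.\<close>

definition dyn_zeta ::
    "('v, 'e) pre_digraph \<Rightarrow> ((nat \<Rightarrow> 'e) measure \<Rightarrow> 'x) \<Rightarrow> ((nat \<Rightarrow> 'e) \<Rightarrow> real) \<Rightarrow> 'x set \<Rightarrow> complex fps"
  where
  "dyn_zeta G U \<phi> D =
     Abs_fps (\<lambda>n. if n = 0 then 0 else complex_of_real (Z_sum G U \<phi> D n / real n))"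

text \<open>
  The infimum is taken in \<^typ>\<open>ereal\<close>, so the distance to the empty set is \<open>\<infinity>\<close> and its
  neighbourhoods are empty; \<^const>\<open>infdist\<close> would give distance \<open>0\<close> there.
\<close>

definition set_ball :: "'x::metric_space set \<Rightarrow> real \<Rightarrow> 'x set" where
  "set_ball C r = {x. (INF c\<in>C. ereal (dist x c)) < ereal r}"

end

theory Submission
  imports Defs
begin

text \<open>
  Both bounds are proved at the level of words. For the upper bound, \<open>h(\<mu>)\<close> is at least the limit of
  the increments \<open>H\<^sub>k\<^sub>+\<^sub>1 - H\<^sub>k\<close> of the entropies of the cylinder partitions, so some increment is nearly
  at most \<open>h(\<mu>)\<close>; comparing words with the Markov chain whose transition weights are the smoothed
  conditional \<open>\<mu>\<close>-probabilities shows that the words with empirical measure close to \<open>\<mu>\<close> carry total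
  weight at most about \<open>exp (n (h(\<mu>) + \<integral>\<phi> d\<mu>))\<close>. If \<open>\<mu>\<close> is not invariant there are eventually no such
  words. Compactness of the space of probability measures makes finitely many neighbourhoods suffice.
  This copes with \<open>U\<close> not being affine.

  For the lower bound, draw blocks of a fixed large length \<open>k\<close> independently from the \<open>k\<close>-marginal
  of \<open>\<mu>\<close> and link them by connecting paths of bounded length. By the weak law of large numbers a
  typical concatenation has empirical measure close to \<open>\<mu>\<close>, and there are about \<open>exp (m H\<^sub>k)\<close> typical
  sequences of \<open>m\<close> blocks, where \<open>H\<^sub>k \<ge> k h(\<mu>)\<close>; the connecting paths lose a factor exponential in \<open>m\<close> with
  a rate independent of \<open>k\<close>. No ergodicity is needed.
\<close>


section \<open>Words and the path topology\<close>

text \<open>\<open>ks_entropy\<close> is a supremum over all finite measurable partitions, while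
  words see only the partition into one-letter cylinders. The upper bound needs merely that this
  partition belongs to the supremum. The lower bound needs
  \<open>H\<^sub>k \<ge> k h(\<mu>)\<close>, which is the generator theorem and the only place where
  arbitrary Borel partitions have to be approximated. Increments rather than
  \<open>H\<^sub>k / k\<close> enter the upper bound because an increment is the mean logarithmic
  loss of a Markov chain with memory k. Smoothing the chain keeps its logarithms finite: up to the
  last k letters, the log-likelihood per letter is the integral of a continuous function against the
  empirical measure, so weak closeness controls it even on words to which \<mu> gives no mass. In
  the lower bound the loss comes from gluing not being injective, as connecting paths of different
  lengths can lead to the same word. All losses per block are made negligible by choosing k after
  the connecting paths are fixed.\<close>

abbreviation (input) path_probs :: "('v, 'e) pre_digraph \<Rightarrow> (nat \<Rightarrow> 'e) measure set" where
  "path_probs G \<equiv> borel_probs (path_topology G)"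

abbreviation (input) shift_probs :: "('v, 'e) pre_digraph \<Rightarrow> (nat \<Rightarrow> 'e) measure set" where
  "shift_probs G \<equiv> invariant_probs (path_topology G) shift_map"

abbreviation (input) path_weak_topology :: "('v, 'e) pre_digraph \<Rightarrow> (nat \<Rightarrow> 'e) measure topology" where
  "path_weak_topology G \<equiv> weak_topology (path_topology G)"

abbreviation (input) path_continuous :: "('v, 'e) pre_digraph \<Rightarrow> ((nat \<Rightarrow> 'e) \<Rightarrow> real) \<Rightarrow> bool" where
  "path_continuous G f \<equiv> continuous_map (path_topology G) euclideanreal f"

lemma shift_map_funpow: "(shift_map ^^ k) u = (\<lambda>i. u (k + i))"
  by (induction k) (auto simp: shift_map_def)

lemma shift_map_infinite_paths: "u \<in> infinite_paths G \<Longrightarrow> shift_map u \<in> infinite_paths G"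
  by (auto simp: infinite_paths_def shift_map_def)

lemma shift_map_funpow_infinite_paths:
  "u \<in> infinite_paths G \<Longrightarrow> (shift_map ^^ k) u \<in> infinite_paths G"
  by (auto simp: infinite_paths_def shift_map_funpow)

definition pre :: "nat \<Rightarrow> (nat \<Rightarrow> 'e) \<Rightarrow> 'e list" where
  "pre n u = map u [0..<n]"

text \<open>A union of cylinders of level \<open>n\<close>, given by the set \<open>W\<close> of
  admissible prefixes. Any set of lists is allowed for \<open>W\<close>, so that complements and
  unions can be formed directly on it.\<close>

abbreviation (input) cyl :: "('v, 'e) pre_digraph \<Rightarrow> nat \<Rightarrow> 'e list set \<Rightarrow> (nat \<Rightarrow> 'e) set" where
  "cyl G n W \<equiv> {u \<in> infinite_paths G. pre n u \<in> W}"

lemma length_pre [simp]: "length (pre n u) = n"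
  by (simp add: pre_def)

lemma nth_pre [simp]: "i < n \<Longrightarrow> pre n u ! i = u i"
  by (simp add: pre_def)

lemma pre_0 [simp]: "pre 0 u = []"
  by (simp add: pre_def)

lemma pre_eq_iff: "pre n u = pre n v \<longleftrightarrow> (\<forall>i<n. u i = v i)"
  by (auto simp: pre_def)

lemma pre_Suc: "pre (Suc n) u = pre n u @ [u n]"
  by (simp add: pre_def)

lemma pre_Suc_Cons: "pre (Suc n) u = u 0 # pre n (shift_map u)"
  by (rule nth_equalityI) (auto simp: pre_def shift_map_def nth_Cons' simp del: upt_Suc)

lemma pre_add: "pre (m + n) u = pre m u @ pre n ((shift_map ^^ m) u)"
  by (rule nth_equalityI) (auto simp: pre_def nth_append shift_map_funpow)

lemma pre_mono: "pre n u = pre n v \<Longrightarrow> m \<le> n \<Longrightarrow> pre m u = pre m v"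
  by (auto simp: pre_eq_iff)

lemma pre_shift: "pre n u = pre n v \<Longrightarrow> k + m \<le> n \<Longrightarrow>
    pre m ((shift_map ^^ k) u) = pre m ((shift_map ^^ k) v)"
  by (auto simp: pre_eq_iff shift_map_funpow)

lemma take_pre: "m \<le> n \<Longrightarrow> take m (pre n u) = pre m u"
  by (rule nth_equalityI) auto

lemma mem_cylinder: "u \<in> cylinder G w \<longleftrightarrow> u \<in> infinite_paths G \<and> pre (length w) u = w"
  by (auto simp: cylinder_def pre_def)

lemma mem_cylinder_pre: "u \<in> infinite_paths G \<Longrightarrow> u \<in> cylinder G (pre n u)"
  by (simp add: mem_cylinder)

lemma finite_paths_iff:
  "w \<in> finite_paths G n \<longleftrightarrow>
     length w = n \<and> set w \<subseteq> arcs G \<and> successively (\<lambda>e f. head G e = tail G f) w"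
  by (auto simp: finite_paths_def successively_conv_nth)

lemma pre_finite_paths: "u \<in> infinite_paths G \<Longrightarrow> pre n u \<in> finite_paths G n"
  by (auto simp: finite_paths_def infinite_paths_def pre_def)

definition birkhoff :: "((nat \<Rightarrow> 'e) \<Rightarrow> real) \<Rightarrow> nat \<Rightarrow> (nat \<Rightarrow> 'e) \<Rightarrow> real" where
  "birkhoff f n u = (\<Sum>k<n. f ((shift_map ^^ k) u))"

lemma birkhoff_0 [simp]: "birkhoff f 0 u = 0"
  by (simp add: birkhoff_def)

lemma birkhoff_add: "birkhoff f (m + n) u = birkhoff f m u + birkhoff f n ((shift_map ^^ m) u)"
proof -
  have "birkhoff f (m + n) u = birkhoff f m u + (\<Sum>k<n. f ((shift_map ^^ (m + k)) u))"
    unfolding birkhoff_def by (induction n) auto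
  also have "(\<lambda>k. (shift_map ^^ (m + k)) u) = (\<lambda>k. (shift_map ^^ k) ((shift_map ^^ m) u))"
    by (auto simp: shift_map_funpow add.assoc add.left_commute)
  finally show ?thesis
    by (simp add: birkhoff_def fun_eq_iff)
qed

lemma birkhoff_bound:
  assumes "\<And>u. u \<in> infinite_paths G \<Longrightarrow> \<bar>f u\<bar> \<le> F" "u \<in> infinite_paths G"
  shows "\<bar>birkhoff f n u\<bar> \<le> n * F"
proof -
  have "\<bar>birkhoff f n u\<bar> \<le> (\<Sum>k<n. F)"
    unfolding birkhoff_def
    by (intro order.trans[OF sum_abs] sum_mono assms(1) shift_map_funpow_infinite_paths assms(2))
  then show ?thesis by simp
qed

lemma topspace_path_topology [simp]: "topspace (path_topology G) = infinite_paths G"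
  by (auto simp: path_topology_def infinite_paths_def)

text \<open>A basic open set restricts finitely many coordinates, all below some \<open>n\<close>,
  so it contains every path sharing \<open>n\<close> letters with a given member; conversely,
  prescribing \<open>n\<close> letters defines an open box.\<close>

lemma openin_path_topology:
  "openin (path_topology G) A \<longleftrightarrow>
     A \<subseteq> infinite_paths G \<and>
     (\<forall>u\<in>A. \<exists>n. \<forall>v\<in>infinite_paths G. pre n v = pre n u \<longrightarrow> v \<in> A)"
proof (intro iffI conjI ballI)
  let ?P = "product_topology (\<lambda>_. discrete_topology (arcs G)) (UNIV :: nat set)"
  assume "openin (path_topology G) A"
  then obtain O' where O': "openin ?P O'" "A = O' \<inter> infinite_paths G"
    by (auto simp: path_topology_def openin_subtopology)
  then show "A \<subseteq> infinite_paths G" by auto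
  fix u assume "u \<in> A"
  then have "u \<in> O'" using O' by auto
  then obtain W where W: "finite {i. W i \<noteq> arcs G}" "u \<in> Pi\<^sub>E UNIV W" "Pi\<^sub>E UNIV W \<subseteq> O'"
    using O'(1) unfolding openin_product_topology_alt by auto
  obtain n where n: "\<And>i. W i \<noteq> arcs G \<Longrightarrow> i < n"
    using W(1) unfolding finite_nat_set_iff_bounded by blast
  have "v \<in> A" if v: "v \<in> infinite_paths G" "pre n v = pre n u" for v
  proof -
    have "v i \<in> W i" for i
    proof (cases "W i = arcs G")
      case True then show ?thesis using v by (auto simp: infinite_paths_def)
    next
      case False
      then have "v i = u i" using n v(2) by (auto simp: pre_eq_iff)
      then show ?thesis using W(2) by auto
    qed
    then have "v \<in> O'" using W(3) by auto
    then show ?thesis using O' v by auto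
  qed
  then show "\<exists>n. \<forall>v\<in>infinite_paths G. pre n v = pre n u \<longrightarrow> v \<in> A"
    by (intro exI[of _ n]) simp
next
  let ?P = "product_topology (\<lambda>_. discrete_topology (arcs G)) (UNIV :: nat set)"
  assume A: "A \<subseteq> infinite_paths G \<and>
     (\<forall>u\<in>A. \<exists>n. \<forall>v\<in>infinite_paths G. pre n v = pre n u \<longrightarrow> v \<in> A)"
  then obtain n where n: "\<And>u v. u \<in> A \<Longrightarrow> v \<in> infinite_paths G \<Longrightarrow> pre (n u) v = pre (n u) u \<Longrightarrow> v \<in> A"
    by metis
  define W where "W u = Pi\<^sub>E UNIV (\<lambda>i. if i < n u then {u i} else arcs G)" for u
  have "openin ?P (W u)" if "u \<in> A" for u
    unfolding W_def openin_PiE_gen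
    using A that by (auto simp: infinite_paths_def subset_iff intro!: finite_subset[of _ "{..<n u}"])
  then have "openin ?P (\<Union>u\<in>A. W u)" by auto
  moreover have "(\<Union>u\<in>A. W u) \<inter> infinite_paths G = A"
  proof -
    have "u \<in> W u" if "u \<in> A" for u
      using A that by (auto simp: W_def infinite_paths_def)
    moreover have "v \<in> A" if "v \<in> W u" "u \<in> A" "v \<in> infinite_paths G" for u v
      using that n[of u v] by (auto simp: W_def pre_eq_iff PiE_iff split: if_splits)
    ultimately show ?thesis using A by blast
  qed
  ultimately show "openin (path_topology G) A"
    by (auto simp: path_topology_def openin_subtopology)
qed

text \<open>A sequence of arcs that is not a path breaks the head-tail condition at some
  \<open>k\<close>, and fixing the coordinates \<open>k\<close> and \<open>Suc k\<close> keeps it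
  broken.\<close>

lemma closedin_infinite_paths:
  "closedin (product_topology (\<lambda>_. discrete_topology (arcs G)) (UNIV :: nat set)) (infinite_paths G)"
proof -
  let ?P = "product_topology (\<lambda>_. discrete_topology (arcs G)) (UNIV :: nat set)"
  have "\<exists>W. finite {i. W i \<noteq> arcs G} \<and> (\<forall>i. W i \<subseteq> arcs G) \<and> u \<in> Pi\<^sub>E UNIV W \<and>
          Pi\<^sub>E UNIV W \<subseteq> topspace ?P - infinite_paths G"
    if u: "u \<in> topspace ?P - infinite_paths G" for u
  proof -
    have ua: "u i \<in> arcs G" for i using u by auto
    then obtain k where k: "head G (u k) \<noteq> tail G (u (Suc k))"
      using u by (auto simp: infinite_paths_def)
    define W where "W i = (if i \<in> {k, Suc k} then {u i} else arcs G)" for i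
    have "finite {i. W i \<noteq> arcs G}"
      by (rule finite_subset[of _ "{k, Suc k}"]) (auto simp: W_def)
    moreover have "\<forall>i. W i \<subseteq> arcs G" "u \<in> Pi\<^sub>E UNIV W" using ua by (auto simp: W_def)
    moreover have "v \<notin> infinite_paths G" if "v \<in> Pi\<^sub>E UNIV W" for v
    proof -
      have "v k \<in> W k" "v (Suc k) \<in> W (Suc k)" using that by auto
      then have "v k = u k" "v (Suc k) = u (Suc k)" by (auto simp: W_def)
      then show ?thesis using k unfolding infinite_paths_def by (metis (mono_tags, lifting) mem_Collect_eq)
    qed
    moreover have "v i \<in> arcs G" if "v \<in> Pi\<^sub>E UNIV W" for v i
    proof -
      have "v i \<in> W i" using that by auto
      then show ?thesis using ua by (auto simp: W_def split: if_splits)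
    qed
    ultimately show ?thesis by (intro exI[of _ W]) auto
  qed
  then have "openin ?P (topspace ?P - infinite_paths G)"
    unfolding openin_product_topology_alt by simp
  then show ?thesis
    by (auto simp: closedin_def infinite_paths_def)
qed

text \<open>A strongly connected graph may consist of one vertex without arcs, and then has no
  infinite path. That case is excluded here and settled separately at the end, so that path space
  and the cylinders of finite paths are nonempty.\<close>

locale path_system = fin_digraph G for G :: "('v, 'e) pre_digraph" +
  assumes sconn: "strongly_connected G" and arcs_nonempty: "arcs G \<noteq> {}"
begin

lemma compact_space_path_topology: "compact_space (path_topology G)"
proof -
  let ?P = "product_topology (\<lambda>_. discrete_topology (arcs G)) (UNIV :: nat set)"
  have "compact_space ?P"
    by (subst compact_space_product_topology) (auto simp: compact_space_discrete_topology)
  then show ?thesis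
    unfolding path_topology_def
    using closedin_infinite_paths closedin_compact_space compactin_subspace by blast
qed

text \<open>Finitely many cylinders on which \<open>f\<close> stays within \<epsilon>/2 of its value
  at a centre cover the compact path space; the largest of their lengths serves for all
  points.\<close>

lemma uniform_continuity:
  fixes \<epsilon> :: real
  assumes "path_continuous G f" "\<epsilon> > 0"
  obtains l :: nat where "\<And>u v. u \<in> infinite_paths G \<Longrightarrow> v \<in> infinite_paths G \<Longrightarrow> pre l u = pre l v \<Longrightarrow>
    \<bar>f u - f v\<bar> < \<epsilon>"
proof -
  have "\<exists>n. \<forall>v\<in>infinite_paths G. pre n v = pre n u \<longrightarrow> \<bar>f v - f u\<bar> < \<epsilon> / 2"
    if u: "u \<in> infinite_paths G" for u
  proof -
    have "openin (path_topology G) {v \<in> topspace (path_topology G). f v \<in> ball (f u) (\<epsilon>/2)}"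
      by (rule openin_continuous_map_preimage[OF assms(1)]) auto
    moreover have "u \<in> {v \<in> topspace (path_topology G). f v \<in> ball (f u) (\<epsilon>/2)}"
      using u assms(2) by simp
    ultimately obtain n where
        "\<forall>v\<in>infinite_paths G. pre n v = pre n u \<longrightarrow> v \<in> {v \<in> topspace (path_topology G). f v \<in> ball (f u) (\<epsilon>/2)}"
      unfolding openin_path_topology by meson
    then show ?thesis by (intro exI[of _ n]) (auto simp: dist_real_def abs_minus_commute)
  qed
  then obtain l where l: "\<And>u v. u \<in> infinite_paths G \<Longrightarrow> v \<in> infinite_paths G \<Longrightarrow>
      pre (l u) v = pre (l u) u \<Longrightarrow> \<bar>f v - f u\<bar> < \<epsilon> / 2"
    by metis
  define W where "W u = {v \<in> infinite_paths G. pre (l u) v = pre (l u) u}" for u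
  have "openin (path_topology G) (W u)" for u
    unfolding openin_path_topology W_def by (force intro!: exI[of _ "l u"])
  moreover have "topspace (path_topology G) \<subseteq> \<Union> (W ` infinite_paths G)"
    by (auto simp: W_def)
  ultimately obtain \<F> where \<F>: "finite \<F>" "\<F> \<subseteq> W ` infinite_paths G"
      "infinite_paths G \<subseteq> \<Union>\<F>"
    using compact_space_path_topology[unfolded compact_space_alt, rule_format, of "W ` infinite_paths G"]
    by auto
  then obtain X where X: "finite X" "X \<subseteq> infinite_paths G" "\<F> = W ` X"
    by (meson finite_subset_image)
  define L where "L = Max (insert 0 (l ` X))"
  show ?thesis
  proof (rule that[of L])
    fix u v assume uv: "u \<in> infinite_paths G" "v \<in> infinite_paths G" "pre L u = pre L v"
    obtain x where x: "x \<in> X" "u \<in> W x" using \<F>(3) X(3) uv(1) by auto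
    have "l x \<le> L" using X(1) x(1) by (auto simp: L_def)
    then have "pre (l x) v = pre (l x) u" using uv(3) pre_mono by metis
    then have "\<bar>f v - f x\<bar> < \<epsilon> / 2" "\<bar>f u - f x\<bar> < \<epsilon> / 2"
      using x X(2) l[of x v] l[of x u] uv by (auto simp: W_def)
    then show "\<bar>f u - f v\<bar> < \<epsilon>" by linarith
  qed
qed

lemma continuous_bounded:
  assumes "path_continuous G f"
  obtains F where "F \<ge> 0" "\<And>u. u \<in> infinite_paths G \<Longrightarrow> \<bar>f u\<bar> \<le> F"
proof -
  have "compactin euclideanreal (f ` topspace (path_topology G))"
    using assms compact_space_path_topology compact_space_def image_compactin by blast
  then have "bounded (f ` infinite_paths G)"
    by (simp add: compact_imp_bounded)
  then obtain F where "F > 0" "\<forall>x\<in>f ` infinite_paths G. \<bar>x\<bar> \<le> F"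
    unfolding bounded_pos by auto
  then have "F \<ge> 0" "\<And>u. u \<in> infinite_paths G \<Longrightarrow> \<bar>f u\<bar> \<le> F" by auto
  then show ?thesis by (rule that)
qed

text \<open>All but the last \<open>l\<close> terms of the two sums are taken at points sharing
  \<open>l\<close> letters, so they differ by at most \<epsilon>/2 each. The last \<open>l\<close>
  terms are merely bounded, which is negligible for large \<open>k\<close>.\<close>

lemma birkhoff_variation:
  fixes \<epsilon> :: real
  assumes "path_continuous G f" "\<epsilon> > 0"
  obtains k0 :: nat where "\<And>k u v. k \<ge> k0 \<Longrightarrow> u \<in> infinite_paths G \<Longrightarrow> v \<in> infinite_paths G \<Longrightarrow>
    pre k u = pre k v \<Longrightarrow> \<bar>birkhoff f k u - birkhoff f k v\<bar> \<le> real k * \<epsilon>"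
proof -
  obtain F where F: "F \<ge> 0" "\<And>u. u \<in> infinite_paths G \<Longrightarrow> \<bar>f u\<bar> \<le> F"
    by (rule continuous_bounded[OF assms(1)]) blast
  obtain l where l: "\<And>u v. u \<in> infinite_paths G \<Longrightarrow> v \<in> infinite_paths G \<Longrightarrow> pre l u = pre l v \<Longrightarrow>
    \<bar>f u - f v\<bar> < \<epsilon> / 2"
    by (rule uniform_continuity[OF assms(1), of "\<epsilon> / 2"]) (use assms(2) in auto)
  \<comment> \<open>The second summand makes \<open>2 * l * F\<close> at most half of
    \<open>real k * \<epsilon>\<close>; the first ensures that \<open>k - l\<close> is a genuine
    difference.\<close>
  define k0 :: nat where "k0 = l + nat \<lceil>4 * l * F / \<epsilon>\<rceil>"
  show ?thesis
  proof (rule that[of k0])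
    fix k u v assume k: "k \<ge> k0" and uv: "u \<in> infinite_paths G" "v \<in> infinite_paths G" "pre k u = pre k v"
    have kl: "k = (k - l) + l" using k by (simp add: k0_def)
    have "\<bar>birkhoff f (k - l) u - birkhoff f (k - l) v\<bar> \<le> (\<Sum>i<k-l. \<bar>f ((shift_map ^^ i) u) - f ((shift_map ^^ i) v)\<bar>)"
      unfolding birkhoff_def sum_subtractf[symmetric] by (rule sum_abs)
    also have "\<dots> \<le> (\<Sum>i<k-l. \<epsilon> / 2)"
    proof (intro sum_mono)
      fix i assume "i \<in> {..<k - l}"
      then have il: "i + l \<le> k" by auto
      show "\<bar>f ((shift_map ^^ i) u) - f ((shift_map ^^ i) v)\<bar> \<le> \<epsilon> / 2"
        using l[OF shift_map_funpow_infinite_paths[OF uv(1)] shift_map_funpow_infinite_paths[OF uv(2)]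
            pre_shift[OF uv(3) il]] by (rule less_imp_le)
    qed
    also have "\<dots> \<le> real k * \<epsilon> / 2" using assms(2) by (simp add: mult_right_mono)
    finally have 1: "\<bar>birkhoff f (k - l) u - birkhoff f (k - l) v\<bar> \<le> real k * \<epsilon> / 2" .
    have 2: "\<bar>birkhoff f l ((shift_map ^^ (k - l)) u)\<bar> \<le> l * F" "\<bar>birkhoff f l ((shift_map ^^ (k - l)) v)\<bar> \<le> l * F"
      using birkhoff_bound[of G f F] F(2) uv shift_map_funpow_infinite_paths by blast+
    have "4 * l * F / \<epsilon> \<le> k" using k unfolding k0_def by linarith
    then have 3: "2 * l * F \<le> real k * \<epsilon> / 2" using assms(2) by (simp add: field_simps)
    have split: "birkhoff f k x = birkhoff f (k - l) x + birkhoff f l ((shift_map ^^ (k - l)) x)" for x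
      using birkhoff_add[of f "k - l" l x] kl by simp
    show "\<bar>birkhoff f k u - birkhoff f k v\<bar> \<le> real k * \<epsilon>"
      using 1 2 3 unfolding split[of u] split[of v] by (simp only: abs_le_iff of_nat_mult) linarith
  qed
qed

text \<open>A walk from the head of \<open>e\<close> back to its tail starts with a successor of
  \<open>e\<close>; if the walk is empty, \<open>e\<close> is a loop and succeeds itself.\<close>

lemma next_arc: "e \<in> arcs G \<Longrightarrow> \<exists>f\<in>arcs G. head G e = tail G f"
proof -
  assume e: "e \<in> arcs G"
  have v: "head G e \<in> verts G" "tail G e \<in> verts G" using e by auto
  then obtain p where p: "awalk (head G e) p (tail G e)"
    using sconn unfolding strongly_connected_def reachable_awalk by blast
  show ?thesis
  proof (cases p)
    case Nil
    then show ?thesis using p e by (auto simp: awalk_def)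
  next
    case (Cons f q)
    then show ?thesis using p by (auto simp: awalk_def intro!: bexI[of _ f])
  qed
qed

text \<open>The word is continued by iterating a chosen successor function from its last letter,
  which exists only for positive length.\<close>

lemma extend_path:
  assumes "w \<in> finite_paths G n" "n > 0"
  shows "\<exists>u\<in>infinite_paths G. pre n u = w"
proof -
  obtain nx where nx: "\<And>e. e \<in> arcs G \<Longrightarrow> nx e \<in> arcs G \<and> head G e = tail G (nx e)"
    using next_arc by metis
  have w: "length w = n" "set w \<subseteq> arcs G" "\<And>k. Suc k < n \<Longrightarrow> head G (w ! k) = tail G (w ! Suc k)"
    using assms(1) by (auto simp: finite_paths_def)
  define u where "u i = (if i < n then w ! i else (nx ^^ (Suc i - n)) (w ! (n - 1)))" for i
  have it: "(nx ^^ j) (w ! (n - 1)) \<in> arcs G" for j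
    by (induction j) (use w assms(2) nx in auto)
  have "u i \<in> arcs G" for i using w it by (auto simp: u_def)
  moreover have "head G (u k) = tail G (u (Suc k))" for k
  proof -
    consider "Suc k < n" | "Suc k = n" | "k \<ge> n" by linarith
    then show ?thesis
    proof cases
      case 1 then show ?thesis using w by (simp add: u_def)
    next
      case 2
      then have "w ! k \<in> arcs G" using w by auto
      then show ?thesis using 2 nx by (auto simp: u_def)
    next
      case 3
      then have "u (Suc k) = nx (u k)" by (simp add: u_def Suc_diff_le)
      then show ?thesis using nx \<open>\<And>i. u i \<in> arcs G\<close> by simp
    qed
  qed
  moreover have "pre n u = w" using w by (intro nth_equalityI) (auto simp: u_def)
  ultimately show ?thesis by (auto simp: infinite_paths_def)
qed

lemma infinite_paths_nonempty: "infinite_paths G \<noteq> {}"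
proof -
  obtain e where "e \<in> arcs G" using arcs_nonempty by auto
  then have "[e] \<in> finite_paths G 1" by (auto simp: finite_paths_def)
  then show ?thesis using extend_path[of "[e]" 1] by auto
qed

lemma finite_finite_paths: "finite (finite_paths G n)"
  by (rule finite_subset[OF _ finite_lists_length_eq[OF finite_arcs, of n]])
     (auto simp: finite_paths_def)

lemma pre_image: "pre n ` infinite_paths G = finite_paths G n"
proof (cases "n = 0")
  case True
  then show ?thesis using infinite_paths_nonempty by (auto simp: finite_paths_def)
next
  case False
  then show ?thesis using extend_path[of _ n] pre_finite_paths[of _ G n] by force
qed

end

section \<open>Entropy of simple functions\<close>

text \<open>Termwise \<open>ln x \<le> x - 1\<close> at the ratio of \<open>q i\<close> to
  \<open>p i\<close>. Only an inequality between the total masses is required, so \<open>q\<close>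
  may be a defective distribution. As \<open>ln 0 = 0\<close> in HOL, an index with
  \<open>p i > 0\<close> and \<open>q i = 0\<close> would contribute 0 instead of minus infinity;
  the positivity assumption rules it out.\<close>

lemma gibbs_inequality:
  fixes p q :: "'i \<Rightarrow> real"
  assumes "finite I" "\<And>i. i \<in> I \<Longrightarrow> 0 \<le> p i" "\<And>i. i \<in> I \<Longrightarrow> 0 \<le> q i"
    and "\<And>i. i \<in> I \<Longrightarrow> 0 < p i \<Longrightarrow> 0 < q i" "(\<Sum>i\<in>I. q i) \<le> (\<Sum>i\<in>I. p i)"
  shows "(\<Sum>i\<in>I. p i * ln (q i)) \<le> (\<Sum>i\<in>I. p i * ln (p i))"
proof -
  have "p i * ln (q i) - p i * ln (p i) \<le> q i - p i" if i: "i \<in> I" for i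
  proof (cases "p i > 0")
    case True
    then have q: "q i > 0" using assms i by auto
    have "p i * ln (q i) - p i * ln (p i) = p i * ln (q i / p i)"
      using True q by (simp add: ln_div right_diff_distrib)
    also have "\<dots> \<le> p i * (q i / p i - 1)"
      using True q by (intro mult_left_mono ln_le_minus_one) auto
    finally show ?thesis using True by (simp add: right_diff_distrib)
  next
    case False
    then have "p i = 0" using assms(2)[OF i] by simp
    then show ?thesis using assms(3)[OF i] by simp
  qed
  then have "(\<Sum>i\<in>I. p i * ln (q i) - p i * ln (p i)) \<le> (\<Sum>i\<in>I. q i - p i)"
    by (rule sum_mono)
  then show ?thesis using assms(5) by (simp add: sum_subtractf)
qed

definition point_prob :: "'a measure \<Rightarrow> ('a \<Rightarrow> 'b) \<Rightarrow> 'b \<Rightarrow> real" where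
  "point_prob M X i = measure M {x \<in> space M. X x = i}"

text \<open>Entropy is attached to a map with finitely many values rather than to a partition:
  common refinements become pairs or lists of values, and coarsenings become compositions.\<close>

definition rv_entropy :: "'a measure \<Rightarrow> ('a \<Rightarrow> 'b) \<Rightarrow> real" where
  "rv_entropy M X = - (\<Sum>i\<in>X ` space M. point_prob M X i * ln (point_prob M X i))"

lemma point_prob_nonneg [simp]: "0 \<le> point_prob M X i"
  by (simp add: point_prob_def)

lemma point_prob_outside: "i \<notin> X ` space M \<Longrightarrow> point_prob M X i = 0"
proof -
  assume "i \<notin> X ` space M"
  then have empty: "{x \<in> space M. X x = i} = {}" by auto
  show ?thesis unfolding point_prob_def empty by simp
qed

lemma rv_entropy_cong:
  assumes "\<And>x. x \<in> space M \<Longrightarrow> X x = Y x"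
  shows "rv_entropy M X = rv_entropy M Y"
proof -
  have "point_prob M X = point_prob M Y"
    unfolding point_prob_def using assms by (auto intro!: ext arg_cong[of _ _ "measure M"])
  moreover have "X ` space M = Y ` space M" using assms by (auto simp: image_def)
  ultimately show ?thesis by (simp add: rv_entropy_def)
qed

lemma rv_entropy_superset:
  assumes "finite I" "X ` space M \<subseteq> I"
  shows "rv_entropy M X = - (\<Sum>i\<in>I. point_prob M X i * ln (point_prob M X i))"
  unfolding rv_entropy_def using assms by (auto intro!: sum.mono_neutral_left simp: point_prob_outside)

lemma simple_function_level_sets:
  "simple_function M X \<Longrightarrow> {x \<in> space M. X x = i} \<in> sets M"
  using simple_functionD(2)[of M X "{i}"] by (simp add: vimage_def Int_def conj_commute)

context prob_space
begin

lemma point_prob_le_1: "point_prob M X i \<le> 1"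
  by (simp add: point_prob_def)

lemma
  fixes g :: "'b \<Rightarrow> real"
  assumes X: "simple_function M X"
  shows integral_simple_function: "(\<integral>x. g (X x) \<partial>M) = (\<Sum>i\<in>X ` space M. point_prob M X i * g i)"
    and integrable_simple_function: "integrable M (\<lambda>x. g (X x))"
proof -
  let ?I = "\<lambda>i. indicator {x \<in> space M. X x = i} :: 'a \<Rightarrow> real"
  have fin: "finite (X ` space M)" using X by (rule simple_functionD)
  have int: "integrable M (\<lambda>x. ?I i x * g i)" for i
    using simple_function_level_sets[OF X] by (auto simp: emeasure_eq_measure)
  have eq: "g (X x) = (\<Sum>i\<in>X ` space M. ?I i x * g i)" if "x \<in> space M" for x
  proof -
    have "(\<Sum>i\<in>X ` space M. ?I i x * g i) = (\<Sum>i\<in>X ` space M. if i = X x then g i else 0)"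
      using that by (intro sum.cong) (auto simp: indicator_def)
    then show ?thesis using fin that by simp
  qed
  have "integrable M (\<lambda>x. \<Sum>i\<in>X ` space M. ?I i x * g i)"
    by (rule Bochner_Integration.integrable_sum[OF int])
  then show "integrable M (\<lambda>x. g (X x))"
    by (subst Bochner_Integration.integrable_cong[OF refl eq]) auto
  have "(\<integral>x. g (X x) \<partial>M) = (\<integral>x. (\<Sum>i\<in>X ` space M. ?I i x * g i) \<partial>M)"
    by (rule Bochner_Integration.integral_cong[OF refl eq])
  also have "\<dots> = (\<Sum>i\<in>X ` space M. \<integral>x. ?I i x * g i \<partial>M)"
    by (rule Bochner_Integration.integral_sum[OF int])
  also have "\<dots> = (\<Sum>i\<in>X ` space M. point_prob M X i * g i)"
    using simple_function_level_sets[OF X] by (intro sum.cong) (auto simp: point_prob_def emeasure_eq_measure)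
  finally show "(\<integral>x. g (X x) \<partial>M) = (\<Sum>i\<in>X ` space M. point_prob M X i * g i)" .
qed

lemma sum_point_prob: "simple_function M X \<Longrightarrow> (\<Sum>i\<in>X ` space M. point_prob M X i) = 1"
  using integral_simple_function[of X "\<lambda>_. 1"] by (simp add: prob_space)

lemma rv_entropy_integral: "simple_function M X \<Longrightarrow> rv_entropy M X = - (\<integral>x. ln (point_prob M X (X x)) \<partial>M)"
  using integral_simple_function[of X "\<lambda>i. ln (point_prob M X i)"] by (simp add: rv_entropy_def)

lemma rv_entropy_nonneg: "0 \<le> rv_entropy M X"
proof -
  have "point_prob M X i * ln (point_prob M X i) \<le> 0" for i
  proof (cases "point_prob M X i = 0")
    case False
    then have "0 < point_prob M X i" using point_prob_nonneg[of M X i] by linarith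
    then show ?thesis using point_prob_le_1[of X i] by (intro mult_nonneg_nonpos) auto
  qed simp
  then show ?thesis by (simp add: rv_entropy_def sum_nonpos)
qed

lemma point_prob_compose_ge:
  assumes "simple_function M X"
  shows "point_prob M X i \<le> point_prob M (\<lambda>x. f (X x)) (f i)"
  unfolding point_prob_def
  using simple_function_level_sets[OF simple_function_compose1[OF assms, of f], of "f i"]
  by (intro finite_measure_mono) auto

text \<open>The value \<open>i\<close> of \<open>X\<close> is at most as probable as the value
  \<open>f i\<close> of the coarser map, and the logarithm is monotone.\<close>

lemma rv_entropy_compose_le:
  assumes X: "simple_function M X"
  shows "rv_entropy M (\<lambda>x. f (X x)) \<le> rv_entropy M X"
proof -
  have "(\<Sum>i\<in>X ` space M. point_prob M X i * ln (point_prob M X i)) \<le>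
        (\<Sum>i\<in>X ` space M. point_prob M X i * ln (point_prob M (\<lambda>x. f (X x)) (f i)))"
  proof (intro sum_mono)
    fix i
    show "point_prob M X i * ln (point_prob M X i) \<le> point_prob M X i * ln (point_prob M (\<lambda>x. f (X x)) (f i))"
    proof (cases "point_prob M X i = 0")
      case False
      then have "0 < point_prob M X i" using point_prob_nonneg[of M X i] by linarith
      then show ?thesis using point_prob_compose_ge[OF X, of i f] by (intro mult_left_mono) auto
    qed simp
  qed
  also have "\<dots> = (\<integral>x. ln (point_prob M (\<lambda>x. f (X x)) (f (X x))) \<partial>M)"
    using integral_simple_function[OF X, of "\<lambda>i. ln (point_prob M (\<lambda>x. f (X x)) (f i))"] by simp
  finally show ?thesis
    by (simp add: rv_entropy_integral[OF simple_function_compose1[OF X]] rv_entropy_def[of M X])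
qed

text \<open>An injective \<open>f\<close> can be undone by another composition, so the inequality
  for coarsenings applies in both directions.\<close>

lemma rv_entropy_compose_inj:
  assumes X: "simple_function M X" and inj: "inj_on f (X ` space M)"
  shows "rv_entropy M (\<lambda>x. f (X x)) = rv_entropy M X"
proof -
  have "rv_entropy M X = rv_entropy M (\<lambda>x. inv_into (X ` space M) f (f (X x)))"
    using inj by (intro rv_entropy_cong) simp
  also have "\<dots> \<le> rv_entropy M (\<lambda>x. f (X x))"
    by (rule rv_entropy_compose_le[OF simple_function_compose1[OF X]])
  finally show ?thesis using rv_entropy_compose_le[OF X, of f] by linarith
qed

text \<open>Gibbs' inequality against the joint weights \<open>P(Y = b) \<kappa> b a\<close>, where the kernel \<open>\<kappa>\<close> is an
  arbitrary guess for the conditional law of \<open>X\<close> given \<open>Y\<close>.\<close>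

lemma rv_entropy_pair_le:
  assumes X: "simple_function M X" and Y: "simple_function M Y"
    and pos: "\<And>a b. point_prob M X a > 0 \<Longrightarrow> \<kappa> b a > 0"
    and nonneg: "\<And>a b. \<kappa> b a \<ge> 0"
    and sum: "\<And>b. (\<Sum>a\<in>X ` space M. \<kappa> b a) \<le> 1"
  shows "rv_entropy M (\<lambda>x. (X x, Y x)) \<le> rv_entropy M Y - (\<integral>x. ln (\<kappa> (Y x) (X x)) \<partial>M)"
proof -
  let ?Z = "\<lambda>x. (X x, Y x)"
  let ?p = "point_prob M ?Z"
  let ?q = "\<lambda>z. point_prob M Y (snd z) * \<kappa> (snd z) (fst z)"
  have Z: "simple_function M ?Z" using X Y by (rule simple_function_Pair)
  have finX: "finite (X ` space M)" and finY: "finite (Y ` space M)"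
    using X Y by (auto dest: simple_functionD)
  have pX: "?p z \<le> point_prob M X (fst z)" and pY: "?p z \<le> point_prob M Y (snd z)" for z
    using point_prob_compose_ge[OF Z, of z fst] point_prob_compose_ge[OF Z, of z snd] by auto
  have qpos: "0 < point_prob M Y (snd z) \<and> 0 < \<kappa> (snd z) (fst z)" if "0 < ?p z" for z
    using that pX[of z] pY[of z] pos[of "fst z" "snd z"] by force
  \<comment> \<open>Passing from the attained pairs to the full product of the two ranges only
    increases the sum, which then splits into the kernel sums.\<close>
  have "(\<Sum>z\<in>?Z ` space M. ?q z) \<le> (\<Sum>z\<in>X ` space M \<times> Y ` space M. ?q z)"
    using finX finY nonneg by (intro sum_mono2) auto
  also have "\<dots> = (\<Sum>a\<in>X ` space M. \<Sum>b\<in>Y ` space M. point_prob M Y b * \<kappa> b a)"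
    by (simp add: sum.cartesian_product case_prod_unfold)
  also have "\<dots> = (\<Sum>b\<in>Y ` space M. point_prob M Y b * (\<Sum>a\<in>X ` space M. \<kappa> b a))"
    by (subst sum.swap) (simp add: sum_distrib_left)
  also have "\<dots> \<le> (\<Sum>b\<in>Y ` space M. point_prob M Y b * 1)"
    by (intro sum_mono mult_left_mono sum) auto
  also have "\<dots> = 1" using sum_point_prob[OF Y] by simp
  finally have qsum: "(\<Sum>z\<in>?Z ` space M. ?q z) \<le> (\<Sum>z\<in>?Z ` space M. ?p z)"
    using sum_point_prob[OF Z] by simp
  have "(\<Sum>z\<in>?Z ` space M. ?p z * ln (?q z)) \<le> (\<Sum>z\<in>?Z ` space M. ?p z * ln (?p z))"
    using simple_functionD(1)[OF Z] qpos qsum nonneg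
    by (intro gibbs_inequality) (auto intro!: mult_nonneg_nonneg mult_pos_pos)
  moreover have "(\<Sum>z\<in>?Z ` space M. ?p z * ln (?q z)) =
      (\<Sum>z\<in>?Z ` space M. ?p z * (ln (point_prob M Y (snd z)) + ln (\<kappa> (snd z) (fst z))))"
  proof (intro sum.cong refl)
    fix z
    show "?p z * ln (?q z) = ?p z * (ln (point_prob M Y (snd z)) + ln (\<kappa> (snd z) (fst z)))"
      using qpos[of z] point_prob_nonneg[of M ?Z z] by (cases "?p z = 0") (auto simp: ln_mult less_le)
  qed
  moreover have "\<dots> = (\<integral>x. ln (point_prob M Y (Y x)) + ln (\<kappa> (Y x) (X x)) \<partial>M)"
    using integral_simple_function[OF Z, of "\<lambda>z. ln (point_prob M Y (snd z)) + ln (\<kappa> (snd z) (fst z))"]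
    by simp
  moreover have "\<dots> = (\<integral>x. ln (point_prob M Y (Y x)) \<partial>M) + (\<integral>x. ln (\<kappa> (Y x) (X x)) \<partial>M)"
    using integrable_simple_function[OF Y, of "\<lambda>b. ln (point_prob M Y b)"]
      integrable_simple_function[OF Z, of "\<lambda>z. ln (\<kappa> (snd z) (fst z))"]
    by (intro Bochner_Integration.integral_add) simp_all
  ultimately show ?thesis
    unfolding rv_entropy_integral[OF Y] rv_entropy_def[of M ?Z] by linarith
qed

text \<open>The kernel that guesses the unconditional law of \<open>X\<close>, whatever the value of
  \<open>Y\<close>.\<close>

lemma rv_entropy_subadditive:
  assumes X: "simple_function M X" and Y: "simple_function M Y"
  shows "rv_entropy M (\<lambda>x. (X x, Y x)) \<le> rv_entropy M X + rv_entropy M Y"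
  using rv_entropy_pair_le[OF X Y, of "\<lambda>_. point_prob M X"] sum_point_prob[OF X] rv_entropy_integral[OF X] by simp

end

text \<open>The limit is the infimum of \<open>a n / n\<close>, finite by nonnegativity. For a
  \<open>k\<close> with \<open>a k / k\<close> close to it, division of \<open>n\<close> by
  \<open>k\<close> leaves a remainder whose value under \<open>a\<close> is at most the maximum
  \<open>A\<close> over all remainders, so \<open>A / n\<close> vanishes.\<close>

lemma fekete:
  fixes a :: "nat \<Rightarrow> real"
  assumes nonneg: "\<And>n. 0 \<le> a n" and sub: "\<And>m n. a (m + n) \<le> a m + a n"
  obtains L where "(\<lambda>n. a n / n) \<longlonglongrightarrow> L" "\<And>n. n > 0 \<Longrightarrow> L \<le> a n / n"
proof -
  define L where "L = (INF n\<in>{0<..}. a n / real n)"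
  have bdd: "bdd_below ((\<lambda>n. a n / real n) ` {0<..})"
    by (rule bdd_belowI[of _ 0]) (auto simp: nonneg)
  have L_le: "L \<le> a n / n" if "n > 0" for n
    unfolding L_def using that bdd by (intro cINF_lower) auto
  have mult: "a (q * k + r) \<le> q * a k + a r" for q k r
  proof (induction q)
    case (Suc q)
    have "a (Suc q * k + r) \<le> a k + a (q * k + r)"
      using sub[of k "q * k + r"] by (simp add: add.assoc)
    also have "\<dots> \<le> a k + (q * a k + a r)" using Suc by simp
    finally show ?case by (simp add: algebra_simps)
  qed simp
  have "(\<lambda>n. a n / n) \<longlonglongrightarrow> L"
  proof (rule order_tendstoI)
    fix y assume "y < L"
    then show "\<forall>\<^sub>F n in sequentially. y < a n / n"
      using L_le by (intro eventually_mono[OF eventually_gt_at_top[of 0]] less_le_trans[OF _ L_le])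
  next
    fix y assume "L < y"
    then obtain k where k: "k > 0" "a k / real k < y"
      unfolding L_def using cINF_less_iff[OF _ bdd] by auto
    define A where "A = Max (a ` {..<k})"
    have A: "a r \<le> A" if "r < k" for r unfolding A_def using that by auto
    have A0: "0 \<le> A" using A[of 0] nonneg[of 0] k by linarith
    have bound: "a n / n \<le> a k / k + A / n" if n: "n > 0" for n
    proof -
      have "a n \<le> (n div k) * a k + a (n mod k)"
        using mult[of "n div k" k "n mod k"] by simp
      also have "\<dots> \<le> (real n / real k) * a k + A"
      proof (intro add_mono mult_right_mono)
        have "real (n div k) * real k \<le> real n"
          by (metis div_times_less_eq_dividend of_nat_le_iff of_nat_mult)
        then show "real (n div k) \<le> real n / real k" using k by (simp add: field_simps)
      qed (use A k nonneg in auto)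
      finally have "a n / n \<le> ((real n / real k) * a k + A) / n"
        using n by (intro divide_right_mono) auto
      then show ?thesis using n by (simp add: add_divide_distrib)
    qed
    have "(\<lambda>n. a k / k + A / n) \<longlonglongrightarrow> a k / k + 0"
      by (intro tendsto_add tendsto_const lim_const_over_n)
    then have "\<forall>\<^sub>F n in sequentially. a k / k + A / n < y"
      using k by (intro order_tendstoD) auto
    then show "\<forall>\<^sub>F n in sequentially. a n / n < y"
      using eventually_gt_at_top[of 0] by eventually_elim (rule le_less_trans[OF bound])
  qed
  then show ?thesis using L_le by (rule that)
qed

section \<open>Itineraries and entropy rates of measure-preserving maps\<close>

definition measure_preserving :: "'a measure \<Rightarrow> ('a \<Rightarrow> 'a) \<Rightarrow> bool" where
  "measure_preserving M T \<longleftrightarrow> T \<in> measurable M M \<and>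
     (\<forall>A\<in>sets M. emeasure M (T -` A \<inter> space M) = emeasure M A)"

text \<open>The itinerary of \<open>x\<close> under \<open>T\<close> during \<open>n\<close> steps,
  as observed through \<open>X\<close>. It encodes the iterated join of the partition into level
  sets of \<open>X\<close>.\<close>

definition names :: "('a \<Rightarrow> 'b) \<Rightarrow> ('a \<Rightarrow> 'a) \<Rightarrow> nat \<Rightarrow> 'a \<Rightarrow> 'b list" where
  "names X T n x = map (\<lambda>k. X ((T ^^ k) x)) [0..<n]"

lemma length_names [simp]: "length (names X T n x) = n"
  by (simp add: names_def)

lemma names_add: "names X T (m + n) x = names X T m x @ names X T n ((T ^^ m) x)"
proof -
  have shift: "(T ^^ i) x = (T ^^ (i - m)) ((T ^^ m) x)" if "\<not> i < m" for i
    using that funpow_add[of "i - m" m T] by simp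
  show ?thesis
  proof (rule nth_equalityI)
    fix i assume "i < length (names X T (m + n) x)"
    then show "names X T (m + n) x ! i = (names X T m x @ names X T n ((T ^^ m) x)) ! i"
      using arg_cong[OF shift, of i X] by (cases "i < m") (simp_all add: names_def nth_append)
  qed simp
qed

locale mp_system = prob_space M for M :: "'a measure" +
  fixes T :: "'a \<Rightarrow> 'a"
  assumes mp: "measure_preserving M T"
begin

lemma measurable_T: "T \<in> measurable M M"
  using mp by (simp add: measure_preserving_def)

lemma measurable_funpow: "T ^^ k \<in> measurable M M"
  by (induction k) (auto intro: measurable_comp measurable_T simp: comp_def measurable_compose[OF _ measurable_T])

lemma funpow_space: "x \<in> space M \<Longrightarrow> (T ^^ k) x \<in> space M"
  by (rule measurable_space[OF measurable_funpow])

lemma emeasure_funpow: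
  assumes "A \<in> sets M"
  shows "emeasure M ((T ^^ k) -` A \<inter> space M) = emeasure M A"
proof (induction k)
  case 0
  then show ?case using sets.sets_into_space[OF assms] by (simp add: Int_absorb2)
next
  case (Suc k)
  let ?B = "(T ^^ k) -` A \<inter> space M"
  have B: "?B \<in> sets M" by (rule measurable_sets[OF measurable_funpow assms])
  have eq: "(T ^^ Suc k) -` A \<inter> space M = T -` ?B \<inter> space M"
    using measurable_space[OF measurable_T] by (auto simp: funpow_swap1)
  have "emeasure M (T -` ?B \<inter> space M) = emeasure M ?B"
    using mp B unfolding measure_preserving_def by blast
  then show ?case unfolding eq using Suc by (simp only:)
qed

lemma distr_funpow: "distr M M (T ^^ k) = M"
  by (rule measure_eqI) (auto simp: emeasure_distr measurable_funpow emeasure_funpow)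

lemma integral_funpow:
  fixes f :: "'a \<Rightarrow> real"
  assumes "f \<in> borel_measurable M"
  shows "(\<integral>x. f ((T ^^ k) x) \<partial>M) = (\<integral>x. f x \<partial>M)"
  using integral_distr[OF measurable_funpow assms, of k] by (simp add: distr_funpow)

lemma simple_function_funpow:
  assumes "simple_function M X"
  shows "simple_function M (\<lambda>x. X ((T ^^ k) x))"
  unfolding simple_function_def
proof (intro conjI ballI)
  have "(\<lambda>x. X ((T ^^ k) x)) ` space M \<subseteq> X ` space M"
    using funpow_space by auto
  then show "finite ((\<lambda>x. X ((T ^^ k) x)) ` space M)"
    using simple_functionD(1)[OF assms] finite_subset by blast
  fix y
  have "(\<lambda>x. X ((T ^^ k) x)) -` {y} \<inter> space M = (T ^^ k) -` (X -` {y} \<inter> space M) \<inter> space M"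
    using funpow_space by auto
  then show "(\<lambda>x. X ((T ^^ k) x)) -` {y} \<inter> space M \<in> sets M"
    using measurable_sets[OF measurable_funpow simple_functionD(2)[OF assms]] by simp
qed

lemma rv_entropy_funpow:
  assumes X: "simple_function M X"
  shows "rv_entropy M (\<lambda>x. X ((T ^^ k) x)) = rv_entropy M X"
proof -
  have "point_prob M (\<lambda>x. X ((T ^^ k) x)) i = point_prob M X i" for i
  proof -
    have eq: "{x \<in> space M. X ((T ^^ k) x) = i} = (T ^^ k) -` {x \<in> space M. X x = i} \<inter> space M"
      using funpow_space by auto
    show ?thesis
      unfolding point_prob_def measure_def eq emeasure_funpow[OF simple_function_level_sets[OF X]] ..
  qed
  moreover have "(\<lambda>x. X ((T ^^ k) x)) ` space M \<subseteq> X ` space M"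
    using funpow_space by auto
  ultimately show ?thesis
    using rv_entropy_superset[OF simple_functionD(1)[OF X], where M = M and X = "\<lambda>x. X ((T ^^ k) x)"]
    by (simp add: rv_entropy_def)
qed

lemma simple_function_names:
  assumes X: "simple_function M X"
  shows "simple_function M (names X T n)"
proof (induction n)
  case 0
  have "names X T 0 = (\<lambda>_. [])" by (simp add: names_def fun_eq_iff)
  then show ?case by simp
next
  case (Suc n)
  have "names X T (Suc n) = (\<lambda>x. (\<lambda>(a, b). a @ [b]) (names X T n x, X ((T ^^ n) x)))"
    by (simp add: names_def fun_eq_iff)
  then show ?case
    using simple_function_compose1[OF simple_function_Pair[OF Suc simple_function_funpow[OF X, of n]],
        of "\<lambda>(a, b). a @ [b]"] by (simp only:)
qed

text \<open>A name of length \<open>m + n\<close> is a concatenation whose second part is the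
  \<open>n\<close>-name of the \<open>m\<close>-th iterate; by invariance that part has the entropy
  of the \<open>n\<close>-name itself.\<close>

lemma rv_entropy_names_subadditive:
  assumes X: "simple_function M X"
  shows "rv_entropy M (names X T (m + n)) \<le> rv_entropy M (names X T m) + rv_entropy M (names X T n)"
proof -
  let ?N = "names X T"
  have s: "simple_function M (\<lambda>x. (?N m x, ?N n ((T ^^ m) x)))"
    by (intro simple_function_Pair simple_function_funpow simple_function_names X)
  have "rv_entropy M (?N (m + n)) = rv_entropy M (\<lambda>x. (\<lambda>(a, b). a @ b) (?N m x, ?N n ((T ^^ m) x)))"
    by (simp add: names_add[abs_def])
  also have "\<dots> \<le> rv_entropy M (\<lambda>x. (?N m x, ?N n ((T ^^ m) x)))"
    by (rule rv_entropy_compose_le[OF s])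
  also have "\<dots> \<le> rv_entropy M (?N m) + rv_entropy M (\<lambda>x. ?N n ((T ^^ m) x))"
    by (intro rv_entropy_subadditive simple_function_funpow simple_function_names X)
  finally show ?thesis by (simp add: rv_entropy_funpow simple_function_names X)
qed

lemma entropy_rate:
  assumes X: "simple_function M X"
  obtains L where "(\<lambda>n. rv_entropy M (names X T n) / n) \<longlonglongrightarrow> L"
    "\<And>n. n > 0 \<Longrightarrow> L \<le> rv_entropy M (names X T n) / n"
  by (rule fekete[of "\<lambda>n. rv_entropy M (names X T n)", OF rv_entropy_nonneg rv_entropy_names_subadditive[OF X]]) (rule that)

section \<open>Finite partitions as maps to their cells\<close>

definition cell_of :: "'a set set \<Rightarrow> 'a \<Rightarrow> 'a set" where
  "cell_of \<xi> x = (THE A. A \<in> \<xi> \<and> x \<in> A)"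

lemma cell_of_eq:
  assumes "measurable_partition M \<xi>" "A \<in> \<xi>" "x \<in> A"
  shows "cell_of \<xi> x = A"
  unfolding cell_of_def
proof (rule the_equality)
  fix B assume "B \<in> \<xi> \<and> x \<in> B"
  then show "B = A"
    using assms unfolding measurable_partition_def partition_on_def disjoint_def by blast
qed (use assms in auto)

lemma cell_of:
  assumes "measurable_partition M \<xi>" "x \<in> space M"
  shows "cell_of \<xi> x \<in> \<xi> \<and> x \<in> cell_of \<xi> x"
proof -
  obtain A where "A \<in> \<xi>" "x \<in> A"
    using assms unfolding measurable_partition_def partition_on_def by blast
  then show ?thesis using cell_of_eq[OF assms(1)] by auto
qed

lemma cell_of_iff:
  assumes "measurable_partition M \<xi>" "x \<in> space M" "A \<in> \<xi>"
  shows "cell_of \<xi> x = A \<longleftrightarrow> x \<in> A"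
  using cell_of[OF assms(1,2)] cell_of_eq[OF assms(1,3)] by auto

lemma simple_function_cell_of:
  assumes \<xi>: "measurable_partition M \<xi>"
  shows "simple_function M (cell_of \<xi>)"
  unfolding simple_function_def
proof (intro conjI ballI)
  have sub: "cell_of \<xi> ` space M \<subseteq> \<xi>" using cell_of[OF \<xi>] by auto
  then show "finite (cell_of \<xi> ` space M)"
    using \<xi> finite_subset unfolding measurable_partition_def by blast
  fix A assume "A \<in> cell_of \<xi> ` space M"
  then have A: "A \<in> \<xi>" using sub by auto
  then have "A \<in> sets M" using \<xi> unfolding measurable_partition_def by auto
  moreover have "cell_of \<xi> -` {A} \<inter> space M = A"
    using cell_of_iff[OF \<xi> _ A] sets.sets_into_space[OF \<open>A \<in> sets M\<close>] by auto
  ultimately show "cell_of \<xi> -` {A} \<inter> space M \<in> sets M" by simp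
qed

text \<open>The nonempty cells of the join correspond bijectively to the attained names. Removing
  the empty set in \<open>iterated_join\<close> matches taking names of actual points only.\<close>

lemma partition_entropy_iterated_join:
  assumes \<xi>: "measurable_partition M \<xi>"
  shows "partition_entropy M (iterated_join M T \<xi> n) = rv_entropy M (names (cell_of \<xi>) T n)"
proof -
  let ?N = "names (cell_of \<xi>) T n"
  define C where "C w = {x \<in> space M. ?N x = w}" for w
  have cell: "space M \<inter> (\<Inter>k<n. (T ^^ k) -` A k) = C (map A [0..<n])" if "\<forall>k<n. A k \<in> \<xi>" for A
  proof (rule set_eqI)
    fix x
    have "?N x = map A [0..<n] \<longleftrightarrow> (\<forall>k<n. cell_of \<xi> ((T ^^ k) x) = A k)"
      by (auto simp: names_def)
    moreover have "cell_of \<xi> ((T ^^ k) x) = A k \<longleftrightarrow> (T ^^ k) x \<in> A k" if "x \<in> space M" "k < n" for k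
      using cell_of_iff[OF \<xi> funpow_space] that \<open>\<forall>k<n. A k \<in> \<xi>\<close> by blast
    ultimately show "x \<in> space M \<inter> (\<Inter>k<n. (T ^^ k) -` A k) \<longleftrightarrow> x \<in> C (map A [0..<n])"
      by (auto simp: C_def)
  qed
  have "iterated_join M T \<xi> n = C ` (?N ` space M)"
  proof (intro equalityI subsetI)
    fix B assume "B \<in> iterated_join M T \<xi> n"
    then obtain A where A: "\<forall>k<n. A k \<in> \<xi>" "B = space M \<inter> (\<Inter>k<n. (T ^^ k) -` A k)" "B \<noteq> {}"
      unfolding iterated_join_def mem_Collect_eq Diff_iff by blast
    have B: "B = C (map A [0..<n])" unfolding A(2) by (rule cell[OF A(1)])
    obtain x where "x \<in> B" using A(3) by auto
    then have "x \<in> space M" "?N x = map A [0..<n]" using B by (auto simp: C_def)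
    then have "B = C (?N x)" using B by (simp only:)
    then show "B \<in> C ` (?N ` space M)"
      using imageI[OF imageI[OF \<open>x \<in> space M\<close>], of C ?N] by (simp only:)
  next
    fix B assume "B \<in> C ` (?N ` space M)"
    then obtain x where x: "x \<in> space M" "B = C (?N x)" by blast
    have mem: "\<forall>k<n. cell_of \<xi> ((T ^^ k) x) \<in> \<xi>" using cell_of[OF \<xi> funpow_space[OF x(1)]] by auto
    have "B = space M \<inter> (\<Inter>k<n. (T ^^ k) -` cell_of \<xi> ((T ^^ k) x))"
      using cell[OF mem] x(2) unfolding names_def by (simp only:)
    moreover have "x \<in> B" unfolding x(2) C_def using x(1) by blast
    ultimately show "B \<in> iterated_join M T \<xi> n"
      unfolding iterated_join_def mem_Collect_eq Diff_iff using mem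
      by (intro conjI exI[of _ "\<lambda>k. cell_of \<xi> ((T ^^ k) x)"]) auto
  qed
  moreover have point_prob: "point_prob M ?N w = measure M (C w)" for w
    by (simp add: point_prob_def C_def)
  moreover have "inj_on C (?N ` space M)"
    by (rule inj_onI) (auto simp: C_def set_eq_iff)
  ultimately show ?thesis
    by (simp add: partition_entropy_def rv_entropy_def sum.reindex point_prob)
qed

lemma lim_partition_entropy:
  assumes \<xi>: "measurable_partition M \<xi>"
    and L: "(\<lambda>n. rv_entropy M (names (cell_of \<xi>) T n) / n) \<longlonglongrightarrow> L"
  shows "lim (\<lambda>n. 1 / real n * partition_entropy M (iterated_join M T \<xi> n)) = L"
  using limI[OF L] by (simp add: partition_entropy_iterated_join[OF \<xi>] divide_simps)

end

section \<open>Cylinder sets\<close>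

text \<open>Distributivity. It shows that a kernel acting independently at each position of a list
  is normalised as soon as each of its factors is.\<close>

lemma sum_lists_prod:
  fixes f :: "nat \<Rightarrow> 'a \<Rightarrow> real"
  assumes "finite A"
  shows "(\<Sum>xs | set xs \<subseteq> A \<and> length xs = n. \<Prod>i<n. f i (xs ! i)) = (\<Prod>i<n. \<Sum>x\<in>A. f i x)"
proof (induction n arbitrary: f)
  case 0
  have "{xs. set xs \<subseteq> A \<and> length xs = 0} = {[]}" by auto
  then show ?case by simp
next
  case (Suc n)
  let ?L = "{xs. set xs \<subseteq> A \<and> length xs = n}"
  have inj: "inj_on (\<lambda>(xs, x). x # xs) (?L \<times> A)" by (auto simp: inj_on_def)
  have "(\<Sum>xs | set xs \<subseteq> A \<and> length xs = Suc n. \<Prod>i<Suc n. f i (xs ! i)) =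
      (\<Sum>(xs, x)\<in>?L \<times> A. f 0 x * (\<Prod>i<n. f (Suc i) (xs ! i)))"
    unfolding lists_length_Suc_eq sum.reindex[OF inj]
    by (simp add: prod.lessThan_Suc_shift case_prod_unfold del: prod.lessThan_Suc)
  also have "\<dots> = (\<Sum>xs\<in>?L. \<Sum>x\<in>A. f 0 x * (\<Prod>i<n. f (Suc i) (xs ! i)))"
    by (simp add: sum.cartesian_product)
  also have "\<dots> = (\<Sum>x\<in>A. f 0 x) * (\<Sum>xs\<in>?L. \<Prod>i<n. f (Suc i) (xs ! i))"
    by (simp add: sum_distrib_left sum_distrib_right)
  also have "\<dots> = (\<Prod>i<Suc n. \<Sum>x\<in>A. f i x)"
    using Suc[of "\<lambda>i. f (Suc i)"] by (simp add: prod.lessThan_Suc_shift del: prod.lessThan_Suc)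
  finally show ?case .
qed

text \<open>The clopen sets decided by finitely many letters. They generate the Borel sets and carry
  both the extension and the approximation of measures.\<close>

definition cyl_algebra :: "('v, 'e) pre_digraph \<Rightarrow> (nat \<Rightarrow> 'e) set set" where
  "cyl_algebra G = {cyl G n W | n W. True}"

lemma cyl_algebraI: "cyl G n W \<in> cyl_algebra G"
  unfolding cyl_algebra_def by blast

text \<open>What \<open>n\<close> letters decide is decided by any larger number of letters; this
  brings two such sets to a common level.\<close>

lemma cyl_algebraE:
  assumes "A \<in> cyl_algebra G"
  obtains n W where "\<And>m. m \<ge> n \<Longrightarrow> A = cyl G m {w. take n w \<in> W}"
proof -
  obtain n W where A: "A = cyl G n W"
    using assms unfolding cyl_algebra_def by auto
  have "A = cyl G m {w. take n w \<in> W}" if "m \<ge> n" for m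
    unfolding A using that by (simp add: take_pre)
  then show ?thesis by (rule that)
qed

lemma cyl_algebra_subset: "cyl_algebra G \<subseteq> Pow (infinite_paths G)"
  unfolding cyl_algebra_def by auto

lemma algebra_cyl_algebra: "algebra (infinite_paths G) (cyl_algebra G)"
  unfolding algebra_iff_Un
proof (intro conjI ballI)
  show "cyl_algebra G \<subseteq> Pow (infinite_paths G)" by (rule cyl_algebra_subset)
  show "{} \<in> cyl_algebra G" using cyl_algebraI[of G 0 "{}"] by simp
next
  fix A assume "A \<in> cyl_algebra G"
  then obtain n W where A: "A = cyl G n W"
    unfolding cyl_algebra_def by auto
  have "infinite_paths G - A = cyl G n (- W)" unfolding A by auto
  then show "infinite_paths G - A \<in> cyl_algebra G" by (simp only: cyl_algebraI)
next
  fix A B assume "A \<in> cyl_algebra G" "B \<in> cyl_algebra G"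
  obtain n W where A: "\<And>l. l \<ge> n \<Longrightarrow> A = cyl G l {w. take n w \<in> W}"
    by (rule cyl_algebraE[OF \<open>A \<in> cyl_algebra G\<close>]) rule
  obtain m V where B: "\<And>l. l \<ge> m \<Longrightarrow> B = cyl G l {w. take m w \<in> V}"
    by (rule cyl_algebraE[OF \<open>B \<in> cyl_algebra G\<close>]) rule
  have "A \<union> B = cyl G (max n m) ({w. take n w \<in> W} \<union> {w. take m w \<in> V})"
    using A[of "max n m", OF max.cobounded1] B[of "max n m", OF max.cobounded2] by blast
  then show "A \<union> B \<in> cyl_algebra G" by (simp only: cyl_algebraI)
qed

lemma openin_cyl: "openin (path_topology G) (cyl G n W)"
  unfolding openin_path_topology by (auto intro!: exI[of _ n])

lemma closedin_cyl: "closedin (path_topology G) (cyl G n W)"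
proof -
  have "infinite_paths G - cyl G n W = cyl G n (- W)"
    by auto
  then show ?thesis using openin_cyl[of G n "- W"] by (auto simp: closedin_def)
qed

lemma space_borel_of_path [simp]: "space (borel_of (path_topology G)) = infinite_paths G"
  by (simp add: borel_of_def space_measure_of_conv)

lemma sets_borel_of_open:
  "sets (borel_of (path_topology G)) = sigma_sets (infinite_paths G) {A. openin (path_topology G) A}"
proof -
  have "{A. openin (path_topology G) A} \<subseteq> Pow (infinite_paths G)"
    using openin_subset[of "path_topology G"] by auto
  then show ?thesis unfolding borel_of_def by (simp add: sets_measure_of)
qed

lemma sets_borel_of_path:
  "sets (borel_of (path_topology G)) = sigma_sets (infinite_paths G) (cyl_algebra G)"
proof -
  have "sets (borel_of (path_topology G)) = sigma_sets (infinite_paths G) {A. openin (path_topology G) A}"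
    by (rule sets_borel_of_open)
  also have "\<dots> = sigma_sets (infinite_paths G) (cyl_algebra G)"
  proof (rule sigma_sets_eqI)
    fix A assume "A \<in> {A. openin (path_topology G) A}"
    then have A: "A \<subseteq> infinite_paths G" "\<And>u. u \<in> A \<Longrightarrow> \<exists>n. \<forall>v\<in>infinite_paths G. pre n v = pre n u \<longrightarrow> v \<in> A"
      by (auto simp: openin_path_topology)
    \<comment> \<open>An open set is the union, over the countably many lengths, of the cylinders
      that it contains.\<close>
    have "A = (\<Union>n. cyl G n {w. cylinder G w \<subseteq> A})"
    proof (intro equalityI subsetI)
      fix u assume u: "u \<in> A"
      obtain n where "\<forall>v\<in>infinite_paths G. pre n v = pre n u \<longrightarrow> v \<in> A" using A(2)[OF u] by auto
      then have "cylinder G (pre n u) \<subseteq> A" by (auto simp: mem_cylinder)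
      then show "u \<in> (\<Union>n. cyl G n {w. cylinder G w \<subseteq> A})"
        using A(1) u by blast
    next
      fix u assume "u \<in> (\<Union>n. cyl G n {w. cylinder G w \<subseteq> A})"
      then obtain n where "u \<in> infinite_paths G" "cylinder G (pre n u) \<subseteq> A" by auto
      then show "u \<in> A" using mem_cylinder_pre by blast
    qed
    also have "\<dots> \<in> sigma_sets (infinite_paths G) (cyl_algebra G)"
      by (intro sigma_sets.Union sigma_sets.Basic cyl_algebraI)
    finally show "A \<in> sigma_sets (infinite_paths G) (cyl_algebra G)" .
  next
    fix A assume "A \<in> cyl_algebra G"
    then have "openin (path_topology G) A" unfolding cyl_algebra_def using openin_cyl by auto
    then show "A \<in> sigma_sets (infinite_paths G) {A. openin (path_topology G) A}" by auto
  qed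
  finally show ?thesis .
qed

lemma borel_probsD:
  assumes "\<nu> \<in> path_probs G"
  shows "prob_space \<nu>" "sets \<nu> = sigma_sets (infinite_paths G) (cyl_algebra G)" "space \<nu> = infinite_paths G"
proof -
  show "prob_space \<nu>" "sets \<nu> = sigma_sets (infinite_paths G) (cyl_algebra G)"
    using assms by (auto simp: borel_probs_def sets_borel_of_path)
  show "space \<nu> = infinite_paths G"
    using assms sets_eq_imp_space_eq[of \<nu> "borel_of (path_topology G)"] by (auto simp: borel_probs_def)
qed

lemma cyl_in_sets:
  assumes "\<nu> \<in> path_probs G"
  shows "cyl G n W \<in> sets \<nu>"
  unfolding borel_probsD(2)[OF assms] by (intro sigma_sets.Basic cyl_algebraI)

lemma cylinder_in_sets:
  assumes "\<nu> \<in> path_probs G"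
  shows "cylinder G w \<in> sets \<nu>"
proof -
  have "cylinder G w = cyl G (length w) {w}" by (auto simp: mem_cylinder)
  then show ?thesis by (simp only: cyl_in_sets[OF assms])
qed

lemma continuous_map_measurable:
  assumes f: "path_continuous G f" and \<nu>: "\<nu> \<in> path_probs G"
  shows "f \<in> borel_measurable \<nu>"
proof (rule borel_measurableI)
  fix V :: "real set" assume "open V"
  then have "openin (path_topology G) {u \<in> topspace (path_topology G). f u \<in> V}"
    by (intro openin_continuous_map_preimage[OF f]) auto
  moreover have "f -` V \<inter> space \<nu> = {u \<in> topspace (path_topology G). f u \<in> V}"
    using borel_probsD(3)[OF \<nu>] by auto
  moreover have "openin (path_topology G) A \<Longrightarrow> A \<in> sets \<nu>" for A
    using \<nu> unfolding borel_probs_def by (auto simp: sets_borel_of_open)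
  ultimately show "f -` V \<inter> space \<nu> \<in> sets \<nu>" by simp
qed

text \<open>Functions of finitely many letters are locally constant.\<close>

lemma continuous_map_pre:
  fixes g :: "'e list \<Rightarrow> real"
  shows "path_continuous G (\<lambda>u. g (pre n u))"
  unfolding continuous_map_def
proof (intro conjI allI impI)
  fix V :: "real set"
  have "{u \<in> topspace (path_topology G). g (pre n u) \<in> V} = cyl G n (g -` V)"
    by auto
  then show "openin (path_topology G) {u \<in> topspace (path_topology G). g (pre n u) \<in> V}"
    using openin_cyl by metis
qed auto

context path_system
begin

lemma simple_function_pre:
  assumes \<nu>: "\<nu> \<in> path_probs G"
  shows "simple_function \<nu> (pre n)"
  unfolding simple_function_def
proof (intro conjI ballI)
  show "finite (pre n ` space \<nu>)"
    using finite_finite_paths[of n] pre_image[of n] borel_probsD(3)[OF \<nu>] by simp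
  fix w
  have "pre n -` {w} \<inter> space \<nu> = cyl G n {w}"
    using borel_probsD(3)[OF \<nu>] by auto
  then show "pre n -` {w} \<inter> space \<nu> \<in> sets \<nu>" by (simp only: cyl_in_sets[OF \<nu>])
qed

lemma integrable_continuous:
  assumes f: "path_continuous G f" and \<nu>: "\<nu> \<in> path_probs G"
  shows "integrable \<nu> f"
proof -
  interpret prob_space \<nu> by (rule borel_probsD(1)[OF \<nu>])
  obtain F where "F \<ge> 0" "\<And>u. u \<in> infinite_paths G \<Longrightarrow> \<bar>f u\<bar> \<le> F"
    by (rule continuous_bounded[OF f]) blast
  then show ?thesis
    using continuous_map_measurable[OF f \<nu>] borel_probsD(3)[OF \<nu>]
    by (intro integrable_const_bound[where B = F]) auto
qed

lemma shift_map_measurable: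
  assumes \<nu>: "\<nu> \<in> path_probs G"
  shows "shift_map \<in> measurable \<nu> \<nu>"
proof (rule measurable_sigma_sets[OF borel_probsD(2)[OF \<nu>] cyl_algebra_subset])
  show "shift_map \<in> space \<nu> \<rightarrow> infinite_paths G"
    using borel_probsD(3)[OF \<nu>] shift_map_infinite_paths by auto
  fix A assume "A \<in> cyl_algebra G"
  then obtain n W where A: "A = cyl G n W"
    unfolding cyl_algebra_def by auto
  have "shift_map -` A \<inter> space \<nu> = cyl G (Suc n) {w. tl w \<in> W}"
    using borel_probsD(3)[OF \<nu>] shift_map_infinite_paths unfolding A by (auto simp: pre_Suc_Cons)
  then show "shift_map -` A \<inter> space \<nu> \<in> sets \<nu>" by (simp only: cyl_in_sets[OF \<nu>])
qed

lemma mp_system_invariant: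
  assumes "\<nu> \<in> shift_probs G"
  shows "mp_system \<nu> shift_map"
proof -
  have \<nu>: "\<nu> \<in> path_probs G" using assms by (simp add: invariant_probs_def)
  interpret prob_space \<nu> by (rule borel_probsD(1)[OF \<nu>])
  show ?thesis
    by unfold_locales (use assms shift_map_measurable[OF \<nu>] in \<open>auto simp: measure_preserving_def invariant_probs_def\<close>)
qed

text \<open>If the shift preserved the mass of every cylinder set, \<nu> and its image would agree
  on an intersection-stable generator and hence be equal. So a failure of invariance is witnessed by
  a clopen set, whose indicator is a continuous observable.\<close>

lemma not_invariant_cylinder:
  assumes \<nu>: "\<nu> \<in> path_probs G" and ni: "\<nu> \<notin> shift_probs G"
  shows "\<exists>n W. measure \<nu> {u \<in> infinite_paths G. pre n (shift_map u) \<in> W} \<noteq>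
               measure \<nu> (cyl G n W)"
proof (rule ccontr)
  interpret prob_space \<nu> by (rule borel_probsD(1)[OF \<nu>])
  assume "\<not> ?thesis"
  then have eq: "\<And>n W. measure \<nu> {u \<in> infinite_paths G. pre n (shift_map u) \<in> W} =
               measure \<nu> (cyl G n W)" by simp
  note m = shift_map_measurable[OF \<nu>]
  have gen: "emeasure (distr \<nu> \<nu> shift_map) A = emeasure \<nu> A" if *: "A \<in> cyl_algebra G" for A
  proof -
    obtain n W where A: "A = cyl G n W"
      using * unfolding cyl_algebra_def by auto
    have "A \<in> sets \<nu>" unfolding A by (rule cyl_in_sets[OF \<nu>])
    moreover have "shift_map -` A \<inter> space \<nu> = {u \<in> infinite_paths G. pre n (shift_map u) \<in> W}"
      using borel_probsD(3)[OF \<nu>] shift_map_infinite_paths unfolding A by auto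
    ultimately show ?thesis
      using eq[of n W] by (simp add: emeasure_distr[OF m] emeasure_eq_measure A)
  qed
  interpret alg: algebra "infinite_paths G" "cyl_algebra G" by (rule algebra_cyl_algebra)
  have "distr \<nu> \<nu> shift_map = \<nu>"
  proof (rule measure_eqI_generator_eq[where A = "\<lambda>_. infinite_paths G"])
    show "Int_stable (cyl_algebra G)" by (auto simp: Int_stable_def)
  qed (use cyl_algebra_subset[of G] gen borel_probsD(2)[OF \<nu>] in \<open>auto simp: emeasure_eq_measure\<close>)
  then have "emeasure \<nu> (shift_map -` A \<inter> space \<nu>) = emeasure \<nu> A" if "A \<in> sets \<nu>" for A
    using emeasure_distr[OF m that] by simp
  then show False using \<nu> ni by (simp add: invariant_probs_def)
qed

text \<open>Induction over the generation of the Borel sets: approximability passes to complements,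
  where the symmetric difference is unchanged, and to countable unions.\<close>

lemma approx_by_cylinder:
  assumes \<nu>: "\<nu> \<in> path_probs G" and A: "A \<in> sets \<nu>" and "\<epsilon> > 0"
  shows "\<exists>C\<in>cyl_algebra G. measure \<nu> ((A - C) \<union> (C - A)) < \<epsilon>"
proof -
  interpret prob_space \<nu> by (rule borel_probsD(1)[OF \<nu>])
  interpret alg: algebra "infinite_paths G" "cyl_algebra G" by (rule algebra_cyl_algebra)
  have cyl: "C \<in> sets \<nu>" if "C \<in> cyl_algebra G" for C
    unfolding borel_probsD(2)[OF \<nu>] using that by (rule sigma_sets.Basic)
  have "A \<in> sigma_sets (infinite_paths G) (cyl_algebra G)" using A borel_probsD(2)[OF \<nu>] by simp
  then show ?thesis using \<open>\<epsilon> > 0\<close>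
  proof (induction A arbitrary: \<epsilon>)
    case (Basic A)
    then show ?case by (intro bexI[of _ A]) auto
  next
    case Empty
    then show ?case by (intro bexI[of _ "{}"]) auto
  next
    case (Compl A)
    then obtain C where C: "C \<in> cyl_algebra G" "measure \<nu> ((A - C) \<union> (C - A)) < \<epsilon>" by auto
    have "A \<subseteq> infinite_paths G"
      using Compl.hyps sigma_sets_into_sp[OF cyl_algebra_subset] by auto
    moreover have "C \<subseteq> infinite_paths G" using C(1) cyl_algebra_subset by auto
    ultimately have "((infinite_paths G - A) - (infinite_paths G - C)) \<union>
        ((infinite_paths G - C) - (infinite_paths G - A)) = (A - C) \<union> (C - A)" by auto
    then show ?case using C by (intro bexI[of _ "infinite_paths G - C"]) auto
  next
    case (Union A)
    have As: "A i \<in> sets \<nu>" for i using Union.hyps borel_probsD(2)[OF \<nu>] by simp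
    \<comment> \<open>The union is cut off after \<open>N\<close> sets with loss below \<epsilon>/2,
      and the \<open>N\<close> approximations share the other \<epsilon>/2. Dividing by
      \<open>N + 1\<close> avoids a zero denominator for \<open>N = 0\<close>.\<close>
    define B where "B N = (\<Union>i<N. A i)" for N :: nat
    have Bs: "B N \<in> sets \<nu>" for N using As by (auto simp: B_def)
    have UB: "(\<Union>i. A i) = (\<Union>N. B N)" by (auto simp: B_def)
    have "(\<lambda>N. measure \<nu> (B N)) \<longlonglongrightarrow> measure \<nu> (\<Union>N. B N)"
    proof (rule finite_Lim_measure_incseq)
      show "incseq B" unfolding B_def by (intro incseq_SucI UN_mono) auto
    qed (use Bs in blast)
    then have "\<forall>\<^sub>F N in sequentially. measure \<nu> (\<Union>N. B N) - \<epsilon> / 2 < measure \<nu> (B N)"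
      using Union.prems by (intro order_tendstoD(1)) auto
    then obtain N where N: "measure \<nu> (\<Union>N. B N) - \<epsilon> / 2 < measure \<nu> (B N)"
      by (auto simp: eventually_sequentially)
    have tail: "measure \<nu> ((\<Union>i. A i) - B N) < \<epsilon> / 2"
      using N Bs unfolding UB by (subst finite_measure_Diff) auto
    have "\<exists>C\<in>cyl_algebra G. measure \<nu> ((A i - C) \<union> (C - A i)) < \<epsilon> / (2 * (N + 1))" for i
      using Union.prems by (intro Union.IH) auto
    then obtain C where C: "\<And>i. C i \<in> cyl_algebra G"
        "\<And>i. measure \<nu> ((A i - C i) \<union> (C i - A i)) < \<epsilon> / (2 * (N + 1))"
      by metis
    let ?C = "\<Union>i<N. C i"
    have C1: "?C \<in> cyl_algebra G" using C(1) by auto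
    have "measure \<nu> (((\<Union>i. A i) - ?C) \<union> (?C - (\<Union>i. A i))) \<le>
        measure \<nu> (((\<Union>i. A i) - B N) \<union> (\<Union>i<N. (A i - C i) \<union> (C i - A i)))"
      using As Bs cyl[OF C(1)] by (intro finite_measure_mono) (auto simp: B_def)
    also have "\<dots> \<le> measure \<nu> ((\<Union>i. A i) - B N) + measure \<nu> (\<Union>i<N. (A i - C i) \<union> (C i - A i))"
      using As Bs cyl[OF C(1)] by (intro measure_Un_le) auto
    finally have 1: "measure \<nu> (((\<Union>i. A i) - ?C) \<union> (?C - (\<Union>i. A i))) \<le>
        measure \<nu> ((\<Union>i. A i) - B N) + measure \<nu> (\<Union>i<N. (A i - C i) \<union> (C i - A i))" .
    have "measure \<nu> (\<Union>i<N. (A i - C i) \<union> (C i - A i)) \<le> (\<Sum>i<N. measure \<nu> ((A i - C i) \<union> (C i - A i)))"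
      using As cyl[OF C(1)] by (intro finite_measure_subadditive_finite) auto
    also have "\<dots> \<le> (\<Sum>i<N. \<epsilon> / (2 * (N + 1)))"
      using C(2) by (intro sum_mono less_imp_le)
    also have "\<dots> = N / (N + 1) * (\<epsilon> / 2)" by (simp add: field_simps)
    also have "\<dots> \<le> 1 * (\<epsilon> / 2)" using Union.prems by (intro mult_right_mono) (auto simp: field_simps)
    finally show ?case using tail C1 1 by (intro bexI[of _ ?C]) auto
  qed
qed

end

section \<open>Kolmogorov--Sinai entropy through the partition into one-letter cylinders\<close>

context path_system
begin

lemma names_coordinate: "names (\<lambda>u. u 0) shift_map n u = pre n u"
  by (simp add: names_def pre_def shift_map_funpow)

lemma point_prob_pre:
  assumes "\<nu> \<in> path_probs G" "length w = n"
  shows "point_prob \<nu> (pre n) w = measure \<nu> (cylinder G w)"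
proof -
  have "{u \<in> space \<nu>. pre n u = w} = cylinder G w"
    unfolding borel_probsD(3)[OF assms(1)] assms(2)[symmetric] by (simp add: set_eq_iff mem_cylinder)
  then show ?thesis unfolding point_prob_def by (simp only:)
qed

text \<open>If no increment were below \<open>c\<close>, adding them up would give
  \<open>H\<^sub>n \<ge> n c\<close> for all n, and the partition into one-letter cylinders alone
  would force the entropy to be at least \<open>c\<close>.\<close>

lemma ks_entropy_generator_upper:
  fixes c :: real
  assumes inv: "\<nu> \<in> shift_probs G" and c: "ks_entropy shift_map \<nu> < ereal c"
  shows "\<exists>k. rv_entropy \<nu> (pre (Suc k)) - rv_entropy \<nu> (pre k) < c"
proof (rule ccontr)
  assume neg: "\<not> ?thesis"
  have \<nu>: "\<nu> \<in> path_probs G" using inv by (simp add: invariant_probs_def)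
  interpret mp_system \<nu> shift_map by (rule mp_system_invariant[OF inv])
  note sp = borel_probsD(3)[OF \<nu>]
  have c_le: "n * c \<le> rv_entropy \<nu> (pre n)" for n
  proof (induction n)
    case 0
    then show ?case using rv_entropy_nonneg[of "pre 0"] by (simp only: of_nat_0 mult_zero_left)
  next
    case (Suc n)
    have "c \<le> rv_entropy \<nu> (pre (Suc n)) - rv_entropy \<nu> (pre n)" using neg by (auto simp: not_less)
    then show ?case using Suc by (simp add: algebra_simps)
  qed
  \<comment> \<open>Only letters that begin some infinite path are taken, so that no cell is
    empty.\<close>
  define \<xi> where "\<xi> = (\<lambda>e. cylinder G [e]) ` (\<lambda>u. u 0) ` infinite_paths G"
  have cyl1: "cylinder G [e] = cyl G 1 {[e]}" for e
    by (auto simp: mem_cylinder)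
  have mem: "u \<in> cylinder G [e] \<longleftrightarrow> u \<in> infinite_paths G \<and> u 0 = e" for u e
    by (auto simp: mem_cylinder pre_def)
  have part: "measurable_partition \<nu> \<xi>"
    unfolding measurable_partition_def
  proof (intro conjI)
    have "(\<lambda>u. u 0) ` infinite_paths G \<subseteq> arcs G" by (auto simp: infinite_paths_def)
    then show "finite \<xi>" unfolding \<xi>_def using finite_subset[OF _ finite_arcs] by blast
    show "\<xi> \<subseteq> sets \<nu>" unfolding \<xi>_def cyl1 by (intro image_subsetI cyl_in_sets[OF \<nu>])
    show "partition_on (space \<nu>) \<xi>"
      unfolding partition_on_def sp disjoint_def \<xi>_def by (auto simp: mem)
  qed
  have cell: "cell_of \<xi> u = cylinder G [u 0]" if "u \<in> infinite_paths G" for u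
    by (rule cell_of_eq[OF part]) (use that in \<open>auto simp: \<xi>_def mem\<close>)
  have rv_entropy_eq: "rv_entropy \<nu> (names (cell_of \<xi>) shift_map n) = rv_entropy \<nu> (pre n)" for n
  proof -
    have nm: "names (cell_of \<xi>) shift_map n u = map (\<lambda>e. cylinder G [e]) (pre n u)" if "u \<in> space \<nu>" for u
    proof (rule nth_equalityI)
      fix i assume "i < length (names (cell_of \<xi>) shift_map n u)"
      then show "names (cell_of \<xi>) shift_map n u ! i = map (\<lambda>e. cylinder G [e]) (pre n u) ! i"
        using cell[of "(shift_map ^^ i) u"] that sp shift_map_funpow_infinite_paths[of u G i]
        by (simp add: names_def shift_map_funpow)
    qed simp
    have "rv_entropy \<nu> (names (cell_of \<xi>) shift_map n) = rv_entropy \<nu> (\<lambda>u. map (\<lambda>e. cylinder G [e]) (pre n u))"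
      by (rule rv_entropy_cong[OF nm])
    also have "\<dots> = rv_entropy \<nu> (pre n)"
    proof (rule rv_entropy_compose_inj[OF simple_function_pre[OF \<nu>]])
      \<comment> \<open>A cell determines its letter because it is nonempty: the i-th shift of
        \<open>u\<close> lies in it.\<close>
      show "inj_on (map (\<lambda>e. cylinder G [e])) (pre n ` space \<nu>)"
      proof (rule inj_onI, elim imageE)
        fix w w' u v assume *: "map (\<lambda>e. cylinder G [e]) w = map (\<lambda>e. cylinder G [e]) w'"
          "u \<in> space \<nu>" "w = pre n u" "v \<in> space \<nu>" "w' = pre n v"
        show "w = w'"
        proof (rule nth_equalityI)
          fix i assume "i < length w"
          then have i: "i < n" using * by simp
          have "cylinder G [w ! i] = cylinder G [w' ! i]"
            using arg_cong[OF *(1), of "\<lambda>l. l ! i"] i * by simp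
          moreover have "(shift_map ^^ i) u \<in> cylinder G [w ! i]"
            using * i sp shift_map_funpow_infinite_paths[of u G i] by (simp add: mem shift_map_funpow)
          ultimately show "w ! i = w' ! i"
            using * i by (auto simp: mem shift_map_funpow)
        qed (use * in simp)
      qed
    qed
    finally show ?thesis .
  qed
  obtain L where L: "(\<lambda>n. rv_entropy \<nu> (names (cell_of \<xi>) shift_map n) / n) \<longlonglongrightarrow> L"
    using entropy_rate[OF simple_function_cell_of[OF part]] by blast
  have "c \<le> L"
  proof (rule tendsto_lowerbound[OF L])
    show "\<forall>\<^sub>F n in sequentially. c \<le> rv_entropy \<nu> (names (cell_of \<xi>) shift_map n) / real n"
      using eventually_gt_at_top[of 0]
      by eventually_elim (use c_le in \<open>simp add: rv_entropy_eq field_simps\<close>)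
  qed simp
  also have "ereal L \<le> ks_entropy shift_map \<nu>"
    unfolding ks_entropy_def
    using part by (intro SUP_upper2[of \<xi>]) (simp_all only: lim_partition_entropy[OF part L] mem_Collect_eq order.refl)
  finally show False using c by simp
qed

text \<open>Every cell is approximated by a cylinder set, all of them at a common level
  \<open>l\<close>. A path outside all the symmetric differences lies in the approximation of its
  own cell and of no other one, so its prefix reveals the cell.\<close>

lemma predict_partition:
  assumes \<nu>: "\<nu> \<in> path_probs G" and \<xi>: "measurable_partition \<nu> \<xi>" and e: "e > 0"
    and cell: "\<And>u A. u \<in> infinite_paths G \<Longrightarrow> A \<in> \<xi> \<Longrightarrow> X u = A \<longleftrightarrow> u \<in> A"
    and X: "\<And>u. u \<in> infinite_paths G \<Longrightarrow> X u \<in> \<xi>"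
  shows "\<exists>l g. (\<forall>b. g b \<in> \<xi>) \<and> measure \<nu> {u \<in> infinite_paths G. X u \<noteq> g (pre l u)} < e"
proof -
  interpret prob_space \<nu> by (rule borel_probsD(1)[OF \<nu>])
  note sp = borel_probsD(3)[OF \<nu>]
  have fin: "finite \<xi>" and sets: "A \<in> \<xi> \<Longrightarrow> A \<in> sets \<nu>" for A
    using \<xi> by (auto simp: measurable_partition_def)
  obtain u0 where u0: "u0 \<in> infinite_paths G" using infinite_paths_nonempty by auto
  then have A0: "X u0 \<in> \<xi>" by (rule X)
  then have card: "card \<xi> > 0" using fin by (auto simp: card_gt_0_iff)
  have "\<exists>C\<in>cyl_algebra G. measure \<nu> ((A - C) \<union> (C - A)) < e / card \<xi>" if "A \<in> \<xi>" for A
    using approx_by_cylinder[OF \<nu> sets[OF that]] e card by simp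
  then obtain C where C: "\<And>A. A \<in> \<xi> \<Longrightarrow> C A \<in> cyl_algebra G"
      "\<And>A. A \<in> \<xi> \<Longrightarrow> measure \<nu> ((A - C A) \<union> (C A - A)) < e / card \<xi>"
    by metis
  have "\<exists>n. \<forall>m\<ge>n. \<exists>W. C A = cyl G m W" if "A \<in> \<xi>" for A
  proof (rule cyl_algebraE[OF C(1)[OF that]])
    fix k W assume *: "\<And>m. m \<ge> k \<Longrightarrow> C A = cyl G m {w. take k w \<in> W}"
    show ?thesis
    proof (intro exI[of _ k] allI impI)
      fix m assume "m \<ge> k"
      then show "\<exists>W. C A = cyl G m W" by (intro exI) (rule *)
    qed
  qed
  then have "\<forall>A\<in>\<xi>. \<exists>n. \<forall>m\<ge>n. \<exists>W. C A = cyl G m W" by (rule ballI)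
  from bchoice[OF this] obtain n
    where n: "\<And>A m. A \<in> \<xi> \<Longrightarrow> m \<ge> n A \<Longrightarrow> \<exists>W. C A = cyl G m W"
    by auto
  define l where "l = Max (n ` \<xi>)"
  have "n A \<le> l" if "A \<in> \<xi>" for A using that fin by (auto simp: l_def)
  then have "\<forall>A\<in>\<xi>. \<exists>W. C A = cyl G l W"
    by (intro ballI n)
  from bchoice[OF this] obtain W where W: "\<And>A. A \<in> \<xi> \<Longrightarrow> C A = cyl G l (W A)"
    by auto
  \<comment> \<open>A prefix may lie in several approximations, where the choice is arbitrary, or in
    none, where the cell of \<open>u0\<close> is the default. For prefixes of paths, both happen
    only inside the symmetric differences.\<close>
  define g where "g b = (if \<exists>A\<in>\<xi>. b \<in> W A then SOME A. A \<in> \<xi> \<and> b \<in> W A else X u0)" for b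
  have g1: "g b \<in> \<xi> \<and> b \<in> W (g b)" if ex: "\<exists>A\<in>\<xi>. b \<in> W A" for b
  proof -
    have "g b = (SOME A. A \<in> \<xi> \<and> b \<in> W A)" using ex by (simp add: g_def)
    then show ?thesis using someI_ex[of "\<lambda>A. A \<in> \<xi> \<and> b \<in> W A"] ex by auto
  qed
  have g: "g b \<in> \<xi>" for b
    using g1[of b] A0 by (cases "\<exists>A\<in>\<xi>. b \<in> W A") (auto simp: g_def)
  let ?D = "\<lambda>A. (A - C A) \<union> (C A - A)"
  have Cs: "C A \<in> sets \<nu>" if "A \<in> \<xi>" for A
    using W[OF that] cyl_in_sets[OF \<nu>] by simp
  have sub: "{u \<in> infinite_paths G. X u \<noteq> g (pre l u)} \<subseteq> (\<Union>A\<in>\<xi>. ?D A)"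
  proof
    fix u assume "u \<in> {u \<in> infinite_paths G. X u \<noteq> g (pre l u)}"
    then have u: "u \<in> infinite_paths G" and neq: "X u \<noteq> g (pre l u)" by auto
    have uX: "u \<in> X u" using cell[OF u X[OF u]] by simp
    show "u \<in> (\<Union>A\<in>\<xi>. ?D A)"
    proof (rule ccontr)
      assume nin: "u \<notin> (\<Union>A\<in>\<xi>. ?D A)"
      then have "u \<in> C (X u)" using uX X[OF u] by auto
      then have "\<exists>A\<in>\<xi>. pre l u \<in> W A" using W[OF X[OF u]] X[OF u] by auto
      then have "pre l u \<in> W (g (pre l u))" using g1 by blast
      then have "u \<in> C (g (pre l u))" using W[OF g] u by auto
      then have "u \<in> g (pre l u)" using nin g by auto
      then show False using neq cell[OF u g] by simp
    qed
  qed
  have "measure \<nu> {u \<in> infinite_paths G. X u \<noteq> g (pre l u)} \<le> measure \<nu> (\<Union>A\<in>\<xi>. ?D A)"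
    using sub sets Cs fin by (intro finite_measure_mono) auto
  also have "\<dots> \<le> (\<Sum>A\<in>\<xi>. measure \<nu> (?D A))"
    using sets Cs fin by (intro finite_measure_subadditive_finite) auto
  also have "\<dots> < (\<Sum>A\<in>\<xi>. e / card \<xi>)"
    using C(2) fin A0 by (intro sum_strict_mono) auto
  also have "\<dots> = e" using card by simp
  finally show ?thesis using g by blast
qed

text \<open>The \<open>\<xi>\<close>-cell of \<open>u\<close> is predicted from the first \<open>l\<close> letters with small error probability. The kernel
  that trusts this prediction at each of the \<open>n\<close> times, up to a mass \<open>\<delta>\<close> spread evenly over all cells,
  bounds the entropy of the \<open>\<xi>\<close>-names by that of the words of length \<open>n + l\<close>, up to \<open>n \<epsilon>\<close>.\<close>

lemma ks_entropy_generator_lower: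
  fixes c :: real
  assumes inv: "\<nu> \<in> shift_probs G" and c: "ereal c < ks_entropy shift_map \<nu>"
  shows "k * c \<le> rv_entropy \<nu> (pre k)"
proof -
  have \<nu>: "\<nu> \<in> path_probs G" using inv by (simp add: invariant_probs_def)
  interpret mp_system \<nu> shift_map by (rule mp_system_invariant[OF inv])
  note sp = borel_probsD(3)[OF \<nu>]
  note spre = simple_function_pre[OF \<nu>]
  obtain \<xi> where \<xi>: "measurable_partition \<nu> \<xi>" and
      c\<xi>: "c < lim (\<lambda>n. 1 / real n * partition_entropy \<nu> (iterated_join \<nu> shift_map \<xi> n))"
    using c unfolding ks_entropy_def less_SUP_iff by auto
  let ?X = "cell_of \<xi>"
  let ?N = "names ?X shift_map"
  have sX: "simple_function \<nu> ?X" by (rule simple_function_cell_of[OF \<xi>])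
  have X\<xi>: "?X u \<in> \<xi>" if "u \<in> infinite_paths G" for u using cell_of[OF \<xi>] that sp by auto
  obtain L where L: "(\<lambda>n. rv_entropy \<nu> (?N n) / n) \<longlonglongrightarrow> L"
    using entropy_rate[OF sX] by blast
  have cL: "c < L" using c\<xi> lim_partition_entropy[OF \<xi> L] by simp
  have s0: "simple_function \<nu> (\<lambda>u. u 0)"
    using simple_function_compose1[OF spre[of 1], of hd] by (simp add: pre_def)
  have pre_names: "names (\<lambda>u. u 0) shift_map n = pre n" for n
    by (rule ext) (rule names_coordinate)
  obtain La where La: "(\<lambda>n. rv_entropy \<nu> (pre n) / n) \<longlonglongrightarrow> La" "\<And>n. n > 0 \<Longrightarrow> La \<le> rv_entropy \<nu> (pre n) / n"
    using entropy_rate[OF s0] unfolding pre_names by blast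
  have sub: "rv_entropy \<nu> (pre (m + n)) \<le> rv_entropy \<nu> (pre m) + rv_entropy \<nu> (pre n)" for m n
    using rv_entropy_names_subadditive[OF s0] unfolding pre_names .
  \<comment> \<open>\<open>L\<close> is the rate of \<xi> and \<open>La\<close> that of the words.
    Comparing the rates suffices, since by subadditivity \<open>La\<close> is a lower bound for
    every \<open>rv_entropy \<nu> (pre n) / n\<close> with positive \<open>n\<close>.\<close>
  have "L \<le> La"
  proof (rule field_le_epsilon)
    fix \<epsilon> :: real assume \<epsilon>: "\<epsilon> > 0"
    \<comment> \<open>The bound 1/2 permits the estimate of \<open>ln (1 - \<delta>)\<close> by
      which a correct prediction costs at most \<open>2 * \<delta>\<close>; the bound \<epsilon>/4
      makes this at most \<epsilon>/2.\<close>
    define \<delta> where "\<delta> = min (1/2) (\<epsilon>/4)"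
    have \<delta>: "0 < \<delta>" "\<delta> \<le> 1/2" "2 * \<delta> \<le> \<epsilon> / 2" using \<epsilon> by (auto simp: \<delta>_def)
    define s where "s = real (card \<xi>)"
    have fin: "finite \<xi>" using \<xi> by (simp add: measurable_partition_def)
    obtain u0 where u0: "u0 \<in> infinite_paths G" using infinite_paths_nonempty by auto
    have "card \<xi> > 0" using X\<xi>[OF u0] fin by (auto simp: card_gt_0_iff)
    then have s: "s \<ge> 1" by (simp add: s_def)
    have "1 < s / \<delta>" using \<delta> s by (simp add: field_simps)
    then have lnpos: "ln (s / \<delta>) > 0" by simp
    \<comment> \<open>A wrong prediction receives weight \<open>\<delta> / s\<close> and costs
      \<open>ln (s / \<delta>)\<close>; with error probability below \<open>e\<close> this
      contributes at most the other \<epsilon>/2 to the mean.\<close>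
    define e where "e = \<epsilon> / (2 * ln (s / \<delta>))"
    have e: "e > 0" using \<epsilon> lnpos by (simp add: e_def)
    obtain l g where g: "\<And>b. g b \<in> \<xi>" and err: "measure \<nu> {u \<in> infinite_paths G. ?X u \<noteq> g (pre l u)} < e"
      using predict_partition[OF \<nu> \<xi> e cell_of_iff[OF \<xi>, unfolded sp] X\<xi>] by blast
    define \<kappa>1 where "\<kappa>1 b a = (if a = b then 1 - \<delta> else 0) + \<delta> / s" for a b :: "(nat \<Rightarrow> 'e) set"
    have k1pos: "\<kappa>1 b a > 0" for a b using \<delta> s by (simp add: \<kappa>1_def add_pos_pos)
    have k1sum: "(\<Sum>a\<in>\<xi>. \<kappa>1 (g b) a) = 1" for b
    proof -
      have "(\<Sum>a\<in>\<xi>. \<delta> / s) = \<delta>" using s by (simp add: s_def[symmetric])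
      then show ?thesis using g[of b] fin unfolding \<kappa>1_def sum.distrib by simp
    qed
    define f where "f u = ln (\<kappa>1 (g (pre l u)) (?X u))" for u
    have sf: "simple_function \<nu> (\<lambda>u. (?X u, pre l u))" by (intro simple_function_Pair sX spre)
    have f_int: "integrable \<nu> f"
      unfolding f_def using integrable_simple_function[OF sf, of "\<lambda>(a, b). ln (\<kappa>1 (g b) a)"] by simp
    let ?E = "{u \<in> infinite_paths G. ?X u \<noteq> g (pre l u)}"
    have Es: "?E \<in> sets \<nu>"
    proof -
      have "?E = (\<lambda>u. (?X u, pre l u)) -` {p. fst p \<noteq> g (snd p)} \<inter> space \<nu>" using sp by auto
      then show ?thesis using simple_functionD(2)[OF sf] by (simp only:)
    qed
    have "- (\<integral>u. f u \<partial>\<nu>) = (\<integral>u. - f u \<partial>\<nu>)" by simp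
    also have "\<dots> \<le> (\<integral>u. 2 * \<delta> + ln (s / \<delta>) * indicator ?E u \<partial>\<nu>)"
    proof (rule integral_mono)
      show "integrable \<nu> (\<lambda>u. - f u)" using f_int by simp
      show "integrable \<nu> (\<lambda>u. 2 * \<delta> + ln (s / \<delta>) * indicator ?E u)"
        using Es by (intro Bochner_Integration.integrable_add integrable_mult_right) (auto simp: emeasure_eq_measure)
      fix u assume "u \<in> space \<nu>"
      then have u: "u \<in> infinite_paths G" using sp by simp
      show "- f u \<le> 2 * \<delta> + ln (s / \<delta>) * indicator ?E u"
      proof (cases "u \<in> ?E")
        case True
        then have "f u = - ln (s / \<delta>)" using s \<delta> by (simp add: f_def \<kappa>1_def ln_div)
        then show ?thesis using True \<delta> by simp
      next
        case False
        then have eq: "?X u = g (pre l u)" using u by simp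
        have "\<delta> * \<delta> \<le> \<delta> * (1/2)" using \<delta> by (intro mult_left_mono) auto
        then have "- (2 * \<delta>) \<le> - \<delta> - 2 * \<delta>\<^sup>2" by (simp add: power2_eq_square)
        also have "\<dots> \<le> ln (1 - \<delta>)" using \<delta> by (intro ln_one_minus_pos_lower_bound) auto
        also have "\<dots> \<le> ln (1 - \<delta> + \<delta> / s)"
          using \<delta> s by (subst ln_le_cancel_iff) (auto intro: add_pos_pos)
        also have "\<dots> = f u" by (simp add: f_def eq \<kappa>1_def)
        finally show ?thesis using False by simp
      qed
    qed
    also have "\<dots> = 2 * \<delta> + ln (s / \<delta>) * measure \<nu> ?E"
      using Es by (subst Bochner_Integration.integral_add) (auto simp: emeasure_eq_measure prob_space)
    also have "\<dots> \<le> 2 * \<delta> + ln (s / \<delta>) * e"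
      using err lnpos by (intro add_left_mono mult_left_mono) auto
    also have "\<dots> \<le> \<epsilon>" using \<delta> lnpos by (simp add: e_def)
    finally have fe: "- (\<integral>u. f u \<partial>\<nu>) \<le> \<epsilon>" .
    have main: "rv_entropy \<nu> (?N n) \<le> rv_entropy \<nu> (pre n) + rv_entropy \<nu> (pre l) + real n * \<epsilon>" for n
    proof -
      \<comment> \<open>The i-th factor predicts from the window of \<open>l\<close> letters
        starting at position \<open>i\<close>. For \<open>i < n\<close> all these windows fit into a
        word of length \<open>n + l\<close>.\<close>
      define \<kappa> where "\<kappa> w as = (\<Prod>i<n. \<kappa>1 (g (take l (drop i w))) (as ! i))" for w as
      have kpos: "\<kappa> w as > 0" for w as unfolding \<kappa>_def by (intro prod_pos) (auto simp: k1pos)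
      have sum1: "(\<Sum>as\<in>?N n ` space \<nu>. \<kappa> w as) \<le> 1" for w
      proof -
        have "?N n ` space \<nu> \<subseteq> {as. set as \<subseteq> \<xi> \<and> length as = n}"
          using X\<xi> sp by (auto simp: names_def shift_map_funpow_infinite_paths)
        then have "(\<Sum>as\<in>?N n ` space \<nu>. \<kappa> w as) \<le> (\<Sum>as | set as \<subseteq> \<xi> \<and> length as = n. \<kappa> w as)"
          using finite_lists_length_eq[OF fin] kpos by (intro sum_mono2) (auto simp: less_imp_le)
        also have "\<dots> = (\<Prod>i<n. \<Sum>a\<in>\<xi>. \<kappa>1 (g (take l (drop i w))) a)"
          unfolding \<kappa>_def by (rule sum_lists_prod[OF fin])
        also have "\<dots> = 1" by (simp add: k1sum)
        finally show ?thesis .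
      qed
      have sN: "simple_function \<nu> (?N n)" by (rule simple_function_names[OF sX])
      have "rv_entropy \<nu> (?N n) \<le> rv_entropy \<nu> (\<lambda>u. (?N n u, pre (n + l) u))"
        using rv_entropy_compose_le[OF simple_function_Pair[OF sN spre], of fst] by simp
      also have "\<dots> \<le> rv_entropy \<nu> (pre (n + l)) - (\<integral>u. ln (\<kappa> (pre (n + l) u) (?N n u)) \<partial>\<nu>)"
        using kpos sum1 by (intro rv_entropy_pair_le sN spre) (auto simp: less_imp_le)
      also have "(\<lambda>u. ln (\<kappa> (pre (n + l) u) (?N n u))) = (\<lambda>u. \<Sum>i<n. f ((shift_map ^^ i) u))"
      proof
        fix u :: "nat \<Rightarrow> 'e"
        have "take l (drop i (pre (n + l) u)) = pre l ((shift_map ^^ i) u)" if "i < n" for i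
          using that by (intro nth_equalityI) (auto simp: shift_map_funpow)
        then have "\<kappa> (pre (n + l) u) (?N n u) =
            (\<Prod>i<n. \<kappa>1 (g (pre l ((shift_map ^^ i) u))) (?X ((shift_map ^^ i) u)))"
          unfolding \<kappa>_def by (intro prod.cong) (auto simp: names_def)
        then show "ln (\<kappa> (pre (n + l) u) (?N n u)) = (\<Sum>i<n. f ((shift_map ^^ i) u))"
          by (simp add: ln_prod less_imp_neq[OF k1pos, symmetric] f_def)
      qed
      also have "(\<integral>u. (\<Sum>i<n. f ((shift_map ^^ i) u)) \<partial>\<nu>) = (\<Sum>i<n. \<integral>u. f ((shift_map ^^ i) u) \<partial>\<nu>)"
      proof (rule Bochner_Integration.integral_sum)
        fix i
        show "integrable \<nu> (\<lambda>u. f ((shift_map ^^ i) u))"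
          using integrable_simple_function[OF simple_function_funpow[OF sf], of "\<lambda>(a, b). ln (\<kappa>1 (g b) a)" i]
          by (simp add: f_def)
      qed
      also have "\<dots> = real n * (\<integral>u. f u \<partial>\<nu>)"
        using integral_funpow[of f] f_int by simp
      finally have "rv_entropy \<nu> (?N n) \<le> rv_entropy \<nu> (pre (n + l)) + real n * - (\<integral>u. f u \<partial>\<nu>)" by simp
      also have "\<dots> \<le> rv_entropy \<nu> (pre n) + rv_entropy \<nu> (pre l) + real n * \<epsilon>"
        using fe by (intro add_mono sub mult_left_mono) auto
      finally show ?thesis .
    qed
    \<comment> \<open>The surplus of \<open>l\<close> letters costs a constant amount of entropy,
      which vanishes after division by \<open>n\<close>.\<close>
    have "(\<lambda>n. rv_entropy \<nu> (pre n) / n + rv_entropy \<nu> (pre l) / n + \<epsilon>) \<longlonglongrightarrow> La + 0 + \<epsilon>"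
      by (intro tendsto_add tendsto_const La lim_const_over_n)
    moreover have "\<forall>\<^sub>F n in sequentially. rv_entropy \<nu> (?N n) / n \<le> rv_entropy \<nu> (pre n) / n + rv_entropy \<nu> (pre l) / n + \<epsilon>"
      using eventually_gt_at_top[of 0]
    proof eventually_elim
      fix n :: nat assume n: "0 < n"
      have "rv_entropy \<nu> (?N n) / n \<le> (rv_entropy \<nu> (pre n) + rv_entropy \<nu> (pre l) + real n * \<epsilon>) / n"
        using n main[of n] by (intro divide_right_mono) auto
      then show "rv_entropy \<nu> (?N n) / n \<le> rv_entropy \<nu> (pre n) / n + rv_entropy \<nu> (pre l) / n + \<epsilon>"
        using n by (simp add: add_divide_distrib)
    qed
    ultimately have "L \<le> La + 0 + \<epsilon>"
      by (intro tendsto_le[OF _ _ L]) auto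
    then show "L \<le> La + \<epsilon>" by simp
  qed
  then have cLa: "c \<le> La" using cL by simp
  show ?thesis
  proof (cases "k = 0")
    case True
    then show ?thesis using rv_entropy_nonneg[of "pre k"] by simp
  next
    case False
    then have "c \<le> rv_entropy \<nu> (pre k) / k" using cLa La(2)[of k] by simp
    then show ?thesis using False by (simp add: field_simps)
  qed
qed

end

section \<open>Compactness of the weak topology\<close>

lemma finite_paths_Suc_iff:
  "w @ [e] \<in> finite_paths G (Suc n) \<Longrightarrow> w \<in> finite_paths G n"
  by (auto simp: finite_paths_iff successively_append_iff)

lemma finite_paths_0 [simp]: "finite_paths G 0 = {[]}"
  by (auto simp: finite_paths_def)

text \<open>The candidates for the family of cylinder masses of a probability measure. They are
  indexed by all lists and bounded by 1, so that they form a subset of a product of compact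
  intervals.\<close>

definition consistent_weights :: "('v, 'e) pre_digraph \<Rightarrow> ('e list \<Rightarrow> real) set" where
  "consistent_weights G = {p \<in> UNIV \<rightarrow> {0..1}. p [] = 1 \<and>
     (\<forall>n. \<forall>w\<in>finite_paths G n. p w = (\<Sum>e | w @ [e] \<in> finite_paths G (Suc n). p (w @ [e])))}"

context path_system
begin

lemma finite_extensions: "finite {e. w @ [e] \<in> finite_paths G n}"
  by (rule finite_subset[OF _ finite_arcs]) (auto simp: finite_paths_def)

text \<open>The mass of \<open>A\<close> as computed from words of length \<open>n\<close>. If
  \<open>A\<close> is decided by \<open>n\<close> letters, this is the value a measure with the
  given cylinder masses must assign to it.\<close>

definition level_sum :: "('e list \<Rightarrow> real) \<Rightarrow> nat \<Rightarrow> (nat \<Rightarrow> 'e) set \<Rightarrow> real" where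
  "level_sum p n A = (\<Sum>w | w \<in> finite_paths G n \<and> cylinder G w \<subseteq> A. p w)"

lemma cylinder_subset_iff:
  assumes "w \<in> finite_paths G n"
  shows "cylinder G w \<subseteq> cyl G n W \<longleftrightarrow> w \<in> W"
proof
  obtain u where "u \<in> infinite_paths G" "pre n u = w" using assms pre_image[of n] by force
  then show "cylinder G w \<subseteq> cyl G n W \<Longrightarrow> w \<in> W"
    using mem_cylinder_pre[of u G n] by auto
next
  have "length w = n" using assms by (simp add: finite_paths_def)
  then show "w \<in> W \<Longrightarrow> cylinder G w \<subseteq> cyl G n W"
    by (auto simp: mem_cylinder)
qed

lemma level_sum_cyl:
  "level_sum p n (cyl G n W) = (\<Sum>w\<in>finite_paths G n \<inter> W. p w)"
  unfolding level_sum_def using cylinder_subset_iff by (intro sum.cong) auto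

text \<open>Every word splits into its one-letter extensions, and consistency says that their
  weights add up to its own.\<close>

lemma level_sum_Suc:
  assumes p: "p \<in> consistent_weights G"
  shows "level_sum p (Suc n) (cyl G n W) = level_sum p n (cyl G n W)"
proof -
  have "cyl G n W = cyl G (Suc n) {w. butlast w \<in> W}"
    by (auto simp: pre_Suc)
  then have "level_sum p (Suc n) (cyl G n W) =
      (\<Sum>w\<in>finite_paths G (Suc n) \<inter> {w. butlast w \<in> W}. p w)"
    by (simp only: level_sum_cyl)
  also have "finite_paths G (Suc n) \<inter> {w. butlast w \<in> W} =
      (\<lambda>(w, e). w @ [e]) ` (SIGMA w:finite_paths G n \<inter> W. {e. w @ [e] \<in> finite_paths G (Suc n)})"
  proof (intro equalityI subsetI)
    fix w assume w: "w \<in> finite_paths G (Suc n) \<inter> {w. butlast w \<in> W}"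
    then have "w \<noteq> []" by (auto simp: finite_paths_def)
    then have eq: "w = butlast w @ [last w]" by simp
    then have "butlast w @ [last w] \<in> finite_paths G (Suc n)" using w by simp
    then have "(butlast w, last w) \<in> (SIGMA w:finite_paths G n \<inter> W. {e. w @ [e] \<in> finite_paths G (Suc n)})"
      using w finite_paths_Suc_iff by auto
    then show "w \<in> (\<lambda>(w, e). w @ [e]) ` (SIGMA w:finite_paths G n \<inter> W. {e. w @ [e] \<in> finite_paths G (Suc n)})"
      using eq by (intro image_eqI[of _ _ "(butlast w, last w)"]) auto
  qed auto
  also have "(\<Sum>w\<in>\<dots>. p w) =
      (\<Sum>(w, e)\<in>(SIGMA w:finite_paths G n \<inter> W. {e. w @ [e] \<in> finite_paths G (Suc n)}). p (w @ [e]))"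
    by (subst sum.reindex) (auto simp: inj_on_def case_prod_unfold)
  also have "\<dots> = (\<Sum>w\<in>finite_paths G n \<inter> W. \<Sum>e | w @ [e] \<in> finite_paths G (Suc n). p (w @ [e]))"
    using finite_finite_paths finite_extensions by (subst sum.Sigma) auto
  also have "\<dots> = (\<Sum>w\<in>finite_paths G n \<inter> W. p w)"
    using p by (intro sum.cong) (auto simp: consistent_weights_def)
  finally show ?thesis by (simp only: level_sum_cyl)
qed

lemma level_sum_mono:
  assumes p: "p \<in> consistent_weights G" and "n \<le> m"
  shows "level_sum p m (cyl G n W) = level_sum p n (cyl G n W)"
  using \<open>n \<le> m\<close>
proof (induction m rule: dec_induct)
  case (step m)
  have "cyl G n W = cyl G m {w. take n w \<in> W}"
    using step.hyps by (simp add: take_pre)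
  then show ?case using level_sum_Suc[OF p, of m "{w. take n w \<in> W}"] step.IH by simp
qed simp

text \<open>Kolmogorov extension by means of Caratheodory's theorem. Finite additivity is a
  computation at a common level, and continuity at the empty set comes from compactness of the path
  space.\<close>

lemma weights_measure_exists:
  assumes p: "p \<in> consistent_weights G"
  shows "\<exists>\<nu>\<in>path_probs G. \<forall>n. \<forall>w\<in>finite_paths G n. measure \<nu> (cylinder G w) = p w"
proof -
  interpret alg: algebra "infinite_paths G" "cyl_algebra G" by (rule algebra_cyl_algebra)
  \<comment> \<open>The level sums of a cylinder set are eventually constant, so the limit yields
    its mass without fixing a representation of the set.\<close>
  define f where "f A = lim (\<lambda>m. level_sum p m A)" for A
  have p0: "p w \<ge> 0" for w using p by (auto simp: consistent_weights_def Pi_iff)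
  have f_eq: "f (cyl G n W) = level_sum p m (cyl G n W)"
    if "n \<le> m" for n m W
  proof -
    have "\<forall>\<^sub>F m in sequentially. level_sum p m (cyl G n W) =
        level_sum p n (cyl G n W)"
      using eventually_ge_at_top[of n] by eventually_elim (rule level_sum_mono[OF p])
    then have "f (cyl G n W) = level_sum p n (cyl G n W)"
      unfolding f_def by (intro limI tendsto_eventually)
    then show ?thesis using level_sum_mono[OF p that] by simp
  qed
  have f_cyl: "f (cyl G n W) = (\<Sum>w\<in>finite_paths G n \<inter> W. p w)" for n W
    using f_eq[of n n W] level_sum_cyl by simp
  have f0: "0 \<le> f A" if "A \<in> cyl_algebra G" for A
    using that f_cyl unfolding cyl_algebra_def by (auto intro!: sum_nonneg p0)
  have f_empty: "f {} = 0" using f_cyl[of 0 "{}"] by simp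
  have add: "f (A \<union> B) = f A + f B" if AB: "A \<in> cyl_algebra G" "B \<in> cyl_algebra G" "A \<inter> B = {}" for A B
  proof -
    obtain n W where A: "\<And>l. l \<ge> n \<Longrightarrow> A = cyl G l {w. take n w \<in> W}"
      by (rule cyl_algebraE[OF AB(1)]) rule
    obtain m V where B: "\<And>l. l \<ge> m \<Longrightarrow> B = cyl G l {w. take m w \<in> V}"
      by (rule cyl_algebraE[OF AB(2)]) rule
    define l where "l = max n m"
    define W' where "W' = {w. take n w \<in> W}"
    define V' where "V' = {w. take m w \<in> V}"
    have A': "A = cyl G l W'" unfolding W'_def l_def by (rule A) simp
    have B': "B = cyl G l V'" unfolding V'_def l_def by (rule B) simp
    have AB': "A \<union> B = cyl G l (W' \<union> V')" unfolding A' B' by auto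
    have disj: "(finite_paths G l \<inter> W') \<inter> (finite_paths G l \<inter> V') = {}"
    proof (rule ccontr)
      assume "\<not> ?thesis"
      then obtain w where w: "w \<in> finite_paths G l" "w \<in> W'" "w \<in> V'" by auto
      then obtain u where "u \<in> infinite_paths G" "pre l u = w" using pre_image[of l] by force
      then have "u \<in> A \<inter> B" using w unfolding A' B' by simp
      then show False using AB(3) by simp
    qed
    show ?thesis
      unfolding AB' unfolding A' B' f_cyl Int_Un_distrib
      by (rule sum.union_disjoint) (use disj finite_finite_paths in auto)
  qed
  have "\<exists>\<mu> :: (nat \<Rightarrow> 'e) set \<Rightarrow> ennreal. (\<forall>s\<in>cyl_algebra G. \<mu> s = ennreal (f s)) \<and>
      measure_space (infinite_paths G) (sigma_sets (infinite_paths G) (cyl_algebra G)) \<mu>"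
  proof (rule alg.caratheodory_empty_continuous)
    show "positive (cyl_algebra G) (\<lambda>A. ennreal (f A))" by (simp add: positive_def f_empty)
    show "additive (cyl_algebra G) (\<lambda>A. ennreal (f A))"
      by (simp add: additive_def add f0 ennreal_plus[symmetric] del: ennreal_plus)
    fix A :: "nat \<Rightarrow> (nat \<Rightarrow> 'e) set"
    assume A: "range A \<subseteq> cyl_algebra G" "decseq A" "(\<Inter>i. A i) = {}"
    \<comment> \<open>Cylinder sets are closed, so a decreasing sequence of nonempty ones would have
      a common point.\<close>
    have "\<exists>i. A i = {}"
    proof (rule ccontr)
      assume ne: "\<not> ?thesis"
      have "closedin (path_topology G) (A i)" for i
        using A(1) closedin_cyl unfolding cyl_algebra_def by (auto dest!: range_subsetD[of A _ i])
      then have "(\<Inter>i. A i) \<noteq> {}"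
        using ne A(2) by (intro compact_space_imp_nest[OF compact_space_path_topology]) auto
      then show False using A(3) by simp
    qed
    then obtain i where "A i = {}" by auto
    then have "A j = {}" if "j \<ge> i" for j using A(2) that by (auto simp: decseq_def)
    then have "\<forall>\<^sub>F j in sequentially. ennreal (f (A j)) = 0"
      using f_empty by (intro eventually_mono[OF eventually_ge_at_top[of i]]) simp
    then show "(\<lambda>j. ennreal (f (A j))) \<longlonglongrightarrow> 0" by (rule tendsto_eventually)
  qed simp
  then obtain m where m: "\<And>s. s \<in> cyl_algebra G \<Longrightarrow> m s = ennreal (f s)"
      and ms: "measure_space (infinite_paths G) (sigma_sets (infinite_paths G) (cyl_algebra G)) m" by auto
  define \<S> where "\<S> = sigma_sets (infinite_paths G) (cyl_algebra G)"
  define \<nu> where "\<nu> = measure_of (infinite_paths G) \<S> m"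
  have sa: "sigma_algebra (infinite_paths G) \<S>" and pos: "positive \<S> m" and ca: "countably_additive \<S> m"
    using ms by (auto simp: measure_space_def \<S>_def)
  have sub: "\<S> \<subseteq> Pow (infinite_paths G)" using sa by (auto simp: sigma_algebra_iff2)
  have sets: "sets \<nu> = sigma_sets (infinite_paths G) (cyl_algebra G)" and space: "space \<nu> = infinite_paths G"
    unfolding \<nu>_def using sub sigma_algebra.sigma_sets_eq[OF sa]
    by (simp_all add: sets_measure_of space_measure_of) (simp add: \<S>_def)
  have em: "emeasure \<nu> A = ennreal (f A)" if "A \<in> cyl_algebra G" for A
  proof -
    have "A \<in> \<S>" using that by (auto simp: \<S>_def)
    then have "emeasure \<nu> A = m A"
      unfolding \<nu>_def by (rule emeasure_measure_of_sigma[OF sa pos ca])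
    then show ?thesis using m[OF that] by simp
  qed
  have "emeasure \<nu> (space \<nu>) = 1"
  proof -
    have "cyl G 0 {[]} = infinite_paths G" by auto
    then have "f (infinite_paths G) = 1"
      using f_cyl[of 0 "{[]}"] p by (simp add: consistent_weights_def)
    then show ?thesis using em[of "infinite_paths G"] space by simp
  qed
  then have "prob_space \<nu>" by (rule prob_spaceI)
  then have "\<nu> \<in> path_probs G"
    by (simp add: borel_probs_def sets sets_borel_of_path)
  moreover have "measure \<nu> (cylinder G w) = p w" if w: "w \<in> finite_paths G n" for n w
  proof -
    have len: "length w = n" using w by (simp add: finite_paths_def)
    then have cyl: "cylinder G w = cyl G n {w}" by (auto simp: mem_cylinder)
    have "finite_paths G n \<inter> {w} = {w}" using w by auto
    then have "f (cylinder G w) = p w" unfolding cyl f_cyl by simp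
    moreover have "cylinder G w \<in> cyl_algebra G" unfolding cyl by (rule cyl_algebraI)
    ultimately show ?thesis using em p0[of w] by (simp add: measure_def)
  qed
  ultimately show ?thesis by blast
qed

end

section \<open>Neighbourhoods in the weak topology and empirical measures\<close>

lemma topspace_weak_topology [simp]: "topspace (weak_topology T) = borel_probs T"
proof
  show "topspace (weak_topology T) \<subseteq> borel_probs T"
    unfolding weak_topology_def by auto
  have "borel_probs T = {\<mu> \<in> borel_probs T. (\<integral>x. (0::real) \<partial>\<mu>) \<in> UNIV}" by simp
  moreover have "continuous_map T euclideanreal (\<lambda>x. 0) \<and> bounded ((\<lambda>x. 0::real) ` topspace T) \<and> open (UNIV :: real set)"
    by (auto simp: image_constant_conv)
  ultimately show "borel_probs T \<subseteq> topspace (weak_topology T)"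
    unfolding weak_topology_def topology_generated_by_topspace by blast
qed

text \<open>Induction over the generation of open sets from the subbasis: for an intersection the
  test functions are united and the smaller tolerance is taken.\<close>

lemma weak_neighbourhood:
  assumes "openin (weak_topology T) W" "\<nu> \<in> W"
  shows "\<exists>F \<delta>. finite F \<and> \<delta> > 0 \<and> (\<forall>f\<in>F. continuous_map T euclideanreal f) \<and>
    (\<forall>\<nu>'\<in>borel_probs T. (\<forall>f\<in>F. \<bar>(\<integral>x. f x \<partial>\<nu>') - (\<integral>x. f x \<partial>\<nu>)\<bar> < \<delta>) \<longrightarrow> \<nu>' \<in> W)"
  using openin_topology_generated_by[OF assms(1)[unfolded weak_topology_def]] assms(2)
proof induction
  case Empty
  then show ?case by simp
next
  case (Int a b)
  from Int.IH(1)[OF IntD1[OF Int.prems]] obtain F1 \<delta>1 where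
    1: "finite F1" "\<delta>1 > 0" "\<forall>f\<in>F1. continuous_map T euclideanreal f"
    "\<forall>\<nu>'\<in>borel_probs T. (\<forall>f\<in>F1. \<bar>(\<integral>x. f x \<partial>\<nu>') - (\<integral>x. f x \<partial>\<nu>)\<bar> < \<delta>1) \<longrightarrow> \<nu>' \<in> a"
    by auto
  from Int.IH(2)[OF IntD2[OF Int.prems]] obtain F2 \<delta>2 where
    2: "finite F2" "\<delta>2 > 0" "\<forall>f\<in>F2. continuous_map T euclideanreal f"
    "\<forall>\<nu>'\<in>borel_probs T. (\<forall>f\<in>F2. \<bar>(\<integral>x. f x \<partial>\<nu>') - (\<integral>x. f x \<partial>\<nu>)\<bar> < \<delta>2) \<longrightarrow> \<nu>' \<in> b"
    by auto
  from 1 2 show ?case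
    by (intro exI[of _ "F1 \<union> F2"] exI[of _ "min \<delta>1 \<delta>2"]) auto
next
  case (UN K)
  then obtain k where k: "k \<in> K" "\<nu> \<in> k" by auto
  from UN.IH[OF k] obtain F \<delta> where "finite F" "\<delta> > 0" "\<forall>f\<in>F. continuous_map T euclideanreal f"
    "\<forall>\<nu>'\<in>borel_probs T. (\<forall>f\<in>F. \<bar>(\<integral>x. f x \<partial>\<nu>') - (\<integral>x. f x \<partial>\<nu>)\<bar> < \<delta>) \<longrightarrow> \<nu>' \<in> k"
    by auto
  then show ?case using k(1) by (intro exI[of _ F] exI[of _ \<delta>]) auto
next
  case (Basis s)
  then obtain f V where fV: "s = {\<mu> \<in> borel_probs T. (\<integral>x. f x \<partial>\<mu>) \<in> V}"
      "continuous_map T euclideanreal f" "open V" by auto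
  then have "(\<integral>x. f x \<partial>\<nu>) \<in> V" using Basis by auto
  then obtain \<delta> where "\<delta> > 0" "\<forall>y. dist y (\<integral>x. f x \<partial>\<nu>) < \<delta> \<longrightarrow> y \<in> V"
    using fV(3) unfolding open_dist by auto
  then show ?case using fV(1,2)
    by (intro exI[of _ "{f}"] exI[of _ \<delta>]) (auto simp: dist_real_def)
qed

text \<open>The empirical measure is the law of the orbit point at a uniformly random time below
  \<open>n\<close>. Being a probability measure and integrating to Birkhoff averages are then
  inherited from the uniform law.\<close>

lemma empirical_measure_distr:
  assumes "n > 0" "u \<in> infinite_paths G"
  shows "empirical_measure G n u =
    distr (uniform_count_measure {..<n}) (borel_of (path_topology G)) (\<lambda>k. (shift_map ^^ k) u)"
proof -
  let ?B = "borel_of (path_topology G)"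
  let ?D = "distr (uniform_count_measure {..<n}) ?B (\<lambda>k. (shift_map ^^ k) u)"
  have meas: "(\<lambda>k. (shift_map ^^ k) u) \<in> measurable (uniform_count_measure {..<n}) ?B"
    using assms(2) by (auto simp: measurable_def space_uniform_count_measure sets_uniform_count_measure
        shift_map_funpow_infinite_paths)
  have "(\<Sum>k<n. emeasure (return ?B ((shift_map ^^ k) u)) A) / of_nat n = emeasure ?D A"
    if A: "A \<in> sets ?B" for A
  proof -
    let ?K = "{k \<in> {..<n}. (shift_map ^^ k) u \<in> A}"
    have "emeasure ?D A = emeasure (uniform_count_measure {..<n}) ?K"
      using meas A by (subst emeasure_distr) (auto simp: space_uniform_count_measure intro!: arg_cong2[of _ _ _ _ emeasure])
    also have "\<dots> = ennreal (card ?K / n)"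
      by (subst emeasure_uniform_count_measure) auto
    also have "\<dots> = of_nat (card ?K) / of_nat n"
      using assms by (simp add: divide_ennreal[symmetric] ennreal_of_nat_eq_real_of_nat)
    also have "of_nat (card ?K) = (\<Sum>k<n. indicator A ((shift_map ^^ k) u) :: ennreal)"
      by (simp add: indicator_def sum.If_cases Int_def)
    also have "\<dots> = (\<Sum>k<n. emeasure (return ?B ((shift_map ^^ k) u)) A)"
      using A by simp
    finally show ?thesis by simp
  qed
  then have "empirical_measure G n u = measure_of (space ?B) (sets ?B) (emeasure ?D)"
    unfolding empirical_measure_def Let_def
    using sets.sigma_sets_eq[of ?B] by (intro measure_of_eq sets.space_closed) (simp only:)
  also have "\<dots> = ?D" using measure_of_of_measure[of ?D] by (simp only: space_distr sets_distr)
  finally show ?thesis .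
qed

lemma empirical_measure_borel_probs:
  assumes "n > 0" "u \<in> infinite_paths G"
  shows "empirical_measure G n u \<in> path_probs G"
  unfolding empirical_measure_distr[OF assms] borel_probs_def
proof (intro CollectI conjI)
  have "prob_space (uniform_count_measure {..<n})"
    using assms by (intro prob_space_uniform_count_measure) auto
  then show "prob_space (distr (uniform_count_measure {..<n}) (borel_of (path_topology G)) (\<lambda>k. (shift_map ^^ k) u))"
    using assms(2) by (intro prob_space.prob_space_distr)
      (auto simp: measurable_def space_uniform_count_measure sets_uniform_count_measure
        shift_map_funpow_infinite_paths)
qed simp

lemma integral_empirical_measure:
  assumes "n > 0" "u \<in> infinite_paths G" "path_continuous G f"
  shows "(\<integral>x. f x \<partial>empirical_measure G n u) = birkhoff f n u / n"
proof -
  let ?B = "borel_of (path_topology G)"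
  have "f \<in> borel_measurable (empirical_measure G n u)"
    by (rule continuous_map_measurable[OF assms(3) empirical_measure_borel_probs[OF assms(1,2)]])
  then have f: "f \<in> borel_measurable ?B"
    unfolding empirical_measure_distr[OF assms(1,2)] by simp
  have "(\<integral>x. f x \<partial>empirical_measure G n u) = (\<integral>k. f ((shift_map ^^ k) u) \<partial>uniform_count_measure {..<n})"
    unfolding empirical_measure_distr[OF assms(1,2)] using assms(2) f
    by (intro integral_distr) (auto simp: measurable_def space_uniform_count_measure sets_uniform_count_measure
        shift_map_funpow_infinite_paths)
  also have "\<dots> = birkhoff f n u / n"
    by (simp add: integral_uniform_count_measure birkhoff_def)
  finally show ?thesis .
qed

lemma finite_paths_length: "w \<in> finite_paths G n \<Longrightarrow> length w = n"
  by (simp add: finite_paths_def)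

context path_system
begin

lemma measure_cyl:
  assumes \<nu>: "\<nu> \<in> path_probs G"
  shows "measure \<nu> (cyl G n W) = (\<Sum>w\<in>finite_paths G n \<inter> W. measure \<nu> (cylinder G w))"
proof -
  interpret prob_space \<nu> by (rule borel_probsD(1)[OF \<nu>])
  have len: "length w = n" if "w \<in> finite_paths G n" for w using that by (simp add: finite_paths_def)
  note cs = cylinder_in_sets[OF \<nu>]
  have "cyl G n W = (\<Union>w\<in>finite_paths G n \<inter> W. cylinder G w)"
    using len by (auto simp: mem_cylinder pre_finite_paths)
  also have "measure \<nu> \<dots> = (\<Sum>w\<in>finite_paths G n \<inter> W. measure \<nu> (cylinder G w))"
  proof (rule finite_measure_finite_Union)
    show "disjoint_family_on (cylinder G) (finite_paths G n \<inter> W)"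
      using len by (auto simp: disjoint_family_on_def mem_cylinder)
  qed (use finite_finite_paths cs in auto)
  finally show ?thesis .
qed

text \<open>The mass of a cylinder set is a finite sum of masses of cylinders, and cylinder sets
  form an intersection-stable generator.\<close>

lemma borel_probs_eqI:
  assumes \<nu>: "\<nu> \<in> path_probs G" and \<nu>': "\<nu>' \<in> path_probs G"
    and eq: "\<And>n w. w \<in> finite_paths G n \<Longrightarrow> measure \<nu> (cylinder G w) = measure \<nu>' (cylinder G w)"
  shows "\<nu> = \<nu>'"
proof -
  interpret N: prob_space \<nu> by (rule borel_probsD(1)[OF \<nu>])
  interpret N': prob_space \<nu>' by (rule borel_probsD(1)[OF \<nu>'])
  interpret alg: algebra "infinite_paths G" "cyl_algebra G" by (rule algebra_cyl_algebra)
  show ?thesis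
  proof (rule measure_eqI_generator_eq[where A = "\<lambda>_. infinite_paths G"])
    show "Int_stable (cyl_algebra G)" by (auto simp: Int_stable_def)
    fix A assume "A \<in> cyl_algebra G"
    then obtain n W where A: "A = cyl G n W" unfolding cyl_algebra_def by auto
    show "emeasure \<nu> A = emeasure \<nu>' A"
      unfolding A N.emeasure_eq_measure N'.emeasure_eq_measure measure_cyl[OF \<nu>] measure_cyl[OF \<nu>']
      using eq by (auto intro!: arg_cong[of _ _ ennreal] sum.cong)
  qed (use cyl_algebra_subset[of G] borel_probsD(2)[OF \<nu>] borel_probsD(2)[OF \<nu>'] in
      \<open>auto simp: N.emeasure_eq_measure\<close>)
qed

lemma cylinder_weights_consistent:
  assumes \<nu>: "\<nu> \<in> path_probs G"
  shows "(\<lambda>w. measure \<nu> (cylinder G w)) \<in> consistent_weights G"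
  unfolding consistent_weights_def
proof (intro CollectI conjI allI ballI)
  interpret prob_space \<nu> by (rule borel_probsD(1)[OF \<nu>])
  show "(\<lambda>w. measure \<nu> (cylinder G w)) \<in> UNIV \<rightarrow> {0..1}" by auto
  have "cylinder G [] = space \<nu>" unfolding borel_probsD(3)[OF \<nu>] by (simp add: set_eq_iff mem_cylinder)
  then show "measure \<nu> (cylinder G []) = 1" by (simp add: prob_space)
  fix n w assume w: "w \<in> finite_paths G n"
  then have "length w = n" by (simp add: finite_paths_def)
  then have "cylinder G w = cyl G (Suc n) {w'. butlast w' = w}"
    by (auto simp: mem_cylinder pre_Suc)
  then have "measure \<nu> (cylinder G w) = (\<Sum>w'\<in>finite_paths G (Suc n) \<inter> {w'. butlast w' = w}. measure \<nu> (cylinder G w'))"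
    by (simp only: measure_cyl[OF \<nu>])
  also have "finite_paths G (Suc n) \<inter> {w'. butlast w' = w} = (\<lambda>e. w @ [e]) ` {e. w @ [e] \<in> finite_paths G (Suc n)}"
  proof (intro equalityI subsetI)
    fix w' assume w': "w' \<in> finite_paths G (Suc n) \<inter> {w'. butlast w' = w}"
    then have "w' \<noteq> []" by (auto simp: finite_paths_def)
    then have "w' = w @ [last w']" using w' by auto
    then show "w' \<in> (\<lambda>e. w @ [e]) ` {e. w @ [e] \<in> finite_paths G (Suc n)}"
      using w' by (intro image_eqI[of _ _ "last w'"]) auto
  qed auto
  also have "(\<Sum>w'\<in>\<dots>. measure \<nu> (cylinder G w')) =
      (\<Sum>e | w @ [e] \<in> finite_paths G (Suc n). measure \<nu> (cylinder G (w @ [e])))"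
    by (subst sum.reindex) (auto simp: inj_on_def)
  finally show "measure \<nu> (cylinder G w) =
      (\<Sum>e | w @ [e] \<in> finite_paths G (Suc n). measure \<nu> (cylinder G (w @ [e])))" .
qed

text \<open>A chosen path with prefix \<open>w\<close>. Evaluation there turns a function of paths
  into a function of words.\<close>

definition rep :: "nat \<Rightarrow> 'e list \<Rightarrow> nat \<Rightarrow> 'e" where
  "rep n w = (SOME u. u \<in> infinite_paths G \<and> pre n u = w)"

lemma rep:
  assumes "w \<in> finite_paths G n"
  shows "rep n w \<in> infinite_paths G" "pre n (rep n w) = w"
proof -
  have "\<exists>u. u \<in> infinite_paths G \<and> pre n u = w" using assms pre_image[of n] by force
  then show "rep n w \<in> infinite_paths G" "pre n (rep n w) = w"
    unfolding rep_def using someI_ex[of "\<lambda>u. u \<in> infinite_paths G \<and> pre n u = w"] by auto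
qed

lemma integral_pre:
  fixes g :: "'e list \<Rightarrow> real"
  assumes \<nu>: "\<nu> \<in> path_probs G"
  shows "(\<integral>u. g (pre n u) \<partial>\<nu>) = (\<Sum>w\<in>finite_paths G n. measure \<nu> (cylinder G w) * g w)"
proof -
  interpret prob_space \<nu> by (rule borel_probsD(1)[OF \<nu>])
  show ?thesis
    using integral_simple_function[OF simple_function_pre[OF \<nu>, of n], of g]
    by (simp add: borel_probsD(3)[OF \<nu>] pre_image point_prob_pre[OF \<nu> finite_paths_length])
qed

text \<open>Replacing \<open>f\<close> at each path by its value at the representative of the prefix
  changes it by at most \<epsilon> and leaves a function with finitely many values.\<close>

lemma integral_approx:
  assumes f: "path_continuous G f" and \<nu>: "\<nu> \<in> path_probs G"
    and var: "\<And>u v. u \<in> infinite_paths G \<Longrightarrow> v \<in> infinite_paths G \<Longrightarrow> pre n u = pre n v \<Longrightarrow> \<bar>f u - f v\<bar> \<le> \<epsilon>"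
  shows "\<bar>(\<Sum>w\<in>finite_paths G n. measure \<nu> (cylinder G w) * f (rep n w)) - (\<integral>u. f u \<partial>\<nu>)\<bar> \<le> \<epsilon>"
proof -
  interpret prob_space \<nu> by (rule borel_probsD(1)[OF \<nu>])
  let ?g = "\<lambda>u. f (rep n (pre n u))"
  have int: "integrable \<nu> f" by (rule integrable_continuous[OF f \<nu>])
  have intg: "integrable \<nu> ?g"
    using integrable_simple_function[OF simple_function_pre[OF \<nu>], of "\<lambda>w. f (rep n w)"] .
  have "\<bar>\<integral>u. (?g u - f u) \<partial>\<nu>\<bar> \<le> (\<integral>u. \<bar>?g u - f u\<bar> \<partial>\<nu>)"
    using integral_abs_bound[of \<nu> "\<lambda>u. ?g u - f u"] .
  also have "\<dots> \<le> (\<integral>u. \<epsilon> \<partial>\<nu>)"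
    using int intg borel_probsD(3)[OF \<nu>] rep[OF pre_finite_paths]
    by (intro integral_mono) (auto intro!: var)
  also have "\<dots> = \<epsilon>" by (simp add: prob_space)
  also have "(\<integral>u. (?g u - f u) \<partial>\<nu>) = (\<integral>u. ?g u \<partial>\<nu>) - (\<integral>u. f u \<partial>\<nu>)"
    using int intg by simp
  finally show ?thesis using integral_pre[OF \<nu>, of "\<lambda>w. f (rep n w)" n] by simp
qed

abbreviation weight_topology :: "('e list \<Rightarrow> real) topology" where
  "weight_topology \<equiv> product_topology (\<lambda>_. top_of_set {0..1}) UNIV"

lemma continuous_map_coordinate: "continuous_map weight_topology euclideanreal (\<lambda>p. p w)"
  using continuous_map_product_projection[of w UNIV "\<lambda>_. top_of_set {0..1::real}"]
  by (simp add: continuous_map_in_subtopology)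

text \<open>A closed subset of a Tychonoff cube: each consistency equation involves finitely many
  coordinates.\<close>

lemma compactin_consistent_weights: "compactin weight_topology (consistent_weights G)"
proof (rule closedin_compact_space)
  show "compact_space weight_topology"
    by (simp add: compact_space_product_topology compact_space_subtopology compactin_euclidean_iff)
  let ?E = "\<lambda>n w. {p \<in> topspace weight_topology.
      p w - (\<Sum>e | w @ [e] \<in> finite_paths G (Suc n). p (w @ [e])) \<in> {0}}"
  have "closedin weight_topology (?E n w)" for n w
    by (rule closedin_continuous_map_preimage[where Y = euclideanreal])
       (auto intro!: continuous_map_diff continuous_map_sum continuous_map_coordinate finite_extensions)
  moreover have "closedin weight_topology {p \<in> topspace weight_topology. p [] \<in> {1}}"
    by (rule closedin_continuous_map_preimage[where Y = euclideanreal]) (auto intro: continuous_map_coordinate)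
  moreover have "consistent_weights G = {p \<in> topspace weight_topology. p [] \<in> {1}} \<inter>
      (\<Inter>n. (\<Inter>w\<in>finite_paths G n. ?E n w))"
    by (auto simp: consistent_weights_def PiE_iff Pi_iff)
  ultimately show "closedin weight_topology (consistent_weights G)"
    using pre_image infinite_paths_nonempty by (force intro!: closedin_Int closedin_INT)
qed

text \<open>The space of measures is the continuous image of the compact set of consistent weights
  under the extension map \<Phi>, which is onto because a measure is determined by its cylinder
  masses.\<close>

lemma compact_space_weak_topology: "compact_space (path_weak_topology G)"
proof -
  let ?K = "subtopology weight_topology (consistent_weights G)"
  have topK: "topspace ?K = consistent_weights G"
    by (auto simp: consistent_weights_def PiE_iff Pi_iff)
  obtain \<Phi> where \<Phi>: "\<And>p. p \<in> consistent_weights G \<Longrightarrow> \<Phi> p \<in> path_probs G"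
      "\<And>p n w. p \<in> consistent_weights G \<Longrightarrow> w \<in> finite_paths G n \<Longrightarrow> measure (\<Phi> p) (cylinder G w) = p w"
    using weights_measure_exists by metis
  \<comment> \<open>By uniform continuity of \<open>f\<close>, the integral is a limit, uniform in
    \<open>p\<close>, of finite linear combinations of coordinates of \<open>p\<close>.\<close>
  have int: "continuous_map ?K euclideanreal (\<lambda>p. \<integral>u. f u \<partial>\<Phi> p)"
    if f: "path_continuous G f" for f
  proof -
    have "continuous_map ?K Met_TC.mtopology (\<lambda>p. \<integral>u. f u \<partial>\<Phi> p)"
    proof (rule Met_TC.continuous_map_uniform_limit[where F = sequentially])
      show "\<forall>\<^sub>F n in sequentially. continuous_map ?K Met_TC.mtopology
          (\<lambda>p. \<Sum>w\<in>finite_paths G n. p w * f (rep n w))"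
        using finite_finite_paths
        by (auto intro!: always_eventually continuous_map_sum continuous_map_real_mult
            continuous_map_from_subtopology continuous_map_coordinate)
      fix \<epsilon> :: real assume "\<epsilon> > 0"
      then obtain l where l: "\<And>u v. u \<in> infinite_paths G \<Longrightarrow> v \<in> infinite_paths G \<Longrightarrow> pre l u = pre l v \<Longrightarrow>
          \<bar>f u - f v\<bar> < \<epsilon> / 2"
        by (rule uniform_continuity[OF f half_gt_zero]) blast
      have "\<bar>(\<Sum>w\<in>finite_paths G n. p w * f (rep n w)) - (\<integral>u. f u \<partial>\<Phi> p)\<bar> < \<epsilon>"
        if n: "n \<ge> l" and p: "p \<in> consistent_weights G" for n p
      proof -
        have "\<bar>(\<Sum>w\<in>finite_paths G n. measure (\<Phi> p) (cylinder G w) * f (rep n w)) - (\<integral>u. f u \<partial>\<Phi> p)\<bar> \<le> \<epsilon> / 2"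
          using l pre_mono[OF _ n] by (intro integral_approx[OF f \<Phi>(1)[OF p]] less_imp_le) blast
        then show ?thesis using \<Phi>(2)[OF p] \<open>\<epsilon> > 0\<close> by simp
      qed
      then show "\<forall>\<^sub>F n in sequentially. \<forall>p\<in>topspace ?K. (\<integral>u. f u \<partial>\<Phi> p) \<in> UNIV \<and>
          dist (\<Sum>w\<in>finite_paths G n. p w * f (rep n w)) (\<integral>u. f u \<partial>\<Phi> p) < \<epsilon>"
        unfolding topK by (intro eventually_mono[OF eventually_ge_at_top[of l]]) (auto simp: dist_real_def)
    qed simp
    then show ?thesis by simp
  qed
  have "continuous_map ?K (path_weak_topology G) \<Phi>"
    unfolding weak_topology_def
  proof (rule continuous_on_generated_topo)
    fix W assume "W \<in> {{\<mu> \<in> path_probs G. (\<integral>x. f x \<partial>\<mu>) \<in> V} | f V.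
        path_continuous G f \<and> bounded (f ` topspace (path_topology G)) \<and> open V}"
    then obtain f V where fV: "W = {\<mu> \<in> path_probs G. (\<integral>x. f x \<partial>\<mu>) \<in> V}"
      "path_continuous G f" "open V" by auto
    have "\<Phi> -` W \<inter> topspace ?K = {p \<in> topspace ?K. (\<integral>u. f u \<partial>\<Phi> p) \<in> V}"
      unfolding topK fV(1) using \<Phi>(1) by auto
    then show "openin ?K (\<Phi> -` W \<inter> topspace ?K)"
      using openin_continuous_map_preimage[OF int[OF fV(2)], of V] fV(3) by simp
  next
    show "\<Phi> ` topspace ?K \<subseteq> \<Union> {{\<mu> \<in> path_probs G. (\<integral>x. f x \<partial>\<mu>) \<in> V} | f V.
        path_continuous G f \<and> bounded (f ` topspace (path_topology G)) \<and> open V}"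
      unfolding topology_generated_by_topspace[symmetric] weak_topology_def[symmetric] topK
      using \<Phi>(1) by auto
  qed
  moreover have "compactin ?K (topspace ?K)"
    using compactin_consistent_weights[unfolded compactin_subspace] unfolding compact_space_def by blast
  ultimately have "compactin (path_weak_topology G) (\<Phi> ` topspace ?K)"
    by (rule image_compactin[rotated])
  moreover have "\<Phi> ` topspace ?K = topspace (path_weak_topology G)"
  proof (intro equalityI subsetI)
    fix \<nu> assume "\<nu> \<in> topspace (path_weak_topology G)"
    then have \<nu>: "\<nu> \<in> path_probs G" by simp
    let ?p = "\<lambda>w. measure \<nu> (cylinder G w)"
    have p: "?p \<in> consistent_weights G" by (rule cylinder_weights_consistent[OF \<nu>])
    have "\<nu> = \<Phi> ?p" using \<Phi>(2)[OF p] by (intro borel_probs_eqI \<nu> \<Phi>(1)[OF p]) simp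
    then show "\<nu> \<in> \<Phi> ` topspace ?K" using p unfolding topK by blast
  qed (use \<Phi>(1) topK in auto)
  ultimately show ?thesis by (simp add: compact_space_def)
qed

lemma openin_weak_ball:
  assumes f: "path_continuous G f"
  shows "openin (path_weak_topology G) {\<nu> \<in> path_probs G. \<bar>(\<integral>u. f u \<partial>\<nu>) - x\<bar> < \<epsilon>}"
proof -
  obtain F where "\<And>u. u \<in> infinite_paths G \<Longrightarrow> \<bar>f u\<bar> \<le> F"
    by (rule continuous_bounded[OF f]) blast
  then have "bounded (f ` topspace (path_topology G))"
    by (auto simp: bounded_iff intro!: exI[of _ F])
  moreover have "{\<nu> \<in> path_probs G. \<bar>(\<integral>u. f u \<partial>\<nu>) - x\<bar> < \<epsilon>} =
      {\<nu> \<in> path_probs G. (\<integral>u. f u \<partial>\<nu>) \<in> ball x \<epsilon>}"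
    by (auto simp: dist_real_def abs_minus_commute)
  ultimately show ?thesis
    unfolding weak_topology_def using f by (intro topology_generated_by_Basis) blast
qed

end

section \<open>Upper bound\<close>

lemma sum_le_sum_Union:
  fixes f :: "'a \<Rightarrow> real"
  assumes "finite X" "\<And>i. i \<in> X \<Longrightarrow> finite (B i)" "A \<subseteq> (\<Union>i\<in>X. B i)" "\<And>x. 0 \<le> f x"
  shows "sum f A \<le> (\<Sum>i\<in>X. sum f (B i))"
proof -
  have fin: "finite (\<Union>i\<in>X. B i)" using assms by auto
  have "sum f A \<le> sum f (\<Union>i\<in>X. B i)" using fin assms by (intro sum_mono2) auto
  also have "\<dots> \<le> (\<Sum>i\<in>X. sum f (B i))"
    using assms(1,2)
  proof (induction X rule: finite_induct)
    case (insert i X)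
    have "sum f (\<Union>i\<in>insert i X. B i) \<le> sum f (B i) + sum f (\<Union>i\<in>X. B i)"
      using insert assms(4) sum.union_inter[of "B i" "\<Union>i\<in>X. B i" f]
        sum_nonneg[of "B i \<inter> (\<Union>i\<in>X. B i)" f] by auto
    then show ?case using insert by auto
  qed simp
  finally show ?thesis .
qed

text \<open>The chain runs backwards in time: each letter is weighted given the \<open>k\<close> letters that follow it, so the
  total weight is computed by prepending letters. The last \<open>k\<close> letters are free.\<close>

primrec chain_weight :: "nat \<Rightarrow> ('e \<Rightarrow> 'e list \<Rightarrow> real) \<Rightarrow> 'e list \<Rightarrow> real" where
  "chain_weight k q [] = 1"
| "chain_weight k q (x # w) = (if k \<le> length w then q x (take k w) else 1) * chain_weight k q w"

text \<open>With the following letters fixed, the sum over the first letter gives 1 if at least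
  \<open>k\<close> letters follow and \<open>card A\<close> otherwise; the latter happens at the
  last \<open>k\<close> positions only.\<close>

lemma chain_weight_sum:
  assumes A: "finite A" and q: "\<And>b. set b \<subseteq> A \<Longrightarrow> length b = k \<Longrightarrow> (\<Sum>x\<in>A. q x b) = 1"
  shows "(\<Sum>w | set w \<subseteq> A \<and> length w = n. chain_weight k q w) = card A ^ min n k"
proof (induction n)
  case 0
  have "{w. set w \<subseteq> A \<and> length w = 0} = {[]}" by auto
  then show ?case by simp
next
  case (Suc n)
  let ?L = "{w. set w \<subseteq> A \<and> length w = n}"
  let ?t = "\<lambda>w. \<Sum>x\<in>A. if k \<le> length w then q x (take k w) else 1"
  have inj: "inj_on (\<lambda>(w, x). x # w) (?L \<times> A)" by (auto simp: inj_on_def)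
  have t: "?t w = (if k \<le> n then 1 else card A)" if w: "w \<in> ?L" for w
  proof (cases "k \<le> n")
    case True
    have "set (take k w) \<subseteq> A" using w set_take_subset[of k w] by auto
    then show ?thesis using True w q[of "take k w"] by simp
  qed (use w in auto)
  have "(\<Sum>w | set w \<subseteq> A \<and> length w = Suc n. chain_weight k q w) =
      (\<Sum>(w, x)\<in>?L \<times> A. (if k \<le> length w then q x (take k w) else 1) * chain_weight k q w)"
    unfolding lists_length_Suc_eq sum.reindex[OF inj] by (simp add: case_prod_unfold)
  also have "\<dots> = (\<Sum>w\<in>?L. ?t w * chain_weight k q w)"
    by (simp add: sum.cartesian_product[symmetric] sum_distrib_right)
  also have "\<dots> = (\<Sum>w\<in>?L. (if k \<le> n then 1 else card A) * chain_weight k q w)"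
    by (intro sum.cong refl) (simp only: t)
  also have "\<dots> = (if k \<le> n then 1 else card A) * card A ^ min n k"
    unfolding sum_distrib_left[symmetric] Suc by simp
  also have "\<dots> = card A ^ min (Suc n) k"
    by (cases "k \<le> n") (simp_all add: min.absorb1 min.absorb2)
  finally show ?case .
qed

section \<open>Weights of words and the words whose empirical measures meet a neighbourhood\<close>

definition word_weight :: "('v, 'e) pre_digraph \<Rightarrow> ((nat \<Rightarrow> 'e) \<Rightarrow> real) \<Rightarrow> 'e list \<Rightarrow> real" where
  "word_weight G \<phi> w = (SUP u\<in>cylinder G w. exp (birkhoff \<phi> (length w) u))"

lemma Z_sum_word_weight:
  "Z_sum G U \<phi> D n =
    (\<Sum>w\<in>{w \<in> finite_paths G n. (\<lambda>u. U (empirical_measure G n u)) ` cylinder G w \<subseteq> D}. word_weight G \<phi> w)"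
  unfolding Z_sum_def word_weight_def birkhoff_def
  by (intro sum.cong) (auto simp: finite_paths_def)

context path_system
begin

lemma cylinder_nonempty: "w \<in> finite_paths G n \<Longrightarrow> cylinder G w \<noteq> {}"
  using pre_image[of n] mem_cylinder_pre by (metis empty_iff imageE)

lemma word_weight_bdd:
  assumes "path_continuous G \<phi>"
  shows "bdd_above ((\<lambda>u. exp (birkhoff \<phi> n u)) ` cylinder G w)"
proof -
  obtain F where F: "\<And>u. u \<in> infinite_paths G \<Longrightarrow> \<bar>\<phi> u\<bar> \<le> F"
    by (rule continuous_bounded[OF assms]) blast
  have "exp (birkhoff \<phi> n u) \<le> exp (n * F)" if "u \<in> cylinder G w" for u
    using birkhoff_bound[of G \<phi> F u n] F that by (auto simp: mem_cylinder abs_le_iff)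
  then show ?thesis by (intro bdd_aboveI2)
qed

lemma word_weight_ge:
  assumes "path_continuous G \<phi>" "u \<in> cylinder G w" "length w = n"
  shows "exp (birkhoff \<phi> n u) \<le> word_weight G \<phi> w"
  unfolding word_weight_def using assms(2,3) word_weight_bdd[OF assms(1)] by (auto intro!: cSUP_upper)

lemma word_weight_nonneg:
  assumes "path_continuous G \<phi>" "w \<in> finite_paths G n"
  shows "0 \<le> word_weight G \<phi> w"
proof -
  obtain u where "u \<in> cylinder G w" using cylinder_nonempty[OF assms(2)] by auto
  then show ?thesis
    using word_weight_ge[OF assms(1), of u w n] assms(2) exp_ge_zero order.trans
    by (metis finite_paths_length)
qed

lemma word_weight_le:
  assumes "w \<in> finite_paths G n" "\<And>u. u \<in> cylinder G w \<Longrightarrow> exp (birkhoff \<phi> n u) \<le> c"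
  shows "word_weight G \<phi> w \<le> c"
  unfolding word_weight_def using assms cylinder_nonempty[OF assms(1)]
  by (auto intro!: cSUP_least simp: finite_paths_length)

text \<open>The shift pulls the cylinder of \<open>b\<close> back to the disjoint union of the
  cylinders of \<open>x # b\<close>, and invariance preserves its mass. This identity normalises
  weights of a letter conditioned on the letters that follow it.\<close>

lemma sum_weight_Cons:
  assumes inv: "\<nu> \<in> shift_probs G"
  shows "(\<Sum>x\<in>arcs G. measure \<nu> (cylinder G (x # b))) = measure \<nu> (cylinder G b)"
proof -
  have \<nu>: "\<nu> \<in> path_probs G" using inv by (simp add: invariant_probs_def)
  interpret prob_space \<nu> by (rule borel_probsD(1)[OF \<nu>])
  note cs = cylinder_in_sets[OF \<nu>]
  have "measure \<nu> (cylinder G b) = measure \<nu> (shift_map -` cylinder G b \<inter> space \<nu>)"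
    using inv cs[of b] unfolding invariant_probs_def measure_def by auto
  also have "shift_map -` cylinder G b \<inter> space \<nu> = (\<Union>x\<in>arcs G. cylinder G (x # b))"
    unfolding borel_probsD(3)[OF \<nu>]
  proof (intro equalityI subsetI)
    fix u assume u: "u \<in> shift_map -` cylinder G b \<inter> infinite_paths G"
    then have "u 0 \<in> arcs G" by (auto simp: infinite_paths_def)
    moreover have "u \<in> cylinder G (u 0 # b)" using u by (simp add: mem_cylinder pre_Suc_Cons)
    ultimately show "u \<in> (\<Union>x\<in>arcs G. cylinder G (x # b))" by blast
  next
    fix u assume "u \<in> (\<Union>x\<in>arcs G. cylinder G (x # b))"
    then show "u \<in> shift_map -` cylinder G b \<inter> infinite_paths G"
      by (auto simp: mem_cylinder pre_Suc_Cons shift_map_infinite_paths)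
  qed
  also have "measure \<nu> \<dots> = (\<Sum>x\<in>arcs G. measure \<nu> (cylinder G (x # b)))"
  proof (rule finite_measure_finite_Union)
    show "disjoint_family_on (\<lambda>x. cylinder G (x # b)) (arcs G)"
      by (auto simp: disjoint_family_on_def mem_cylinder pre_Suc_Cons)
  qed (use cs in auto)
  finally show ?thesis by simp
qed

lemma rv_entropy_pre:
  assumes \<nu>: "\<nu> \<in> path_probs G"
  shows "rv_entropy \<nu> (pre n) = - (\<Sum>w\<in>finite_paths G n. measure \<nu> (cylinder G w) * ln (measure \<nu> (cylinder G w)))"
  by (simp add: rv_entropy_def borel_probsD(3)[OF \<nu>] pre_image point_prob_pre[OF \<nu> finite_paths_length])

text \<open>Empirical measures of different paths in one cylinder need not fall into the same
  neighbourhood. Asking for a single path allows each word counted in \<open>Z_sum\<close> to be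
  assigned to some member of a cover.\<close>

definition hit_words :: "(nat \<Rightarrow> 'e) measure set \<Rightarrow> nat \<Rightarrow> 'e list set" where
  "hit_words N n = {w \<in> finite_paths G n. \<exists>u\<in>cylinder G w. empirical_measure G n u \<in> N}"

lemma finite_hit_words: "finite (hit_words N n)"
  unfolding hit_words_def using finite_finite_paths by auto

lemma birkhoff_Suc: "birkhoff f (Suc n) u = f u + birkhoff f n (shift_map u)"
  using birkhoff_add[of f 1 n u] by (simp add: birkhoff_def)

text \<open>A word hitting \<open>N\<close> has chain weight at least about
  \<open>exp (- n * c)\<close> and weight at most about \<open>exp (n * I)\<close>, while the chain
  weights of all words of length \<open>n\<close> add up to at most \<open>A ^ k\<close>.\<close>

lemma local_upper_invariant:
  fixes a :: real
  assumes inv: "\<nu> \<in> shift_probs G"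
    and \<phi>: "path_continuous G \<phi>"
    and a: "ks_entropy shift_map \<nu> + ereal (\<integral>u. \<phi> u \<partial>\<nu>) < ereal a"
  shows "\<exists>N K. openin (path_weak_topology G) N \<and> \<nu> \<in> N \<and> 0 \<le> K \<and>
    (\<forall>\<^sub>F n in sequentially. (\<Sum>w\<in>hit_words N n. word_weight G \<phi> w) \<le> K * exp (n * a))"
proof -
  have \<nu>: "\<nu> \<in> path_probs G" using inv by (simp add: invariant_probs_def)
  interpret mp_system \<nu> shift_map by (rule mp_system_invariant[OF inv])
  define I where "I = (\<integral>u. \<phi> u \<partial>\<nu>)"
  have "ks_entropy shift_map \<nu> < ereal (a - I)"
    using a unfolding I_def by (cases "ks_entropy shift_map \<nu>") auto
  then obtain c where c: "ks_entropy shift_map \<nu> < ereal c" "c < a - I"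
    using ereal_dense2[of "ks_entropy shift_map \<nu>" "ereal (a - I)"] by auto
  obtain k where k: "rv_entropy \<nu> (pre (Suc k)) - rv_entropy \<nu> (pre k) < c"
    using ks_entropy_generator_upper[OF inv c(1)] by auto
  \<comment> \<open>Four errors of size \<epsilon> per letter occur: the smoothing, the tolerance of
    \<open>N\<close> for \<open>f\<close>, its tolerance for \<phi>, and the variation of Birkhoff
    sums of \<phi> on a cylinder.\<close>
  define \<epsilon> where "\<epsilon> = (a - I - c) / 4"
  have \<epsilon>: "\<epsilon> > 0" using c by (simp add: \<epsilon>_def)
  define A where "A = real (card (arcs G))"
  have "card (arcs G) > 0" using arcs_nonempty by (simp add: card_gt_0_iff)
  then have A: "A \<ge> 1" by (simp add: A_def)
  define M where "M = real (card (finite_paths G k))"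
  \<comment> \<open>The smoothing mass costs at most \<open>A * d\<close> for each of the
    \<open>M\<close> words of length \<open>k\<close>; this choice keeps the total at most
    \<epsilon>.\<close>
  define d where "d = \<epsilon> / (A * (M + 1))"
  have M: "M \<ge> 0" by (simp add: M_def)
  have d: "d > 0" using A M \<epsilon> by (simp add: d_def)
  have dM: "M * (A * d) \<le> \<epsilon>"
  proof -
    have "M * (A * d) = \<epsilon> * (M / (M + 1))" using A by (simp add: d_def)
    also have "\<dots> \<le> \<epsilon> * 1" using \<epsilon> M by (intro mult_left_mono) auto
    finally show ?thesis by simp
  qed
  define p where "p w = measure \<nu> (cylinder G w)" for w
  have p0: "p w \<ge> 0" for w by (simp add: p_def)
  have p_sum: "(\<Sum>x\<in>arcs G. p (x # b)) = p b" for b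
    unfolding p_def by (rule sum_weight_Cons[OF inv])
  \<comment> \<open>The conditional probability of \<open>x\<close> given that \<open>b\<close>
    follows, with mass \<open>d\<close> added for each of the \<open>A\<close> letters. It stays
    positive when \<open>b\<close> has measure 0, where it is uniform on the arcs.\<close>
  define q where "q x b = (p (x # b) + d) / (p b + A * d)" for x b
  have den: "p b + A * d > 0" for b using p0[of b] A d by (simp add: add_nonneg_pos)
  have qpos: "q x b > 0" for x b using p0[of "x # b"] d den[of b] by (simp add: q_def add_nonneg_pos)
  have q_sum: "(\<Sum>x\<in>arcs G. q x b) = 1" for b
    using den[of b] by (simp add: q_def sum_divide_distrib[symmetric] sum.distrib p_sum A_def)
  have q_le: "q x b \<le> 1" if "x \<in> arcs G" for x b
    using member_le_sum[of x "arcs G" "\<lambda>x. q x b"] that q_sum[of b] qpos by (simp add: less_imp_le)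
  define f where "f u = ln (q (u 0) (pre k (shift_map u)))" for u
  have f_eq: "f u = ln (q (hd (pre (Suc k) u)) (tl (pre (Suc k) u)))" for u
    by (simp add: f_def pre_Suc_Cons)
  have f_cont: "path_continuous G f"
    using continuous_map_pre[of G "\<lambda>w. ln (q (hd w) (tl w))" "Suc k"] by (simp only: f_eq[abs_def])
  have f_le: "f u \<le> 0" if "u \<in> infinite_paths G" for u
    using that qpos q_le by (auto simp: f_def infinite_paths_def)
  have chain_pos: "chain_weight k q w > 0" for w
    by (induction w) (auto simp: qpos)
  \<comment> \<open>At the last \<open>k\<close> letters the chain has factor 1, and the inequality
    there rests on \<open>f \<le> 0\<close>.\<close>
  have chain_ge: "exp (birkhoff f n u) \<le> chain_weight k q (pre n u)" if "u \<in> infinite_paths G" for n u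
    using that
  proof (induction n arbitrary: u)
    case (Suc n)
    let ?c = "if k \<le> n then q (u 0) (take k (pre n (shift_map u))) else 1"
    have "exp (birkhoff f (Suc n) u) = exp (f u) * exp (birkhoff f n (shift_map u))"
      by (simp add: birkhoff_Suc exp_add)
    also have "\<dots> \<le> ?c * chain_weight k q (pre n (shift_map u))"
    proof (rule mult_mono)
      show "exp (f u) \<le> ?c"
        using f_le[OF Suc.prems] qpos by (simp add: f_def take_pre)
      show "exp (birkhoff f n (shift_map u)) \<le> chain_weight k q (pre n (shift_map u))"
        by (intro Suc.IH shift_map_infinite_paths Suc.prems)
    qed (use qpos in \<open>auto simp: less_imp_le\<close>)
    finally show ?case by (simp add: pre_Suc_Cons)
  qed simp
  have int_f: "- (\<integral>u. f u \<partial>\<nu>) \<le> c + \<epsilon>"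
  proof -
    let ?g1 = "\<lambda>u. ln (p (pre (Suc k) u) + d)"
    let ?g2 = "\<lambda>u. ln (p (pre k u) + A * d)"
    have i1: "integrable \<nu> ?g1"
      using integrable_simple_function[OF simple_function_pre[OF \<nu>, of "Suc k"], of "\<lambda>w. ln (p w + d)"] .
    have i2: "integrable \<nu> ?g2"
      using integrable_simple_function[OF simple_function_pre[OF \<nu>, of k], of "\<lambda>w. ln (p w + A * d)"] .
    have i3: "integrable \<nu> (\<lambda>u. ?g2 (shift_map u))"
      using integrable_simple_function[OF simple_function_funpow[OF simple_function_pre[OF \<nu>, of k], of 1],
          of "\<lambda>w. ln (p w + A * d)"] by simp
    have "f u = ?g1 u - ?g2 (shift_map u)" for u
      using p0[of "u 0 # pre k (shift_map u)"] d den[of "pre k (shift_map u)"]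
      by (simp add: f_def q_def pre_Suc_Cons ln_div add_nonneg_pos)
    then have "(\<integral>u. f u \<partial>\<nu>) = (\<integral>u. ?g1 u - ?g2 (shift_map u) \<partial>\<nu>)" by simp
    also have "\<dots> = (\<integral>u. ?g1 u \<partial>\<nu>) - (\<integral>u. ?g2 (shift_map u) \<partial>\<nu>)"
      using i1 i3 by simp
    also have "(\<integral>u. ?g2 (shift_map u) \<partial>\<nu>) = (\<integral>u. ?g2 u \<partial>\<nu>)"
      using integral_funpow[of ?g2 1] i2 by simp
    finally have int: "- (\<integral>u. f u \<partial>\<nu>) = (\<integral>u. ?g2 u \<partial>\<nu>) - (\<integral>u. ?g1 u \<partial>\<nu>)" by simp
    \<comment> \<open>Smoothing can only increase the logarithms of the numerators, which helps; in
      the denominators it costs at most the added mass per word, by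
      \<open>ln (1 + t) \<le> t\<close>.\<close>
    have lnle: "x * ln x \<le> x * ln (x + y)" if "x \<ge> 0" "y \<ge> 0" for x y :: real
      using that by (cases "x = 0") (auto intro!: mult_left_mono)
    have "(\<Sum>w\<in>finite_paths G (Suc k). p w * ln (p w)) \<le> (\<Sum>w\<in>finite_paths G (Suc k). p w * ln (p w + d))"
      using p0 d by (intro sum_mono lnle) auto
    then have g1: "- (\<integral>u. ?g1 u \<partial>\<nu>) \<le> rv_entropy \<nu> (pre (Suc k))"
      using integral_pre[OF \<nu>, of "\<lambda>w. ln (p w + d)" "Suc k"] by (simp add: rv_entropy_pre[OF \<nu>] p_def)
    have lnge: "x * ln (x + y) \<le> x * ln x + y" if "x \<ge> 0" "y \<ge> 0" for x y :: real
    proof (cases "x = 0")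
      case False
      then have x: "x > 0" using that by simp
      have "1 + y / x = (x + y) / x" using x by (simp add: add_divide_distrib)
      then have "ln (x + y) - ln x = ln (1 + y / x)" using x that ln_div[of "x + y" x] by simp
      also have "\<dots> \<le> y / x" using x that by (intro ln_add_one_self_le_self) auto
      finally have "x * (ln (x + y) - ln x) \<le> x * (y / x)" using x by (intro mult_left_mono) auto
      then show ?thesis using x by (simp add: right_diff_distrib)
    qed (use that in simp)
    have "(\<integral>u. ?g2 u \<partial>\<nu>) = (\<Sum>w\<in>finite_paths G k. p w * ln (p w + A * d))"
      using integral_pre[OF \<nu>, of "\<lambda>w. ln (p w + A * d)" k] by (simp add: p_def)
    also have "\<dots> \<le> (\<Sum>w\<in>finite_paths G k. p w * ln (p w) + A * d)"
      using p0 A d by (intro sum_mono lnge) auto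
    also have "\<dots> = - rv_entropy \<nu> (pre k) + M * (A * d)"
      by (simp add: sum.distrib rv_entropy_pre[OF \<nu>] p_def M_def)
    finally show ?thesis using int g1 dM k by linarith
  qed
  define N where "N = {\<nu>' \<in> path_probs G. \<bar>(\<integral>u. f u \<partial>\<nu>') - (\<integral>u. f u \<partial>\<nu>)\<bar> < \<epsilon>} \<inter>
      {\<nu>' \<in> path_probs G. \<bar>(\<integral>u. \<phi> u \<partial>\<nu>') - I\<bar> < \<epsilon>}"
  have "openin (path_weak_topology G) N"
    unfolding N_def by (intro openin_Int openin_weak_ball f_cont \<phi>)
  moreover have "\<nu> \<in> N" using \<nu> \<epsilon> by (simp add: N_def I_def)
  moreover have "\<forall>\<^sub>F n in sequentially. (\<Sum>w\<in>hit_words N n. word_weight G \<phi> w) \<le> A ^ k * exp (n * a)"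
  proof -
    obtain k0 :: nat where k0: "\<And>k u v. k \<ge> k0 \<Longrightarrow> u \<in> infinite_paths G \<Longrightarrow> v \<in> infinite_paths G \<Longrightarrow>
        pre k u = pre k v \<Longrightarrow> \<bar>birkhoff \<phi> k u - birkhoff \<phi> k v\<bar> \<le> k * \<epsilon>"
      by (rule birkhoff_variation[OF \<phi> \<epsilon>]) blast
    show ?thesis
      using eventually_gt_at_top[of 0] eventually_ge_at_top[of k0]
    proof eventually_elim
      fix n :: nat assume n: "0 < n" "k0 \<le> n"
      have bound: "word_weight G \<phi> w \<le> chain_weight k q w * exp (n * a)" if w: "w \<in> hit_words N n" for w
      proof -
        obtain u where u: "w \<in> finite_paths G n" "u \<in> cylinder G w" "empirical_measure G n u \<in> N"
          using w by (auto simp: hit_words_def)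
        have len: "length w = n" using u by (simp add: finite_paths_def)
        have uI: "u \<in> infinite_paths G" "pre n u = w" using u len by (auto simp: mem_cylinder)
        have "\<bar>birkhoff f n u / n - (\<integral>u. f u \<partial>\<nu>)\<bar> < \<epsilon>" "\<bar>birkhoff \<phi> n u / n - I\<bar> < \<epsilon>"
          using u(3) integral_empirical_measure[OF n(1) uI(1)] f_cont \<phi> by (auto simp: N_def)
        then have "birkhoff f n u / n \<ge> - c - 2 * \<epsilon>" "birkhoff \<phi> n u / n \<le> I + \<epsilon>"
          using int_f by linarith+
        then have b1: "birkhoff f n u \<ge> n * (- c - 2 * \<epsilon>)" and b2: "birkhoff \<phi> n u \<le> n * (I + \<epsilon>)"
          using n by (simp_all add: field_simps)
        have "word_weight G \<phi> w \<le> exp (n * (I + 2 * \<epsilon>))"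
        proof (rule word_weight_le[OF u(1)])
          fix v assume "v \<in> cylinder G w"
          then have "\<bar>birkhoff \<phi> n u - birkhoff \<phi> n v\<bar> \<le> n * \<epsilon>"
            using k0[OF n(2), of u v] uI len by (auto simp: mem_cylinder)
          then have "birkhoff \<phi> n v \<le> n * (I + 2 * \<epsilon>)" using b2 by (simp add: algebra_simps)
          then show "exp (birkhoff \<phi> n v) \<le> exp (n * (I + 2 * \<epsilon>))" by simp
        qed
        also have "\<dots> = exp (n * (- c - 2 * \<epsilon>)) * exp (n * a)"
          by (simp add: exp_add[symmetric] \<epsilon>_def algebra_simps)
        also have "\<dots> \<le> chain_weight k q w * exp (n * a)"
          using b1 chain_ge[OF uI(1), of n] uI(2) by (intro mult_right_mono) (auto intro: order.trans[of _ "exp (birkhoff f n u)"])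
        finally show ?thesis .
      qed
      have "(\<Sum>w\<in>hit_words N n. word_weight G \<phi> w) \<le> (\<Sum>w\<in>hit_words N n. chain_weight k q w * exp (n * a))"
        by (intro sum_mono bound)
      also have "\<dots> = (\<Sum>w\<in>hit_words N n. chain_weight k q w) * exp (n * a)"
        by (simp add: sum_distrib_right)
      also have "\<dots> \<le> (\<Sum>w | set w \<subseteq> arcs G \<and> length w = n. chain_weight k q w) * exp (n * a)"
        using chain_pos finite_lists_length_eq[OF finite_arcs, of n]
        by (intro mult_right_mono sum_mono2) (auto simp: hit_words_def finite_paths_def less_imp_le)
      also have "(\<Sum>w | set w \<subseteq> arcs G \<and> length w = n. chain_weight k q w) = A ^ min n k"
        unfolding A_def by (subst chain_weight_sum[OF finite_arcs]) (auto simp: q_sum)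
      also have "A ^ min n k * exp (n * a) \<le> A ^ k * exp (n * a)"
        using A by (intro mult_right_mono power_increasing) auto
      finally show "(\<Sum>w\<in>hit_words N n. word_weight G \<phi> w) \<le> A ^ k * exp (n * a)" .
    qed
  qed
  moreover have "0 \<le> A ^ k" using A by simp
  ultimately show ?thesis by blast
qed

text \<open>For the indicator \<open>g\<close> of a clopen set whose mass the shift changes, the
  coboundary \<open>h\<close> has nonzero integral under \<nu>, whereas its Birkhoff sums telescope
  and stay within 1. Its empirical averages therefore tend to 0 uniformly and leave a neighbourhood
  of that integral.\<close>

lemma local_upper_not_invariant:
  assumes \<nu>: "\<nu> \<in> path_probs G" and ni: "\<nu> \<notin> shift_probs G"
  shows "\<exists>N. openin (path_weak_topology G) N \<and> \<nu> \<in> N \<and>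
    (\<forall>\<^sub>F n in sequentially. hit_words N n = {})"
proof -
  interpret prob_space \<nu> by (rule borel_probsD(1)[OF \<nu>])
  obtain m W where mW: "measure \<nu> {u \<in> infinite_paths G. pre m (shift_map u) \<in> W} \<noteq>
      measure \<nu> (cyl G m W)"
    using not_invariant_cylinder[OF \<nu> ni] by blast
  define g :: "(nat \<Rightarrow> 'e) \<Rightarrow> real" where "g u = indicator W (pre m u)" for u
  define h where "h u = g (shift_map u) - g u" for u
  have h_eq: "h u = indicator W (tl (pre (Suc m) u)) - indicator W (take m (pre (Suc m) u))" for u
    by (simp add: h_def g_def pre_Suc_Cons take_pre del: take_Suc_Cons) (simp add: pre_Suc_Cons[symmetric] take_pre)
  have h_cont: "path_continuous G h"
    using continuous_map_pre[of G "\<lambda>w. indicator W (tl w) - indicator W (take m w)" "Suc m"]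
    by (simp only: h_eq[abs_def])
  have s1: "{u \<in> infinite_paths G. pre m (shift_map u) \<in> W} = cyl G (Suc m) {w. tl w \<in> W}"
    by (simp add: pre_Suc_Cons)
  have sets1: "{u \<in> infinite_paths G. pre m (shift_map u) \<in> W} \<in> sets \<nu>"
    unfolding s1 by (rule cyl_in_sets[OF \<nu>])
  have sets2: "cyl G m W \<in> sets \<nu>"
    by (rule cyl_in_sets[OF \<nu>])
  have "(\<integral>u. h u \<partial>\<nu>) = (\<integral>u. indicator {u \<in> infinite_paths G. pre m (shift_map u) \<in> W} u -
      indicator (cyl G m W) u \<partial>\<nu>)"
    using borel_probsD(3)[OF \<nu>]
    by (intro Bochner_Integration.integral_cong) (auto simp: h_def g_def indicator_def)
  also have "\<dots> = measure \<nu> {u \<in> infinite_paths G. pre m (shift_map u) \<in> W} -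
      measure \<nu> (cyl G m W)"
    using sets1 sets2 by (subst Bochner_Integration.integral_diff) (auto simp: emeasure_eq_measure)
  finally have "(\<integral>u. h u \<partial>\<nu>) \<noteq> 0" using mW by simp
  define \<delta> where "\<delta> = \<bar>\<integral>u. h u \<partial>\<nu>\<bar>"
  have \<delta>: "\<delta> > 0" using \<open>(\<integral>u. h u \<partial>\<nu>) \<noteq> 0\<close> by (simp add: \<delta>_def)
  define N where "N = {\<nu>' \<in> path_probs G. \<bar>(\<integral>u. h u \<partial>\<nu>') - (\<integral>u. h u \<partial>\<nu>)\<bar> < \<delta> / 2}"
  have "openin (path_weak_topology G) N" unfolding N_def by (rule openin_weak_ball[OF h_cont])
  moreover have "\<nu> \<in> N" using \<nu> \<delta> by (simp add: N_def)
  moreover have "\<forall>\<^sub>F n in sequentially. hit_words N n = {}"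
  proof -
    have "\<forall>\<^sub>F n in sequentially. 2 / \<delta> < real n"
      using filterlim_real_sequentially unfolding filterlim_at_top_dense by auto
    then show ?thesis using eventually_gt_at_top[of 0]
    proof eventually_elim
      fix n :: nat assume n: "2 / \<delta> < real n" "0 < n"
      have "empirical_measure G n u \<notin> N" if u: "u \<in> infinite_paths G" for u
      proof
        assume "empirical_measure G n u \<in> N"
        then have "\<bar>birkhoff h n u / n - (\<integral>u. h u \<partial>\<nu>)\<bar> < \<delta> / 2"
          using integral_empirical_measure[OF n(2) u h_cont] by (simp add: N_def)
        moreover have tele: "birkhoff h n u = g ((shift_map ^^ n) u) - g u"
          unfolding birkhoff_def h_def by (induction n) auto
        have "\<bar>birkhoff h n u\<bar> \<le> 1" unfolding tele g_def by (auto simp: indicator_def)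
        then have "\<bar>birkhoff h n u / n\<bar> \<le> 1 / n" using n by (simp add: divide_right_mono)
        moreover have "1 / n < \<delta> / 2" using n \<delta> by (simp add: field_simps)
        ultimately show False unfolding \<delta>_def by linarith
      qed
      then show "hit_words N n = {}" by (auto simp: hit_words_def mem_cylinder)
    qed
  qed
  ultimately show ?thesis by blast
qed

end

section \<open>From local estimates to a bound on the partition sums\<close>

lemma mem_set_ball: "x \<in> set_ball C r \<longleftrightarrow> (\<exists>c\<in>C. dist x c < r)"
  by (simp add: set_ball_def INF_less_iff)

lemma set_ball_mono: "r \<le> s \<Longrightarrow> set_ball C r \<subseteq> set_ball C s"
  by (force simp: mem_set_ball)

lemma continuous_map_ball_preimage:
  assumes U: "continuous_map X euclidean (U :: 'a \<Rightarrow> 'x::metric_space)"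
  shows "openin X {x \<in> topspace X. dist (U x) y < \<rho>}"
proof -
  have "{x \<in> topspace X. dist (U x) y < \<rho>} = {x \<in> topspace X. U x \<in> ball y \<rho>}"
    by (auto simp: dist_commute)
  then show ?thesis using openin_continuous_map_preimage[OF U, of "ball y \<rho>"] by simp
qed

context path_system
begin

lemma Z_sum_mono:
  assumes \<phi>: "path_continuous G \<phi>" and "D \<subseteq> E"
  shows "Z_sum G U \<phi> D n \<le> Z_sum G U \<phi> E n"
  unfolding Z_sum_word_weight
  using assms finite_finite_paths word_weight_nonneg[OF \<phi>]
  by (intro sum_mono2) auto

lemma Z_sum_nonneg:
  assumes \<phi>: "path_continuous G \<phi>"
  shows "0 \<le> Z_sum G U \<phi> D n"
  unfolding Z_sum_word_weight using word_weight_nonneg[OF \<phi>] by (auto intro: sum_nonneg)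

text \<open>Only invariant \<nu> with \<open>U \<nu>\<close> in the closure of \<open>C\<close> need
  an estimate. Near a non-invariant \<nu> there are eventually no words; if \<open>U \<nu>\<close>
  has distance at least \<rho> from \<open>C\<close>, radii \<open>\<rho> / 2\<close> around both
  already exclude each other. These two cases have \<open>K = 0\<close>.\<close>

lemma local_upper:
  fixes U :: "(nat \<Rightarrow> 'e) measure \<Rightarrow> 'x::metric_space" and a :: real
  assumes U: "continuous_map (path_weak_topology G) euclidean U"
    and \<phi>: "path_continuous G \<phi>"
    and a: "\<And>\<nu>. \<nu> \<in> shift_probs G \<Longrightarrow> U \<nu> \<in> closure C \<Longrightarrow>
      ks_entropy shift_map \<nu> + ereal (\<integral>u. \<phi> u \<partial>\<nu>) < ereal a"
    and \<nu>: "\<nu> \<in> path_probs G"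
  shows "\<exists>N r K. openin (path_weak_topology G) N \<and> \<nu> \<in> N \<and> 0 < r \<and> 0 \<le> K \<and>
    (\<forall>\<^sub>F n in sequentially.
      (\<Sum>w\<in>hit_words (N \<inter> U -` set_ball C r) n. word_weight G \<phi> w) \<le> K * exp (n * a))"
proof -
  have mono: "(\<Sum>w\<in>hit_words (N \<inter> U -` set_ball C r) n. word_weight G \<phi> w) \<le> (\<Sum>w\<in>hit_words N n. word_weight G \<phi> w)"
    for N r n
    using finite_hit_words word_weight_nonneg[OF \<phi>]
    by (intro sum_mono2) (auto simp: hit_words_def)
  consider (inv) "U \<nu> \<in> closure C" "\<nu> \<in> shift_probs G"
    | (ninv) "\<nu> \<notin> shift_probs G"
    | (far) "U \<nu> \<notin> closure C" by blast
  then show ?thesis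
  proof cases
    case inv
    obtain N K where NK: "openin (path_weak_topology G) N" "\<nu> \<in> N" "0 \<le> K"
        "\<forall>\<^sub>F n in sequentially. (\<Sum>w\<in>hit_words N n. word_weight G \<phi> w) \<le> K * exp (n * a)"
      using local_upper_invariant[OF inv(2) \<phi> a[OF inv(2,1)]] by blast
    have "\<forall>\<^sub>F n in sequentially.
        (\<Sum>w\<in>hit_words (N \<inter> U -` set_ball C 1) n. word_weight G \<phi> w) \<le> K * exp (n * a)"
      using NK(4) by eventually_elim (rule order.trans[OF mono])
    then show ?thesis using NK by (intro exI[of _ N] exI[of _ "1::real"] exI[of _ K]) auto
  next
    case ninv
    obtain N where N: "openin (path_weak_topology G) N" "\<nu> \<in> N"
        "\<forall>\<^sub>F n in sequentially. hit_words N n = {}"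
      using local_upper_not_invariant[OF \<nu> ninv] by blast
    have "\<forall>\<^sub>F n in sequentially.
        (\<Sum>w\<in>hit_words (N \<inter> U -` set_ball C 1) n. word_weight G \<phi> w) \<le> 0 * exp (n * a)"
      using N(3)
    proof eventually_elim
      fix n assume "hit_words N n = {}"
      then show "(\<Sum>w\<in>hit_words (N \<inter> U -` set_ball C 1) n. word_weight G \<phi> w) \<le> 0 * exp (n * a)"
        using mono[of N 1 n] by simp
    qed
    then show ?thesis using N by (intro exI[of _ N] exI[of _ "1::real"] exI[of _ "0::real"]) auto
  next
    case far
    then obtain \<rho> where \<rho>: "\<rho> > 0" "\<And>c. c \<in> C \<Longrightarrow> dist c (U \<nu>) \<ge> \<rho>"
      unfolding closure_approachable by (auto simp: not_less)
    define N where "N = {\<nu>' \<in> topspace (path_weak_topology G). dist (U \<nu>') (U \<nu>) < \<rho> / 2}"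
    have "openin (path_weak_topology G) N"
      unfolding N_def by (rule continuous_map_ball_preimage[OF U])
    moreover have "\<nu> \<in> N" using \<nu> \<rho> by (simp add: N_def)
    moreover have "N \<inter> U -` set_ball C (\<rho> / 2) = {}"
    proof (rule ccontr)
      assume "\<not> ?thesis"
      then obtain \<nu>' c where *: "dist (U \<nu>') (U \<nu>) < \<rho> / 2" "c \<in> C" "dist (U \<nu>') c < \<rho> / 2"
        by (auto simp: N_def mem_set_ball)
      then have "dist c (U \<nu>) < \<rho>" using dist_triangle3[of c "U \<nu>" "U \<nu>'"] by linarith
      then show False using \<rho>(2)[OF *(2)] by simp
    qed
    then have "(\<Sum>w\<in>hit_words (N \<inter> U -` set_ball C (\<rho> / 2)) n. word_weight G \<phi> w) \<le> 0 * exp (n * a)" for n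
      by (simp add: hit_words_def)
    ultimately show ?thesis using \<rho>(1)
      by (intro exI[of _ N] exI[of _ "\<rho> / 2"] exI[of _ "0::real"]) auto
  qed
qed

text \<open>A finite subcover, with the minimum of the local radii and the sum of the local
  constants. The constant \<open>K\<close> is absorbed later by a slightly larger exponent.\<close>

lemma Z_sum_upper:
  fixes U :: "(nat \<Rightarrow> 'e) measure \<Rightarrow> 'x::metric_space" and a :: real
  assumes U: "continuous_map (path_weak_topology G) euclidean U"
    and \<phi>: "path_continuous G \<phi>"
    and a: "\<And>\<nu>. \<nu> \<in> shift_probs G \<Longrightarrow> U \<nu> \<in> closure C \<Longrightarrow>
      ks_entropy shift_map \<nu> + ereal (\<integral>u. \<phi> u \<partial>\<nu>) < ereal a"
  shows "\<exists>r>0. \<exists>K\<ge>0. \<forall>\<^sub>F n in sequentially. Z_sum G U \<phi> (set_ball C r) n \<le> K * exp (n * a)"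
proof -
  let ?W = "path_weak_topology G"
  let ?S = "\<lambda>N r n. \<Sum>w\<in>hit_words (N \<inter> U -` set_ball C r) n. word_weight G \<phi> w"
  have "\<forall>\<nu>\<in>path_probs G. \<exists>t. openin ?W (fst t) \<and> \<nu> \<in> fst t \<and> 0 < fst (snd t) \<and> 0 \<le> snd (snd t) \<and>
      (\<forall>\<^sub>F n in sequentially. ?S (fst t) (fst (snd t)) n \<le> snd (snd t) * exp (n * a))"
    using local_upper[OF U \<phi> a] by fastforce
  from bchoice[OF this] obtain t where t: "\<forall>\<nu>\<in>path_probs G. openin ?W (fst (t \<nu>)) \<and>
      \<nu> \<in> fst (t \<nu>) \<and> 0 < fst (snd (t \<nu>)) \<and> 0 \<le> snd (snd (t \<nu>)) \<and>
      (\<forall>\<^sub>F n in sequentially. ?S (fst (t \<nu>)) (fst (snd (t \<nu>))) n \<le> snd (snd (t \<nu>)) * exp (n * a))" ..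
  define N r K where "N \<nu> = fst (t \<nu>)" and "r \<nu> = fst (snd (t \<nu>))" and "K \<nu> = snd (snd (t \<nu>))" for \<nu>
  have N: "openin ?W (N \<nu>)" "\<nu> \<in> N \<nu>" and r: "0 < r \<nu>" and K: "0 \<le> K \<nu>"
    and S: "\<forall>\<^sub>F n in sequentially. ?S (N \<nu>) (r \<nu>) n \<le> K \<nu> * exp (n * a)"
    if "\<nu> \<in> path_probs G" for \<nu>
    using t that by (auto simp: N_def r_def K_def)
  have "\<exists>\<F>. finite \<F> \<and> \<F> \<subseteq> N ` path_probs G \<and> topspace ?W \<subseteq> \<Union>\<F>"
    using N by (intro compact_space_weak_topology[unfolded compact_space_alt, rule_format]) auto
  then obtain \<F> where \<F>: "finite \<F>" "\<F> \<subseteq> N ` path_probs G" "topspace ?W \<subseteq> \<Union>\<F>"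
    by blast
  then obtain X where X: "finite X" "X \<subseteq> path_probs G" "\<F> = N ` X"
    by (meson finite_subset_image)
  define r0 where "r0 = Min (insert 1 (r ` X))"
  have r0: "r0 > 0" using X r by (auto simp: r0_def)
  have r0_le: "r0 \<le> r \<nu>" if "\<nu> \<in> X" for \<nu> using X(1) that by (auto simp: r0_def)
  have "\<forall>\<^sub>F n in sequentially. \<forall>\<nu>\<in>X. ?S (N \<nu>) (r \<nu>) n \<le> K \<nu> * exp (n * a)"
    using S X by (intro eventually_ball_finite) auto
  then have "\<forall>\<^sub>F n in sequentially. Z_sum G U \<phi> (set_ball C r0) n \<le> (\<Sum>\<nu>\<in>X. K \<nu>) * exp (n * a)"
    using eventually_gt_at_top[of 0]
  proof eventually_elim
    fix n :: nat
    assume n: "0 < n" and le: "\<forall>\<nu>\<in>X. ?S (N \<nu>) (r \<nu>) n \<le> K \<nu> * exp (n * a)"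
    let ?A = "{w \<in> finite_paths G n. (\<lambda>u. U (empirical_measure G n u)) ` cylinder G w \<subseteq> set_ball C r0}"
    have sub: "?A \<subseteq> (\<Union>\<nu>\<in>X. hit_words (N \<nu> \<inter> U -` set_ball C (r \<nu>)) n)"
    proof
      fix w assume w: "w \<in> ?A"
      then obtain u where u: "u \<in> cylinder G w" using cylinder_nonempty by blast
      let ?L = "empirical_measure G n u"
      have "?L \<in> topspace ?W"
        using empirical_measure_borel_probs[OF n, of u] u by (auto simp: mem_cylinder)
      then obtain \<nu> where \<nu>: "\<nu> \<in> X" "?L \<in> N \<nu>" using \<F>(3) X(3) by auto
      have "U ?L \<in> set_ball C (r \<nu>)"
        using w u set_ball_mono[OF r0_le[OF \<nu>(1)], of C] by blast
      then have "w \<in> hit_words (N \<nu> \<inter> U -` set_ball C (r \<nu>)) n"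
        using w u \<nu> unfolding hit_words_def by blast
      then show "w \<in> (\<Union>\<nu>\<in>X. hit_words (N \<nu> \<inter> U -` set_ball C (r \<nu>)) n)" using \<nu>(1) by blast
    qed
    \<comment> \<open>The weight is set to 0 off the finite paths, because the sum comparison asks
      for a nonnegative function on all lists and a real supremum over an empty cylinder has no
      evident sign.\<close>
    let ?f = "\<lambda>w. if w \<in> finite_paths G n then word_weight G \<phi> w else 0"
    have "Z_sum G U \<phi> (set_ball C r0) n = sum ?f ?A"
      unfolding Z_sum_word_weight by (intro sum.cong) auto
    also have "\<dots> \<le> (\<Sum>\<nu>\<in>X. sum ?f (hit_words (N \<nu> \<inter> U -` set_ball C (r \<nu>)) n))"
      by (rule sum_le_sum_Union[OF X(1) finite_hit_words sub]) (auto simp: word_weight_nonneg[OF \<phi>])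
    also have "\<dots> = (\<Sum>\<nu>\<in>X. ?S (N \<nu>) (r \<nu>) n)"
      by (intro sum.cong refl) (auto simp: hit_words_def)
    also have "\<dots> \<le> (\<Sum>\<nu>\<in>X. K \<nu> * exp (n * a))" using le by (intro sum_mono) auto
    finally show "Z_sum G U \<phi> (set_ball C r0) n \<le> (\<Sum>\<nu>\<in>X. K \<nu>) * exp (n * a)"
      by (simp add: sum_distrib_right)
  qed
  moreover have "0 \<le> (\<Sum>\<nu>\<in>X. K \<nu>)" using K X by (intro sum_nonneg) auto
  ultimately show ?thesis using r0 by blast
qed

end

section \<open>Lower bound\<close>

definition list_prob :: "('a \<Rightarrow> real) \<Rightarrow> 'a list \<Rightarrow> real" where
  "list_prob p xs = prod_list (map p xs)"

lemma sum_lists_Suc: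
  fixes F :: "'a list \<Rightarrow> real"
  assumes "finite B"
  shows "(\<Sum>xs | set xs \<subseteq> B \<and> length xs = Suc m. F xs) =
    (\<Sum>xs | set xs \<subseteq> B \<and> length xs = m. \<Sum>x\<in>B. F (x # xs))"
proof -
  let ?L = "{xs. set xs \<subseteq> B \<and> length xs = m}"
  have inj: "inj_on (\<lambda>(xs, x). x # xs) (?L \<times> B)" by (auto simp: inj_on_def)
  show ?thesis
    unfolding lists_length_Suc_eq sum.reindex[OF inj] sum.cartesian_product
    by (simp add: case_prod_unfold)
qed

text \<open>Total mass, mean and variance of a sum of \<open>m\<close> independent centred
  variables, by splitting off the first draw; the cross term of the square vanishes because
  \<open>g\<close> is centred.\<close>

lemma list_prob_moments:
  fixes p g :: "'a \<Rightarrow> real"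
  assumes B: "finite B" and p1: "(\<Sum>x\<in>B. p x) = 1" and g0: "(\<Sum>x\<in>B. p x * g x) = 0"
  shows "(\<Sum>xs | set xs \<subseteq> B \<and> length xs = m. list_prob p xs) = 1" (is "?A m = 1")
    and "(\<Sum>xs | set xs \<subseteq> B \<and> length xs = m. list_prob p xs * sum_list (map g xs)) = 0" (is "?B m = 0")
    and "(\<Sum>xs | set xs \<subseteq> B \<and> length xs = m. list_prob p xs * (sum_list (map g xs))\<^sup>2) =
      m * (\<Sum>x\<in>B. p x * (g x)\<^sup>2)" (is "?C m = _")
proof -
  have nil: "{xs. set xs \<subseteq> B \<and> length xs = 0} = {[]}" by auto
  let ?L = "\<lambda>m. {xs. set xs \<subseteq> B \<and> length xs = m}"
  let ?V = "\<Sum>x\<in>B. p x * (g x)\<^sup>2"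
  have A: "?A (Suc m) = ?A m" for m
    unfolding sum_lists_Suc[OF B] by (simp add: list_prob_def sum_distrib_right[symmetric] p1)
  show A1: "?A m = 1" for m
  proof (induction m)
    case 0 then show ?case unfolding nil by (simp add: list_prob_def)
  qed (simp add: A)
  have B: "?B (Suc m) = ?B m" for m
  proof -
    have "(\<Sum>x\<in>B. list_prob p (x # xs) * sum_list (map g (x # xs))) = list_prob p xs * sum_list (map g xs)" for xs
    proof -
      have "(\<Sum>x\<in>B. list_prob p (x # xs) * sum_list (map g (x # xs))) =
          (\<Sum>x\<in>B. list_prob p xs * (p x * g x) + list_prob p xs * sum_list (map g xs) * p x)"
        by (intro sum.cong) (auto simp: list_prob_def algebra_simps)
      then show ?thesis by (simp add: sum.distrib sum_distrib_left[symmetric] g0 p1)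
    qed
    then show ?thesis unfolding sum_lists_Suc[OF B] by simp
  qed
  show B0: "?B m = 0" for m
  proof (induction m)
    case 0 then show ?case unfolding nil by simp
  qed (simp add: B)
  have C: "?C (Suc m) = ?V + ?C m" for m
  proof -
    have "(\<Sum>x\<in>B. list_prob p (x # xs) * (sum_list (map g (x # xs)))\<^sup>2) =
        list_prob p xs * ?V + list_prob p xs * (sum_list (map g xs))\<^sup>2" for xs
    proof -
      have "(\<Sum>x\<in>B. list_prob p (x # xs) * (sum_list (map g (x # xs)))\<^sup>2) =
          (\<Sum>x\<in>B. list_prob p xs * (p x * (g x)\<^sup>2) + list_prob p xs * (2 * sum_list (map g xs)) * (p x * g x) +
            list_prob p xs * (sum_list (map g xs))\<^sup>2 * p x)"
        by (intro sum.cong) (auto simp: list_prob_def power2_eq_square algebra_simps)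
      then show ?thesis by (simp add: sum.distrib sum_distrib_left[symmetric] g0 p1)
    qed
    then have "?C (Suc m) = (\<Sum>xs\<in>?L m. list_prob p xs * ?V + list_prob p xs * (sum_list (map g xs))\<^sup>2)"
      unfolding sum_lists_Suc[OF assms(1)] by simp
    also have "\<dots> = ?A m * ?V + ?C m" by (simp add: sum.distrib sum_distrib_right)
    finally show ?thesis by (simp add: A1)
  qed
  show "?C m = m * ?V"
  proof (induction m)
    case 0 then show ?case unfolding nil by simp
  qed (simp add: C algebra_simps)
qed

text \<open>Chebyshev's inequality for each observable, and a union bound over the finitely many of
  them. A deviation of 1 per draw can be afforded: a draw will be a block of \<open>k\<close>
  letters, so this costs only \<open>1 / k\<close> per letter.\<close>

lemma typical_lists:
  fixes p :: "'a \<Rightarrow> real"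
  assumes B: "finite B" and p0: "\<And>x. x \<in> B \<Longrightarrow> 0 \<le> p x" and p1: "(\<Sum>x\<in>B. p x) = 1" and \<G>: "finite \<G>"
  shows "\<forall>\<^sub>F m in sequentially. 1 / 2 \<le> (\<Sum>xs | (set xs \<subseteq> B \<and> length xs = m) \<and>
      (\<forall>g\<in>\<G>. \<bar>sum_list (map g xs) - m * (\<Sum>x\<in>B. p x * g x)\<bar> \<le> m). list_prob p xs)"
proof -
  let ?L = "\<lambda>m. {xs. set xs \<subseteq> B \<and> length xs = m}"
  define gb where "gb g = (\<Sum>x\<in>B. p x * g x)" for g :: "'a \<Rightarrow> real"
  define V where "V g = (\<Sum>x\<in>B. p x * (g x - gb g)\<^sup>2)" for g
  define bad where "bad m g = {xs \<in> ?L m. \<bar>sum_list (map g xs) - m * gb g\<bar> > m}" for m :: nat and g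
  have finL: "finite (?L m)" for m by (rule finite_lists_length_eq[OF B])
  have lp0: "0 \<le> list_prob p xs" if "xs \<in> ?L m" for xs m
    unfolding list_prob_def by (intro prod_list_nonneg) (use that p0 in \<open>auto simp: subset_iff\<close>)
  have cent: "(\<Sum>x\<in>B. p x * (g x - gb g)) = 0" for g
    by (simp add: right_diff_distrib sum_subtractf sum_distrib_right[symmetric] p1 gb_def)
  have total: "(\<Sum>xs\<in>?L m. list_prob p xs) = 1" for m
    using list_prob_moments(1)[OF B p1 cent[of "\<lambda>_. 0"]] .
  have bad: "(\<Sum>xs\<in>bad m g. list_prob p xs) \<le> V g / m" if m: "m > 0" for m g
  proof -
    have "m * m * (\<Sum>xs\<in>bad m g. list_prob p xs) = (\<Sum>xs\<in>bad m g. list_prob p xs * (real m)\<^sup>2)"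
      by (simp add: sum_distrib_left power2_eq_square mult_ac)
    also have "\<dots> \<le> (\<Sum>xs\<in>bad m g. list_prob p xs * (sum_list (map (\<lambda>x. g x - gb g) xs))\<^sup>2)"
    proof (intro sum_mono mult_left_mono)
      fix xs assume xs: "xs \<in> bad m g"
      have "sum_list (map (\<lambda>x. g x - gb g) xs) = sum_list (map g xs) - m * gb g"
        using xs by (simp add: bad_def sum_list_subtractf sum_list_triv)
      then show "(real m)\<^sup>2 \<le> (sum_list (map (\<lambda>x. g x - gb g) xs))\<^sup>2"
        using xs by (simp add: bad_def abs_le_square_iff[symmetric])
      show "0 \<le> list_prob p xs" using xs lp0 by (auto simp: bad_def)
    qed
    also have "\<dots> \<le> (\<Sum>xs\<in>?L m. list_prob p xs * (sum_list (map (\<lambda>x. g x - gb g) xs))\<^sup>2)"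
      using finL lp0 by (intro sum_mono2) (auto simp: bad_def)
    also have "\<dots> = m * V g"
      unfolding V_def by (rule list_prob_moments(3)[OF B p1 cent])
    finally have "m * (\<Sum>xs\<in>bad m g. list_prob p xs) \<le> V g" using m by (simp add: mult.assoc)
    then show ?thesis using m by (simp add: field_simps)
  qed
  have "(\<lambda>m. (\<Sum>g\<in>\<G>. V g) / real m) \<longlonglongrightarrow> 0" by (rule lim_const_over_n)
  then have "\<forall>\<^sub>F m in sequentially. (\<Sum>g\<in>\<G>. V g) / real m < 1 / 2"
    by (rule order_tendstoD) simp
  then show ?thesis using eventually_gt_at_top[of 0]
  proof eventually_elim
    fix m :: nat assume m: "(\<Sum>g\<in>\<G>. V g) / real m < 1 / 2" "0 < m"
    let ?T = "{xs. (set xs \<subseteq> B \<and> length xs = m) \<and> (\<forall>g\<in>\<G>. \<bar>sum_list (map g xs) - m * gb g\<bar> \<le> m)}"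
    let ?f = "\<lambda>xs. if xs \<in> ?L m then list_prob p xs else 0"
    have "(\<Sum>xs\<in>?L m - ?T. list_prob p xs) = sum ?f (?L m - ?T)" by (intro sum.cong) auto
    also have "\<dots> \<le> (\<Sum>g\<in>\<G>. sum ?f (bad m g))"
    proof (rule sum_le_sum_Union[OF \<G>])
      show "finite (bad m g)" for g by (rule finite_subset[OF _ finL[of m]]) (auto simp: bad_def)
      show "?L m - ?T \<subseteq> (\<Union>g\<in>\<G>. bad m g)" by (auto simp: bad_def not_le)
      show "0 \<le> ?f xs" for xs using lp0 by simp
    qed
    also have "\<dots> = (\<Sum>g\<in>\<G>. \<Sum>xs\<in>bad m g. list_prob p xs)"
      by (intro sum.cong refl) (auto simp: bad_def)
    also have "\<dots> \<le> (\<Sum>g\<in>\<G>. V g / m)" by (intro sum_mono bad m)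
    also have "\<dots> < 1 / 2" using m by (simp add: sum_divide_distrib)
    finally have small: "(\<Sum>xs\<in>?L m - ?T. list_prob p xs) < 1 / 2" .
    have "(\<Sum>xs\<in>?L m. list_prob p xs) = (\<Sum>xs\<in>?L m - ?T. list_prob p xs) + (\<Sum>xs\<in>?T. list_prob p xs)"
      by (rule sum.subset_diff[OF _ finL]) auto
    then have "1 / 2 \<le> (\<Sum>xs\<in>?T. list_prob p xs)"
      using small total[of m] by linarith
    then show "1 / 2 \<le> (\<Sum>xs | (set xs \<subseteq> B \<and> length xs = m) \<and>
      (\<forall>g\<in>\<G>. \<bar>sum_list (map g xs) - m * (\<Sum>x\<in>B. p x * g x)\<bar> \<le> m). list_prob p xs)"
      unfolding gb_def .
  qed
qed

section \<open>Gluing blocks along connecting paths\<close>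

fun glue :: "('e \<Rightarrow> 'e \<Rightarrow> 'e list) \<Rightarrow> 'e list list \<Rightarrow> 'e list" where
  "glue c [] = []"
| "glue c [b] = b"
| "glue c (b # b' # bs) = b @ c (last b) (hd b') @ glue c (b' # bs)"

context path_system
begin

abbreviation linked :: "'e list \<Rightarrow> bool" where
  "linked \<equiv> successively (\<lambda>e f. head G e = tail G f)"

lemma connector_exists:
  assumes "e \<in> arcs G" "f \<in> arcs G"
  shows "\<exists>c. set c \<subseteq> arcs G \<and> linked (e # c @ [f])"
proof -
  have "head G e \<in> verts G" "tail G f \<in> verts G" using assms by auto
  then obtain c where c: "awalk (head G e) c (tail G f)"
    using sconn unfolding strongly_connected_def reachable_awalk by blast
  have "linked (e # c @ [f])" if "cas (head G e) c (tail G f)" for c e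
    using that by (induction c arbitrary: e) auto
  then show ?thesis using c by (auto simp: awalk_def)
qed

text \<open>There are finitely many pairs of arcs, so the chosen connecting paths have a common
  length bound, available before any block length is chosen.\<close>

lemma bounded_connectors:
  obtains c and Lm :: nat where
    "\<And>e f. e \<in> arcs G \<Longrightarrow> f \<in> arcs G \<Longrightarrow> set (c e f) \<subseteq> arcs G \<and> linked (e # c e f @ [f]) \<and> length (c e f) \<le> Lm"
proof -
  obtain c where c: "\<And>e f. e \<in> arcs G \<Longrightarrow> f \<in> arcs G \<Longrightarrow> set (c e f) \<subseteq> arcs G \<and> linked (e # c e f @ [f])"
    using connector_exists by metis
  define Lm where "Lm = Max ((\<lambda>(e, f). length (c e f)) ` (arcs G \<times> arcs G))"
  have "length (c e f) \<le> Lm" if "e \<in> arcs G" "f \<in> arcs G" for e f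
    unfolding Lm_def using that finite_arcs by (intro Max_ge) auto
  then show ?thesis using c by (intro that[of c Lm]) auto
qed

end

locale gluing = path_system G for G :: "('v, 'e) pre_digraph" +
  fixes c :: "'e \<Rightarrow> 'e \<Rightarrow> 'e list" and Lm k :: nat
  assumes conn: "\<And>e f. e \<in> arcs G \<Longrightarrow> f \<in> arcs G \<Longrightarrow>
      set (c e f) \<subseteq> arcs G \<and> successively (\<lambda>e f. head G e = tail G f) (e # c e f @ [f]) \<and> length (c e f) \<le> Lm"
    and k_pos: "k > 0"
begin

lemma block_arcs:
  assumes "b \<in> finite_paths G k"
  shows "b \<noteq> []" "hd b \<in> arcs G" "last b \<in> arcs G" "length b = k" "set b \<subseteq> arcs G" "linked b"
proof -
  show "length b = k" "set b \<subseteq> arcs G" "linked b" using assms by (auto simp: finite_paths_iff)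
  show "b \<noteq> []" using \<open>length b = k\<close> k_pos by auto
  then show "hd b \<in> arcs G" "last b \<in> arcs G" using \<open>set b \<subseteq> arcs G\<close> by auto
qed

lemma glue_path:
  assumes "set bs \<subseteq> finite_paths G k"
  shows "set (glue c bs) \<subseteq> arcs G \<and> linked (glue c bs) \<and>
    length bs * k \<le> length (glue c bs) \<and> length (glue c bs) \<le> length bs * (k + Lm) \<and>
    (bs \<noteq> [] \<longrightarrow> glue c bs \<noteq> [] \<and> hd (glue c bs) = hd (hd bs))"
  using assms
proof (induction bs rule: induct_list012)
  case (2 b)
  then show ?case using block_arcs[of b] by auto
next
  case (3 b b' bs)
  then have b: "b \<in> finite_paths G k" and b': "b' \<in> finite_paths G k" by auto
  note bb = block_arcs[OF b] and bb' = block_arcs[OF b']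
  define g where "g = glue c (b' # bs)"
  define d where "d = c (last b) (hd b')"
  have d: "set d \<subseteq> arcs G" "linked (last b # d @ [hd b'])" "length d \<le> Lm"
    using conn[OF bb(3) bb'(2)] by (auto simp: d_def)
  have g: "set g \<subseteq> arcs G" "linked g" "length (b' # bs) * k \<le> length g"
      "length g \<le> length (b' # bs) * (k + Lm)" "g \<noteq> []" "hd g = hd b'"
    using 3 by (auto simp: g_def)
  have eq: "glue c (b # b' # bs) = b @ d @ g" by (simp add: g_def d_def)
  have "linked ([last b] @ d @ [hd b'])" using d(2) by simp
  then have "linked d" "d \<noteq> [] \<Longrightarrow> head G (last b) = tail G (hd d) \<and> head G (last d) = tail G (hd b')"
      "d = [] \<Longrightarrow> head G (last b) = tail G (hd b')"
    unfolding successively_append_iff by auto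
  then have "linked (b @ d @ g)"
    using g bb by (cases "d = []") (simp_all add: successively_append_iff)
  moreover have "length (b # b' # bs) * k \<le> length (b @ d @ g)"
    using g(3) bb(4) by simp
  moreover have "length (b @ d @ g) \<le> length (b # b' # bs) * (k + Lm)"
    using g(4) d(3) bb(4) by simp
  ultimately show ?case unfolding eq using d(1) g(1) bb(1,5) by simp
qed simp

text \<open>Peels off the first block, the common induction step for estimating Birkhoff sums along
  a gluing and for counting its fibres.\<close>

lemma glue_Cons_prefix:
  assumes b: "b \<in> finite_paths G k" and b': "b' \<in> finite_paths G k"
    and pre: "pre (length (glue c (b # b' # bs))) u = glue c (b # b' # bs)"
  defines "d \<equiv> c (last b) (hd b')" and "g \<equiv> glue c (b' # bs)"
  shows "length d \<le> Lm" "length (glue c (b # b' # bs)) = k + (length d + length g)"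
    "pre k u = b" "pre (length g) ((shift_map ^^ (k + length d)) u) = g"
proof -
  note bb = block_arcs[OF b] and bb' = block_arcs[OF b']
  show "length d \<le> Lm" using conn[OF bb(3) bb'(2)] by (auto simp: d_def)
  have eq: "glue c (b # b' # bs) = b @ d @ g" by (simp add: g_def d_def)
  show len: "length (glue c (b # b' # bs)) = k + (length d + length g)" unfolding eq using bb by simp
  have "pre (k + (length d + length g)) u = b @ d @ g" using pre[unfolded len] unfolding eq .
  then have app: "pre k u @ pre (length d) ((shift_map ^^ k) u) @
      pre (length g) ((shift_map ^^ length d) ((shift_map ^^ k) u)) = b @ d @ g"
    by (simp add: pre_add)
  have "length (pre k u) = length b" using bb(4) by simp
  then have 1: "pre k u = b \<and> pre (length d) ((shift_map ^^ k) u) @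
      pre (length g) ((shift_map ^^ length d) ((shift_map ^^ k) u)) = d @ g"
    using app append_eq_append_conv by blast
  then show "pre k u = b" by blast
  have "pre (length g) ((shift_map ^^ length d) ((shift_map ^^ k) u)) = g"
    using conjunct2[OF 1] by (subst (asm) append_eq_append_conv) auto
  then show "pre (length g) ((shift_map ^^ (k + length d)) u) = g"
    by (simp add: shift_map_funpow add.assoc)
qed

text \<open>A block costs its variation \<open>k * \<eta>\<close> and a connecting path at most
  \<open>Lm * Fb\<close>. Charging a connecting path to the last block as well gives a bound linear
  in the number of blocks.\<close>

lemma glue_birkhoff:
  fixes \<eta> Fb :: real
  assumes var: "\<And>u v. u \<in> infinite_paths G \<Longrightarrow> v \<in> infinite_paths G \<Longrightarrow> pre k u = pre k v \<Longrightarrow>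
      \<bar>birkhoff f k u - birkhoff f k v\<bar> \<le> k * \<eta>"
    and Fb: "0 \<le> Fb" "\<And>u. u \<in> infinite_paths G \<Longrightarrow> \<bar>f u\<bar> \<le> Fb"
    and bs: "set bs \<subseteq> finite_paths G k" and u: "u \<in> infinite_paths G"
    and pre: "pre (length (glue c bs)) u = glue c bs"
  shows "\<bar>birkhoff f (length (glue c bs)) u - sum_list (map (\<lambda>b. birkhoff f k (rep k b)) bs)\<bar> \<le>
    length bs * (k * \<eta> + Lm * Fb)"
  using bs u pre
proof (induction bs arbitrary: u rule: induct_list012)
  case (2 b)
  then have b: "b \<in> finite_paths G k" by simp
  have "\<bar>birkhoff f k u - birkhoff f k (rep k b)\<bar> \<le> k * \<eta>"
    using var[OF 2(2) rep(1)[OF b]] 2(3) rep(2)[OF b] block_arcs(4)[OF b] by simp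
  moreover have "0 \<le> Lm * Fb" using Fb by simp
  ultimately show ?case using block_arcs(4)[OF b] by simp
next
  case (3 b b' bs)
  then have b: "b \<in> finite_paths G k" and b': "b' \<in> finite_paths G k" by auto
  define g where "g = glue c (b' # bs)"
  define d where "d = c (last b) (hd b')"
  note parts = glue_Cons_prefix[OF b b' 3(5), folded g_def d_def]
  let ?u1 = "(shift_map ^^ k) u" and ?u2 = "(shift_map ^^ (k + length d)) u"
  have u1: "?u1 \<in> infinite_paths G" and u2: "?u2 \<in> infinite_paths G"
    using 3(4) by (auto intro: shift_map_funpow_infinite_paths)
  have IH: "\<bar>birkhoff f (length g) ?u2 - sum_list (map (\<lambda>b. birkhoff f k (rep k b)) (b' # bs))\<bar> \<le>
      length (b' # bs) * (k * \<eta> + Lm * Fb)"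
    unfolding g_def using 3(3) u2 parts(4) by (intro 3(2)) (auto simp: g_def)
  have v1: "\<bar>birkhoff f k u - birkhoff f k (rep k b)\<bar> \<le> k * \<eta>"
    using var[OF 3(4) rep(1)[OF b]] parts(3) rep(2)[OF b] by simp
  have "\<bar>birkhoff f (length d) ?u1\<bar> \<le> length d * Fb"
    by (rule birkhoff_bound[OF Fb(2) u1])
  also have "\<dots> \<le> Lm * Fb" using parts(1) Fb by (intro mult_right_mono) auto
  finally have v2: "\<bar>birkhoff f (length d) ?u1\<bar> \<le> Lm * Fb" .
  have "birkhoff f (length (glue c (b # b' # bs))) u =
      birkhoff f k u + birkhoff f (length d) ?u1 + birkhoff f (length g) ?u2"
    unfolding parts(2) birkhoff_add by (simp add: shift_map_funpow add.assoc)
  moreover have "sum_list (map (\<lambda>b. birkhoff f k (rep k b)) (b # b' # bs)) =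
      birkhoff f k (rep k b) + sum_list (map (\<lambda>b. birkhoff f k (rep k b)) (b' # bs))" by simp
  moreover have "real (length (b # b' # bs)) * (k * \<eta> + Lm * Fb) =
      (k * \<eta> + Lm * Fb) + real (length (b' # bs)) * (k * \<eta> + Lm * Fb)"
    by (simp add: algebra_simps)
  ultimately show ?case using IH v1 v2 by linarith
qed simp

text \<open>The sequences of \<open>m\<close> blocks whose gluing is a prefix of \<open>u\<close>;
  their number measures how far gluing is from being injective.\<close>

definition glue_fiber :: "nat \<Rightarrow> (nat \<Rightarrow> 'e) \<Rightarrow> 'e list list set" where
  "glue_fiber m u = {bs. set bs \<subseteq> finite_paths G k \<and> length bs = m \<and> pre (length (glue c bs)) u = glue c bs}"

lemma finite_glue_fiber: "finite (glue_fiber m u)"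
  by (rule finite_subset[OF _ finite_lists_length_eq[OF finite_finite_paths[of k], of m]])
     (auto simp: glue_fiber_def)

text \<open>The blocks can be read off from \<open>u\<close> once the lengths of the connecting paths are known.\<close>

lemma card_glue_fiber: "card (glue_fiber m u) \<le> (Lm + 1) ^ m"
proof (induction m arbitrary: u)
  case 0
  have "glue_fiber 0 u \<subseteq> {[]}" by (auto simp: glue_fiber_def)
  then show ?case using card_mono[of "{[]}" "glue_fiber 0 u"] by simp
next
  case (Suc m)
  let ?R = "\<lambda>j. (#) (pre k u) ` glue_fiber m ((shift_map ^^ (k + j)) u)"
  \<comment> \<open>The first block must be \<open>pre k u\<close>, and only the length
    \<open>j\<close> of the connecting path after it is free. A block that is the last one has no
    such path and is counted under \<open>j = 0\<close>.\<close>
  have "glue_fiber (Suc m) u \<subseteq> (\<Union>j\<in>{..Lm}. ?R j)"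
  proof
    fix bs assume "bs \<in> glue_fiber (Suc m) u"
    then obtain b bs' where bs: "bs = b # bs'" "b \<in> finite_paths G k" "set bs' \<subseteq> finite_paths G k"
        "length bs' = m" and pre: "pre (length (glue c bs)) u = glue c bs"
      by (cases bs) (auto simp: glue_fiber_def)
    show "bs \<in> (\<Union>j\<in>{..Lm}. ?R j)"
    proof (cases bs')
      case Nil
      then have "pre k u = b" using pre bs block_arcs(4)[OF bs(2)] by simp
      moreover have "[] \<in> glue_fiber m ((shift_map ^^ (k + 0)) u)"
        using Nil bs by (simp add: glue_fiber_def)
      ultimately have "bs \<in> ?R 0" using Nil bs by simp
      then show ?thesis by blast
    next
      case (Cons b' bs'')
      then have b': "b' \<in> finite_paths G k" using bs by simp
      note parts = glue_Cons_prefix[OF bs(2) b' pre[unfolded bs(1) Cons]]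
      have "bs' \<in> glue_fiber m ((shift_map ^^ (k + length (c (last b) (hd b')))) u)"
        using bs parts(4) Cons by (simp add: glue_fiber_def)
      then have "bs \<in> ?R (length (c (last b) (hd b')))" using parts(3) bs by simp
      then show ?thesis using parts(1) by blast
    qed
  qed
  then have "card (glue_fiber (Suc m) u) \<le> card (\<Union>j\<in>{..Lm}. ?R j)"
    using finite_glue_fiber by (intro card_mono) auto
  also have "\<dots> \<le> (\<Sum>j\<in>{..Lm}. card (?R j))" by (rule card_UN_le) simp
  also have "\<dots> \<le> (\<Sum>j\<in>{..Lm}. (Lm + 1) ^ m)"
    using Suc finite_glue_fiber by (intro sum_mono order.trans[OF card_image_le]) auto
  finally show ?case by simp
qed

text \<open>Each sequence in \<open>T\<close> is glued, extended to a path and cut to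
  \<open>n\<close> letters. At most \<open>(Lm + 1) ^ m\<close> sequences give the same word, and
  each word contributes at least \<open>exp \<beta>\<close>. The assumption \<open>good\<close>
  covers all paths beginning with the gluing, since \<open>Z_sum\<close> counts a word only if its
  whole cylinder is mapped into \<open>D\<close>.\<close>

lemma Z_sum_glue:
  assumes \<phi>: "path_continuous G \<phi>"
    and T: "\<And>bs. bs \<in> T \<Longrightarrow> set bs \<subseteq> finite_paths G k \<and> length bs = m"
    and n: "m * (k + Lm) \<le> n"
    and good: "\<And>bs v. bs \<in> T \<Longrightarrow> v \<in> infinite_paths G \<Longrightarrow> pre (length (glue c bs)) v = glue c bs \<Longrightarrow>
      U (empirical_measure G n v) \<in> D \<and> \<beta> \<le> birkhoff \<phi> n v"
  shows "card T * exp \<beta> \<le> (Lm + 1) ^ m * Z_sum G U \<phi> D n"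
proof -
  have len: "length (glue c bs) \<le> n" if "bs \<in> T" for bs
    using glue_path[of bs] T[OF that] n by auto
  have "\<exists>u\<in>infinite_paths G. pre (length (glue c bs)) u = glue c bs" if "bs \<in> T" for bs
  proof -
    have "glue c bs \<in> finite_paths G (length (glue c bs))"
      using glue_path[of bs] T[OF that] by (simp add: finite_paths_iff)
    then show ?thesis using rep by blast
  qed
  then have "\<forall>bs\<in>T. \<exists>u. u \<in> infinite_paths G \<and> pre (length (glue c bs)) u = glue c bs" by blast
  from bchoice[OF this] obtain u where u: "\<And>bs. bs \<in> T \<Longrightarrow> u bs \<in> infinite_paths G"
      "\<And>bs. bs \<in> T \<Longrightarrow> pre (length (glue c bs)) (u bs) = glue c bs" by auto
  define W where "W = (\<lambda>bs. pre n (u bs)) ` T"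
  have prefix: "pre (length (glue c bs)) v = glue c bs" if "bs \<in> T" "pre n v = pre n (u bs)" for bs v
    using u(2)[OF that(1)] pre_mono[OF that(2) len[OF that(1)]] by simp
  let ?Z = "{w \<in> finite_paths G n. (\<lambda>u. U (empirical_measure G n u)) ` cylinder G w \<subseteq> D}"
  have W_sub: "W \<subseteq> ?Z"
  proof
    fix w assume "w \<in> W"
    then obtain bs where bs: "bs \<in> T" "w = pre n (u bs)" by (auto simp: W_def)
    have "w \<in> finite_paths G n" using bs u(1) pre_finite_paths by auto
    moreover have "U (empirical_measure G n v) \<in> D" if "v \<in> cylinder G w" for v
      using good[OF bs(1), of v] prefix[OF bs(1), of v] that bs by (auto simp: mem_cylinder)
    ultimately show "w \<in> ?Z" by auto
  qed
  have finZ: "finite ?Z" using finite_finite_paths by auto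
  then have finW: "finite W" using W_sub finite_subset by blast
  have "T \<subseteq> (\<Union>w\<in>W. glue_fiber m (rep n w))"
  proof
    fix bs assume bs: "bs \<in> T"
    have w: "pre n (u bs) \<in> finite_paths G n" using u(1)[OF bs] by (rule pre_finite_paths)
    have "bs \<in> glue_fiber m (rep n (pre n (u bs)))"
      using T[OF bs] prefix[OF bs rep(2)[OF w]] by (simp add: glue_fiber_def)
    then show "bs \<in> (\<Union>w\<in>W. glue_fiber m (rep n w))" using bs by (auto simp: W_def)
  qed
  then have "card T \<le> card (\<Union>w\<in>W. glue_fiber m (rep n w))"
    using finW finite_glue_fiber by (intro card_mono) auto
  also have "\<dots> \<le> (\<Sum>w\<in>W. card (glue_fiber m (rep n w)))" by (rule card_UN_le[OF finW])
  also have "\<dots> \<le> (\<Sum>w\<in>W. (Lm + 1) ^ m)" by (intro sum_mono card_glue_fiber)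
  finally have "card T \<le> (Lm + 1) ^ m * card W" by (simp add: mult.commute)
  then have "real (card T) \<le> real ((Lm + 1) ^ m * card W)" by (rule of_nat_mono)
  then have "card T * exp \<beta> \<le> real ((Lm + 1) ^ m * card W) * exp \<beta>" by (intro mult_right_mono) auto
  also have "\<dots> = (Lm + 1) ^ m * (\<Sum>w\<in>W. exp \<beta>)" by simp
  also have "\<dots> \<le> (Lm + 1) ^ m * (\<Sum>w\<in>W. word_weight G \<phi> w)"
  proof (intro mult_left_mono sum_mono)
    fix w assume "w \<in> W"
    then obtain bs where bs: "bs \<in> T" "w = pre n (u bs)" by (auto simp: W_def)
    have "exp \<beta> \<le> exp (birkhoff \<phi> n (u bs))" using good[OF bs(1) u(1)[OF bs(1)] u(2)[OF bs(1)]] by simp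
    also have "\<dots> \<le> word_weight G \<phi> w"
      using bs mem_cylinder_pre[OF u(1)[OF bs(1)]] by (intro word_weight_ge[OF \<phi>]) auto
    finally show "exp \<beta> \<le> word_weight G \<phi> w" .
  qed simp
  also have "\<dots> \<le> (Lm + 1) ^ m * Z_sum G U \<phi> D n"
    unfolding Z_sum_word_weight using W_sub finZ word_weight_nonneg[OF \<phi>]
    by (intro mult_left_mono sum_mono2) auto
  finally show ?thesis .
qed

end

context path_system
begin

section \<open>Block averages of an invariant measure and the lower estimate\<close>

lemma continuous_map_shift: "continuous_map (path_topology G) (path_topology G) shift_map"
  unfolding continuous_map_def
proof (intro conjI allI impI)
  show "shift_map \<in> topspace (path_topology G) \<rightarrow> topspace (path_topology G)"
    using shift_map_infinite_paths by auto
  fix V assume "openin (path_topology G) V"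
  then have V: "\<And>u. u \<in> V \<Longrightarrow> \<exists>n. \<forall>v\<in>infinite_paths G. pre n v = pre n u \<longrightarrow> v \<in> V"
    by (simp add: openin_path_topology)
  show "openin (path_topology G) {u \<in> topspace (path_topology G). shift_map u \<in> V}"
    unfolding openin_path_topology
  proof (intro conjI ballI)
    fix u assume u: "u \<in> {u \<in> topspace (path_topology G). shift_map u \<in> V}"
    then obtain n where n: "\<forall>v\<in>infinite_paths G. pre n v = pre n (shift_map u) \<longrightarrow> v \<in> V"
      using V by blast
    show "\<exists>n. \<forall>v\<in>infinite_paths G. pre n v = pre n u \<longrightarrow> v \<in> {u \<in> topspace (path_topology G). shift_map u \<in> V}"
      using n shift_map_infinite_paths by (intro exI[of _ "Suc n"]) (auto simp: pre_Suc_Cons)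
  qed auto
qed

lemma continuous_map_birkhoff:
  assumes "path_continuous G f"
  shows "path_continuous G (birkhoff f n)"
proof -
  have iter: "continuous_map (path_topology G) (path_topology G) (shift_map ^^ k)" for k
  proof (induction k)
    case (Suc k)
    show ?case unfolding funpow.simps by (rule continuous_map_compose[OF Suc continuous_map_shift])
  qed simp
  have "path_continuous G (\<lambda>u. f ((shift_map ^^ k) u))" for k
    using continuous_map_compose[OF iter assms] by (simp only: o_def)
  then show ?thesis
    unfolding birkhoff_def[abs_def] by (intro continuous_map_sum) auto
qed

text \<open>By invariance the Birkhoff sum over \<open>k\<close> letters has mean \<open>k\<close>
  times the integral; evaluating it at representatives of the prefixes costs at most its
  variation.\<close>

lemma block_mean:
  assumes inv: "\<nu> \<in> shift_probs G"
    and f: "path_continuous G f"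
    and var: "\<And>u v. u \<in> infinite_paths G \<Longrightarrow> v \<in> infinite_paths G \<Longrightarrow> pre k u = pre k v \<Longrightarrow>
      \<bar>birkhoff f k u - birkhoff f k v\<bar> \<le> real k * \<eta>"
  shows "\<bar>(\<Sum>w\<in>finite_paths G k. measure \<nu> (cylinder G w) * birkhoff f k (rep k w)) - k * (\<integral>u. f u \<partial>\<nu>)\<bar> \<le> k * \<eta>"
proof -
  have \<nu>: "\<nu> \<in> path_probs G" using inv by (simp add: invariant_probs_def)
  interpret mp_system \<nu> shift_map by (rule mp_system_invariant[OF inv])
  have "integrable \<nu> (\<lambda>u. f ((shift_map ^^ i) u))" for i
    using integrable_distr[OF measurable_funpow[of i], of f] integrable_continuous[OF f \<nu>]
    by (simp add: distr_funpow)
  then have "(\<integral>u. birkhoff f k u \<partial>\<nu>) = (\<Sum>i<k. \<integral>u. f ((shift_map ^^ i) u) \<partial>\<nu>)"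
    unfolding birkhoff_def by (intro Bochner_Integration.integral_sum)
  also have "\<dots> = k * (\<integral>u. f u \<partial>\<nu>)"
    by (simp add: integral_funpow[OF continuous_map_measurable[OF f \<nu>]])
  finally show ?thesis
    using integral_approx[OF continuous_map_birkhoff[OF f] \<nu> var] by simp
qed

text \<open>The gap between \<open>a\<close> and \<open>c0 + I\<close> pays for six errors \<eta>
  per letter: four in the Birkhoff averages of typical gluings, one for the losses per block, and
  one for the incomplete last piece together with a factor 2 from the count of typical
  sequences.\<close>

lemma Z_sum_lower:
  fixes U :: "(nat \<Rightarrow> 'e) measure \<Rightarrow> 'x::metric_space" and a :: real
  assumes U: "continuous_map (path_weak_topology G) euclidean U"
    and \<phi>: "path_continuous G \<phi>"
    and inv: "\<nu> \<in> shift_probs G" and C: "U \<nu> \<in> closure C"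
    and a: "ereal a < ks_entropy shift_map \<nu> + ereal (\<integral>u. \<phi> u \<partial>\<nu>)" and r: "r > 0"
  shows "\<forall>\<^sub>F n in sequentially. exp (n * a) \<le> Z_sum G U \<phi> (set_ball C r) n"
proof -
  have \<nu>: "\<nu> \<in> path_probs G" using inv by (simp add: invariant_probs_def)
  interpret mp_system \<nu> shift_map by (rule mp_system_invariant[OF inv])
  define I where "I = (\<integral>u. \<phi> u \<partial>\<nu>)"
  define N where "N = {\<nu>' \<in> topspace (path_weak_topology G). dist (U \<nu>') (U \<nu>) < r / 2}"
  have "openin (path_weak_topology G) N"
    unfolding N_def by (rule continuous_map_ball_preimage[OF U])
  moreover have "\<nu> \<in> N" using \<nu> r by (simp add: N_def)
  ultimately obtain F0 \<delta> where F0: "finite F0" "\<delta> > 0"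
      "\<forall>f\<in>F0. path_continuous G f"
    and F0N: "\<forall>\<nu>'\<in>path_probs G.
      (\<forall>f\<in>F0. \<bar>(\<integral>x. f x \<partial>\<nu>') - (\<integral>x. f x \<partial>\<nu>)\<bar> < \<delta>) \<longrightarrow> \<nu>' \<in> N"
    by (elim weak_neighbourhood[THEN exE] exE conjE)
  \<comment> \<open>A point of \<open>C\<close> within \<open>r / 2\<close> of
    \<open>U \<nu>\<close>; the triangle inequality then sends the neighbourhood \<open>N\<close>
    into \<open>set_ball C r\<close>.\<close>
  obtain y where y: "y \<in> C" "dist y (U \<nu>) < r / 2"
    using C r unfolding closure_approachable by (meson half_gt_zero)
  have N_ball: "U \<nu>' \<in> set_ball C r" if "\<nu>' \<in> N" for \<nu>'
    unfolding mem_set_ball using y that dist_triangle2[of "U \<nu>'" y "U \<nu>"]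
    by (intro bexI[of _ y]) (auto simp: N_def)
  define F where "F = insert \<phi> F0"
  have F: "finite F" and F_cont: "\<And>f. f \<in> F \<Longrightarrow> path_continuous G f"
    using F0 \<phi> by (auto simp: F_def)
  obtain c0 where c0: "a - I < c0" "ereal c0 < ks_entropy shift_map \<nu>"
  proof -
    have "ereal (a - I) < ks_entropy shift_map \<nu>"
      using a unfolding I_def by (cases "ks_entropy shift_map \<nu>") auto
    then show ?thesis using that ereal_dense2[of "ereal (a - I)" "ks_entropy shift_map \<nu>"] by auto
  qed
  \<comment> \<open>The rate is made nonnegative, as it will multiply an upper bound for
    \<open>n\<close>.\<close>
  define c1 where "c1 = max c0 0"
  have c1: "0 \<le> c1" "c0 \<le> c1" by (auto simp: c1_def)
  have rv_entropy_ge: "k * c1 \<le> rv_entropy \<nu> (pre k)" for k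
    using ks_entropy_generator_lower[OF inv c0(2), of k] rv_entropy_nonneg[of "pre k"] by (auto simp: c1_def max_def)
  \<comment> \<open>The divisor 6 is the number of errors per letter; the divisor 5 makes the
    deviation \<open>4 * \<eta>\<close> of the averages strictly smaller than \<delta>.\<close>
  define \<eta> where "\<eta> = min ((c0 + I - a) / 6) (\<delta> / 5)"
  have \<eta>: "\<eta> > 0" "6 * \<eta> \<le> c0 + I - a" "4 * \<eta> < \<delta>" using c0(1) F0(2) by (auto simp: \<eta>_def min_def)
  have "\<forall>f\<in>F. \<exists>B\<ge>0. \<forall>u\<in>infinite_paths G. \<bar>f u\<bar> \<le> B"
  proof
    fix f assume "f \<in> F"
    obtain B where "B \<ge> 0" "\<And>u. u \<in> infinite_paths G \<Longrightarrow> \<bar>f u\<bar> \<le> B"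
      by (rule continuous_bounded[OF F_cont[OF \<open>f \<in> F\<close>]]) blast
    then show "\<exists>B\<ge>0. \<forall>u\<in>infinite_paths G. \<bar>f u\<bar> \<le> B" by blast
  qed
  from bchoice[OF this] obtain B where B: "\<forall>f\<in>F. 0 \<le> B f \<and> (\<forall>u\<in>infinite_paths G. \<bar>f u\<bar> \<le> B f)" ..
  define Fb where "Fb = (\<Sum>f\<in>F. B f)"
  have Fb0: "0 \<le> Fb" unfolding Fb_def using B by (intro sum_nonneg) auto
  have Fb: "\<bar>f u\<bar> \<le> Fb" if "f \<in> F" "u \<in> infinite_paths G" for f u
    using B that member_le_sum[of f F B] F unfolding Fb_def by fastforce
  obtain c Lm where conn: "\<And>e f. e \<in> arcs G \<Longrightarrow> f \<in> arcs G \<Longrightarrow>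
      set (c e f) \<subseteq> arcs G \<and> linked (e # c e f @ [f]) \<and> length (c e f) \<le> Lm"
    by (rule bounded_connectors) blast
  \<comment> \<open>The loss per block in the exponent: the entropy missing on a connecting path,
    the deviation 1 of the log-probability, and the factor \<open>Lm + 1\<close> for the fibres of
    gluing.\<close>
  define D where "D = Lm * c1 + 1 + ln (Lm + 1)"
  have "\<exists>k>0. (\<forall>f\<in>F. \<forall>u\<in>infinite_paths G. \<forall>v\<in>infinite_paths G. pre k u = pre k v \<longrightarrow>
      \<bar>birkhoff f k u - birkhoff f k v\<bar> \<le> real k * \<eta>) \<and> 3 * Lm * Fb + 1 \<le> k * \<eta> \<and> D \<le> k * \<eta>"
  proof -
    have "\<forall>f\<in>F. \<forall>\<^sub>F k in sequentially. \<forall>u\<in>infinite_paths G. \<forall>v\<in>infinite_paths G. pre k u = pre k v \<longrightarrow>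
        \<bar>birkhoff f k u - birkhoff f k v\<bar> \<le> real k * \<eta>"
    proof
      fix f assume "f \<in> F"
      obtain k0 :: nat where "\<And>k u v. k \<ge> k0 \<Longrightarrow> u \<in> infinite_paths G \<Longrightarrow> v \<in> infinite_paths G \<Longrightarrow>
          pre k u = pre k v \<Longrightarrow> \<bar>birkhoff f k u - birkhoff f k v\<bar> \<le> real k * \<eta>"
        by (rule birkhoff_variation[OF F_cont[OF \<open>f \<in> F\<close>] \<eta>(1)]) blast
      then show "\<forall>\<^sub>F k in sequentially. \<forall>u\<in>infinite_paths G. \<forall>v\<in>infinite_paths G. pre k u = pre k v \<longrightarrow>
          \<bar>birkhoff f k u - birkhoff f k v\<bar> \<le> real k * \<eta>"
        unfolding eventually_sequentially by blast
    qed
    then have "\<forall>\<^sub>F k in sequentially. \<forall>f\<in>F. \<forall>u\<in>infinite_paths G. \<forall>v\<in>infinite_paths G. pre k u = pre k v \<longrightarrow>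
        \<bar>birkhoff f k u - birkhoff f k v\<bar> \<le> real k * \<eta>"
      by (rule eventually_ball_finite[OF F])
    moreover have "\<forall>\<^sub>F k in sequentially. x \<le> real k * \<eta>" for x
    proof -
      have "\<forall>\<^sub>F k in sequentially. x / \<eta> \<le> real k"
        using filterlim_real_sequentially unfolding filterlim_at_top by blast
      then show ?thesis by eventually_elim (use \<eta> in \<open>simp add: field_simps\<close>)
    qed
    ultimately have "\<forall>\<^sub>F k in sequentially. 0 < k \<and> (\<forall>f\<in>F. \<forall>u\<in>infinite_paths G. \<forall>v\<in>infinite_paths G. pre k u = pre k v \<longrightarrow>
      \<bar>birkhoff f k u - birkhoff f k v\<bar> \<le> real k * \<eta>) \<and> 3 * Lm * Fb + 1 \<le> k * \<eta> \<and> D \<le> k * \<eta>"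
      by (intro eventually_conj eventually_gt_at_top)
    then show ?thesis using eventually_happens'[OF sequentially_bot] by blast
  qed
  then obtain k where k: "k > 0" "3 * Lm * Fb + 1 \<le> k * \<eta>" "D \<le> k * \<eta>"
    and var: "\<And>f u v. f \<in> F \<Longrightarrow> u \<in> infinite_paths G \<Longrightarrow> v \<in> infinite_paths G \<Longrightarrow> pre k u = pre k v \<Longrightarrow>
      \<bar>birkhoff f k u - birkhoff f k v\<bar> \<le> real k * \<eta>" by blast
  interpret gl: gluing G c Lm k by unfold_locales (use conn k in auto)
  define p where "p w = measure \<nu> (cylinder G w)" for w
  \<comment> \<open>Blocks of measure 0 are dropped, so that the probability of a sequence is the
    exponential of its sum of log-probabilities.\<close>
  define Bl where "Bl = {w \<in> finite_paths G k. p w > 0}"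
  have Bl: "finite Bl" "Bl \<subseteq> finite_paths G k" using finite_finite_paths by (auto simp: Bl_def)
  have p0: "p w \<ge> 0" for w by (simp add: p_def)
  have sum_Bl: "(\<Sum>w\<in>Bl. p w * g w) = (\<Sum>w\<in>finite_paths G k. p w * g w)" for g :: "'e list \<Rightarrow> real"
    using finite_finite_paths p0 unfolding Bl_def
    by (intro sum.mono_neutral_left) (auto simp: less_le)
  have "(\<Sum>w\<in>Bl. p w * 1) = 1"
    unfolding sum_Bl using integral_pre[OF \<nu>, of "\<lambda>_. 1" k] by (simp add: p_def prob_space)
  then have p1: "(\<Sum>w\<in>Bl. p w) = 1" by simp
  define gf where "gf f w = birkhoff f k (rep k w)" for f w
  \<comment> \<open>The log-probability controls the number of typical sequences; the block sums
    control \<phi> and the test functions that locate the empirical measure.\<close>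
  define \<G> where "\<G> = insert (\<lambda>w. ln (p w)) (gf ` F)"
  have mean: "\<bar>(\<Sum>w\<in>Bl. p w * gf f w) - k * (\<integral>u. f u \<partial>\<nu>)\<bar> \<le> k * \<eta>" if "f \<in> F" for f
    unfolding sum_Bl unfolding p_def gf_def using block_mean[OF inv F_cont[OF that] var[OF that]] .
  define H where "H = rv_entropy \<nu> (pre k)"
  have H: "(\<Sum>w\<in>Bl. p w * ln (p w)) = - H"
    unfolding sum_Bl unfolding H_def by (simp add: rv_entropy_pre[OF \<nu>] p_def)
  have int_le: "\<bar>\<integral>u. f u \<partial>\<nu>\<bar> \<le> Fb" if f: "f \<in> F" for f
  proof -
    have "\<bar>\<integral>u. f u \<partial>\<nu>\<bar> \<le> (\<integral>u. \<bar>f u\<bar> \<partial>\<nu>)" by (rule integral_abs_bound)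
    also have "\<dots> \<le> (\<integral>u. Fb \<partial>\<nu>)"
      using integrable_continuous[OF F_cont[OF f] \<nu>] Fb[OF f] borel_probsD(3)[OF \<nu>]
      by (intro integral_mono) auto
    finally show ?thesis by (simp add: prob_space)
  qed
  define T where "T m = {bs. (set bs \<subseteq> Bl \<and> length bs = m) \<and>
      (\<forall>g\<in>\<G>. \<bar>sum_list (map g bs) - m * (\<Sum>w\<in>Bl. p w * g w)\<bar> \<le> m)}" for m :: nat
  have T_path: "set bs \<subseteq> finite_paths G k \<and> length bs = m" if "bs \<in> T m" for bs m
    using that Bl(2) by (auto simp: T_def)
  let ?K = "k + Lm"
  have "\<forall>\<^sub>F m in sequentially. 1 / 2 \<le> (\<Sum>bs\<in>T m. list_prob p bs)"
    unfolding T_def using F p0 by (intro typical_lists Bl p1) (auto simp: \<G>_def)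
  moreover have "filterlim (\<lambda>n. n div ?K) sequentially sequentially"
    unfolding filterlim_at_top
  proof
    fix M
    show "\<forall>\<^sub>F n in sequentially. M \<le> n div ?K"
    proof (rule eventually_mono[OF eventually_ge_at_top[of "M * ?K"]])
      fix n assume "M * ?K \<le> n"
      then show "M \<le> n div ?K" using k(1) by (simp add: less_eq_div_iff_mult_less_eq)
    qed
  qed
  ultimately have ev1: "\<forall>\<^sub>F n in sequentially. 1 / 2 \<le> (\<Sum>bs\<in>T (n div ?K). list_prob p bs)"
    by (rule eventually_compose_filterlim)
  have ev_large: "\<forall>\<^sub>F n in sequentially. x \<le> real n * \<eta>" for x
  proof -
    have "\<forall>\<^sub>F n in sequentially. x / \<eta> \<le> real n"
      using filterlim_real_sequentially unfolding filterlim_at_top by blast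
    then show ?thesis by eventually_elim (use \<eta> in \<open>simp add: field_simps\<close>)
  qed
  show ?thesis
    using ev1 ev_large[of "2 * ?K * Fb"] ev_large[of "?K * c1 + ln 2"] eventually_gt_at_top[of 0]
  proof eventually_elim
    fix n :: nat
    \<comment> \<open>A gluing of \<open>m\<close> blocks has at most \<open>m * ?K\<close> letters
      and so fits into \<open>n\<close>. Of the \<open>n\<close> letters, at most
      \<open>m * Lm + ?K\<close> lie outside the blocks.\<close>
    define m where "m = n div ?K"
    assume "1 / 2 \<le> (\<Sum>bs\<in>T (n div ?K). list_prob p bs)"
      and n1: "2 * ?K * Fb \<le> real n * \<eta>" and n2: "?K * c1 + ln 2 \<le> real n * \<eta>" and n0: "0 < n"
    then have half: "1 / 2 \<le> (\<Sum>bs\<in>T m. list_prob p bs)" by (simp add: m_def)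
    have mK: "m * ?K \<le> n" by (simp add: m_def)
    have "n < m * ?K + ?K"
      using k(1) mod_less_divisor[of ?K n] div_mult_mod_eq[of n ?K] unfolding m_def by linarith
    then have nK: "real n \<le> real m * k + real m * Lm + ?K"
      using of_nat_mono[of n "m * ?K + ?K", where 'a = real] by (simp add: algebra_simps)
    have mk: "real m * k \<le> n"
    proof -
      have "real m * k + real m * Lm = real (m * ?K)" by (simp add: algebra_simps)
      also have "\<dots> \<le> n" using mK by (rule of_nat_mono)
      finally have "real m * k + real m * Lm \<le> n" .
      moreover have "0 \<le> real m * real Lm" by simp
      ultimately show ?thesis by linarith
    qed
    have typical: "\<bar>birkhoff f n v / n - (\<integral>u. f u \<partial>\<nu>)\<bar> \<le> 4 * \<eta>"
      if bs: "bs \<in> T m" and v: "v \<in> infinite_paths G" "pre (length (glue c bs)) v = glue c bs" and f: "f \<in> F"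
      for bs v f
    proof -
      define l where "l = length (glue c bs)"
      define I' where "I' = (\<integral>u. f u \<partial>\<nu>)"
      have bs_path: "set bs \<subseteq> finite_paths G k" and len: "length bs = m" using T_path[OF bs] by auto
      have l: "m * k \<le> l" "l \<le> m * ?K"
        using gl.glue_path[OF bs_path] unfolding l_def len by blast+
      have "l \<le> n" using l(2) mK by (rule order.trans)
      note l = l(1) this
      have "birkhoff f n v = birkhoff f l v + birkhoff f (n - l) ((shift_map ^^ l) v)"
        using birkhoff_add[of f l "n - l" v] l by simp
      moreover have "\<bar>birkhoff f (n - l) ((shift_map ^^ l) v)\<bar> \<le> (n - l) * Fb"
        by (rule birkhoff_bound[OF Fb[OF f] shift_map_funpow_infinite_paths[OF v(1)]])
      moreover have "real (n - l) * Fb \<le> (real n - real m * k) * Fb"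
        using l of_nat_mono[OF l(1), where 'a = real] Fb0 by (intro mult_right_mono) (auto simp: of_nat_diff)
      moreover have "\<bar>birkhoff f l v - sum_list (map (gf f) bs)\<bar> \<le> m * (k * \<eta> + Lm * Fb)"
        unfolding l_def gf_def[abs_def] len[symmetric]
        by (rule gl.glue_birkhoff[OF var[OF f] Fb0 Fb[OF f] bs_path v])
      moreover have "\<bar>sum_list (map (gf f) bs) - m * (\<Sum>w\<in>Bl. p w * gf f w)\<bar> \<le> m"
      proof -
        have "gf f \<in> \<G>" using f by (simp add: \<G>_def)
        then show ?thesis using bs unfolding T_def by blast
      qed
      moreover have "\<bar>m * (\<Sum>w\<in>Bl. p w * gf f w) - m * (k * I')\<bar> \<le> m * (k * \<eta>)"
        using mult_left_mono[OF mean[OF f], of "real m"]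
        unfolding I'_def right_diff_distrib[symmetric] abs_mult by simp
      moreover have "\<bar>m * (k * I') - n * I'\<bar> \<le> (real n - real m * k) * Fb"
      proof -
        have "m * (k * I') - n * I' = - ((real n - real m * k) * I')" by (simp add: algebra_simps)
        then have "\<bar>m * (k * I') - n * I'\<bar> = (real n - real m * k) * \<bar>I'\<bar>"
          using mk by (simp only: abs_minus_cancel abs_mult)
        then show ?thesis using int_le[OF f] mk unfolding I'_def by (simp add: mult_left_mono)
      qed
      ultimately have s1: "\<bar>birkhoff f n v - n * I'\<bar> \<le>
          2 * ((real n - real m * k) * Fb) + m * (k * \<eta> + Lm * Fb) + m + m * (k * \<eta>)" by linarith
      have s2: "(real n - real m * k) * Fb \<le> (real m * Lm + ?K) * Fb"
        using nK Fb0 by (intro mult_right_mono) auto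
      \<comment> \<open>\<open>Lm * Fb\<close> occurs three times per block: once in the gluing
        estimate, once for the letters after the gluing, and once in replacing \<open>m * k\<close>
        by \<open>n\<close> in front of the integral.\<close>
      have s3: "2 * ((real m * Lm + ?K) * Fb) + m * (k * \<eta> + Lm * Fb) + m + m * (k * \<eta>) =
          2 * (real m * k * \<eta>) + m * (3 * Lm * Fb + 1) + 2 * ?K * Fb" by (simp add: algebra_simps)
      have s4: "m * (3 * Lm * Fb + 1) \<le> real m * k * \<eta>"
        using mult_left_mono[OF k(2), of "real m"] by (simp add: mult.assoc)
      have s5: "real m * k * \<eta> \<le> n * \<eta>" using mk \<eta> by (intro mult_right_mono) auto
      have "\<bar>birkhoff f n v - n * I'\<bar> \<le> 3 * (n * \<eta>) + n * \<eta>"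
        using s1 s2 s3 s4 s5 n1 by linarith
      also have "\<dots> = 4 * \<eta> * n" by simp
      finally have "\<bar>birkhoff f n v - n * I'\<bar> / n \<le> 4 * \<eta>"
        using n0 by (simp only: pos_divide_le_eq of_nat_0_less_iff)
      moreover have "birkhoff f n v / n - I' = (birkhoff f n v - n * I') / n"
        using n0 by (simp add: diff_divide_distrib)
      ultimately show ?thesis unfolding I'_def by (simp only: abs_divide abs_of_nat)
    qed
    define \<beta> where "\<beta> = n * (I - 4 * \<eta>)"
    have good: "U (empirical_measure G n v) \<in> set_ball C r \<and> \<beta> \<le> birkhoff \<phi> n v"
      if bs: "bs \<in> T m" and v: "v \<in> infinite_paths G" "pre (length (glue c bs)) v = glue c bs" for bs v
    proof
      have "empirical_measure G n v \<in> N"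
      proof (rule F0N[rule_format, OF empirical_measure_borel_probs[OF n0 v(1)]])
        fix f assume f: "f \<in> F0"
        then have "\<bar>birkhoff f n v / n - (\<integral>u. f u \<partial>\<nu>)\<bar> \<le> 4 * \<eta>"
          using typical[OF bs v, of f] by (simp add: F_def)
        then show "\<bar>(\<integral>x. f x \<partial>empirical_measure G n v) - (\<integral>x. f x \<partial>\<nu>)\<bar> < \<delta>"
          using integral_empirical_measure[OF n0 v(1) F0(3)[rule_format, OF f]] \<eta>(3) by simp
      qed
      then show "U (empirical_measure G n v) \<in> set_ball C r" by (rule N_ball)
      have "I - 4 * \<eta> \<le> birkhoff \<phi> n v / n"
        using typical[OF bs v, of \<phi>] by (simp add: F_def I_def abs_le_iff)
      then show "\<beta> \<le> birkhoff \<phi> n v" using n0 by (simp add: \<beta>_def field_simps)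
    qed
    \<comment> \<open>The typical sequences have total probability at least 1/2, and each of them
      has probability at most \<open>exp (m * (1 - H))\<close>.\<close>
    have card_T: "exp (m * (H - 1)) \<le> 2 * card (T m)"
    proof -
      have "(\<Sum>bs\<in>T m. list_prob p bs) \<le> (\<Sum>bs\<in>T m. exp (m * (1 - H)))"
      proof (rule sum_mono)
        fix bs assume bs: "bs \<in> T m"
        have "\<bar>sum_list (map (\<lambda>w. ln (p w)) bs) - m * (\<Sum>w\<in>Bl. p w * ln (p w))\<bar> \<le> m"
        proof -
          have "(\<lambda>w. ln (p w)) \<in> \<G>" by (simp add: \<G>_def)
          then show ?thesis using bs unfolding T_def by blast
        qed
        then have le: "sum_list (map (\<lambda>w. ln (p w)) bs) \<le> m * (1 - H)" unfolding H by (simp add: algebra_simps)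
        have "list_prob p bs = exp (sum_list (map (\<lambda>w. ln (p w)) bs))" if "set bs \<subseteq> Bl" for bs
          using that by (induction bs) (auto simp: list_prob_def exp_add Bl_def)
        then have "list_prob p bs = exp (sum_list (map (\<lambda>w. ln (p w)) bs))" using bs by (simp add: T_def)
        then show "list_prob p bs \<le> exp (m * (1 - H))" using le by simp
      qed
      then have "1 / 2 \<le> card (T m) * exp (m * (1 - H))" using half by simp
      then have "1 / 2 * exp (m * (H - 1)) \<le> card (T m) * exp (m * (1 - H)) * exp (m * (H - 1))"
        by (intro mult_right_mono) auto
      also have "\<dots> = card (T m)" by (simp add: mult.assoc exp_add[symmetric] algebra_simps)
      finally show ?thesis by simp
    qed
    have "exp (n * a) \<le> Z_sum G U \<phi> (set_ball C r) n"
    proof -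
      let ?Z = "Z_sum G U \<phi> (set_ball C r) n"
      let ?E = "real ((Lm + 1) ^ m)"
      have cZ: "card (T m) * exp \<beta> \<le> ?E * ?Z"
        by (rule gl.Z_sum_glue[OF \<phi> T_path mK good])
      have E: "?E = exp (m * ln (Lm + 1))"
        unfolding exp_of_nat_mult of_nat_power by simp
      have "exp (m * (H - 1) + \<beta>) = exp (m * (H - 1)) * exp \<beta>" by (rule exp_add)
      also have "\<dots> \<le> real (2 * card (T m)) * exp \<beta>" using card_T by (intro mult_right_mono) auto
      also have "\<dots> = 2 * (card (T m) * exp \<beta>)" by simp
      also have "\<dots> \<le> 2 * (?E * ?Z)" using cZ by (intro mult_left_mono) auto
      also have "\<dots> = ?Z * exp (ln 2 + m * ln (Lm + 1))" unfolding exp_add E by simp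
      finally have low: "exp (m * (H - 1) + \<beta> - (ln 2 + m * ln (Lm + 1))) \<le> ?Z"
        unfolding exp_diff by (subst pos_divide_le_eq) simp_all
      have "n * a \<le> m * (H - 1) + \<beta> - (ln 2 + m * ln (Lm + 1))"
      proof -
        have e1: "m * (k * c1) \<le> m * H" using rv_entropy_ge[of k] by (intro mult_left_mono) (auto simp: H_def)
        have "real n * c1 \<le> (real m * k + real m * Lm + ?K) * c1"
          using nK c1 by (intro mult_right_mono) auto
        then have e2: "real n * c1 \<le> m * (k * c1) + m * (Lm * c1) + ?K * c1"
          by (simp add: distrib_right mult.assoc)
        have e3: "m * D = m * (Lm * c1) + m + m * ln (Lm + 1)" by (simp add: D_def algebra_simps)
        have "m * D \<le> m * (k * \<eta>)" using k(3) by (intro mult_left_mono) auto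
        also have "\<dots> \<le> n * \<eta>"
          using mult_right_mono[OF mk, of \<eta>] \<eta> by (simp add: mult.assoc)
        finally have e4: "m * D \<le> n * \<eta>" .
        have "n * (a + 6 * \<eta>) \<le> n * (c1 + I)" using \<eta>(2) c1 by (intro mult_left_mono) auto
        then have e5: "n * a + 6 * (n * \<eta>) \<le> n * c1 + n * I" by (simp add: distrib_left)
        have e6: "m * (H - 1) = m * H - m" "\<beta> = n * I - 4 * (n * \<eta>)"
          by (simp_all add: \<beta>_def algebra_simps)
        show ?thesis using e1 e2 e3 e4 e5 n2 unfolding e6 by linarith
      qed
      then show ?thesis by (intro order.trans[OF _ low]) (simp only: exp_le_cancel_iff)
    qed
    then show "exp (n * a) \<le> Z_sum G U \<phi> (set_ball C r) n" .
  qed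
qed

end

section \<open>Passage to the limit\<close>

lemma pressure_ge:
  fixes Z :: "nat \<Rightarrow> real" and a :: real
  assumes "\<forall>\<^sub>F n in sequentially. exp (n * a) \<le> Z n"
  shows "ereal a \<le> liminf (\<lambda>n. ereal (1 / real n) * ext_log (ereal (Z n)))"
proof (rule Liminf_bounded)
  show "\<forall>\<^sub>F n in sequentially. ereal a \<le> ereal (1 / real n) * ext_log (ereal (Z n))"
    using assms eventually_gt_at_top[of 0]
  proof eventually_elim
    fix n :: nat assume n: "exp (n * a) \<le> Z n" "0 < n"
    have Z: "0 < Z n" using n(1) exp_gt_zero[of "n * a"] by linarith
    then have "n * a \<le> ln (Z n)" using n(1) ln_ge_iff by blast
    then show "ereal a \<le> ereal (1 / real n) * ext_log (ereal (Z n))"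
      using n(2) Z by (simp add: ext_log_def field_simps)
  qed
qed

lemma pressure_le:
  fixes Z :: "nat \<Rightarrow> real" and a :: real
  assumes nonneg: "\<And>n. 0 < n \<Longrightarrow> 0 \<le> Z n" and le: "\<forall>\<^sub>F n in sequentially. Z n \<le> exp (n * a)"
  shows "limsup (\<lambda>n. ereal (1 / real n) * ext_log (ereal (Z n))) \<le> ereal a"
proof (rule Limsup_bounded)
  show "\<forall>\<^sub>F n in sequentially. ereal (1 / real n) * ext_log (ereal (Z n)) \<le> ereal a"
    using le eventually_gt_at_top[of 0]
  proof eventually_elim
    fix n :: nat assume n: "Z n \<le> exp (n * a)" "0 < n"
    show "ereal (1 / real n) * ext_log (ereal (Z n)) \<le> ereal a"
    proof (cases "Z n = 0")
      case True
      then show ?thesis using n(2) by (simp add: ext_log_def)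
    next
      case False
      then have Z: "0 < Z n" using nonneg[OF n(2)] by linarith
      then have "ln (Z n) \<le> ln (exp (n * a))" using n(1) by (subst ln_le_cancel_iff) auto
      then have "ln (Z n) \<le> n * a" by simp
      then show ?thesis using n(2) Z by (simp add: ext_log_def field_simps)
    qed
  qed
qed

text \<open>At \<open>exp (- a)\<close> the terms eventually dominate \<open>1 / n\<close>.
  Divergence of the harmonic series excludes absolute convergence there, so the radius is at most
  \<open>exp (- a)\<close>.\<close>

lemma zeta_exponent_ge:
  fixes Z :: "nat \<Rightarrow> real" and a :: real
  assumes "\<forall>\<^sub>F n in sequentially. exp (n * a) \<le> Z n"
  shows "ereal a \<le> - ext_log (fps_conv_radius (Abs_fps (\<lambda>n. if n = 0 then 0 else complex_of_real (Z n / real n))))"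
proof -
  let ?f = "\<lambda>n. if n = 0 then 0 else complex_of_real (Z n / real n)"
  let ?z = "complex_of_real (exp (- a))"
  have "\<not> summable (\<lambda>n. norm (?f n * ?z ^ n))"
  proof
    assume s: "summable (\<lambda>n. norm (?f n * ?z ^ n))"
    have "\<forall>\<^sub>F n in sequentially. norm (inverse (real n)) \<le> norm (?f n * ?z ^ n)"
      using assms eventually_gt_at_top[of 0]
    proof eventually_elim
      fix n :: nat assume n: "exp (n * a) \<le> Z n" "0 < n"
      have Z: "0 < Z n" using n(1) exp_gt_zero[of "n * a"] by linarith
      have "1 \<le> Z n * exp (- a) ^ n"
        using n(1) by (simp add: exp_of_nat_mult[symmetric] exp_minus field_simps)
      then have "inverse (real n) \<le> Z n * exp (- a) ^ n / n"
        using n(2) by (simp add: field_simps)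
      then show "norm (inverse (real n)) \<le> norm (?f n * ?z ^ n)"
        using n(2) Z by (simp add: norm_mult norm_divide norm_power)
    qed
    then have "summable (\<lambda>n. inverse (real n))" using s by (rule summable_comparison_test_ev)
    then show False using not_summable_harmonic[where 'a = real] by simp
  qed
  then have "conv_radius ?f \<le> ereal (exp (- a))"
    using conv_radius_leI[of ?f ?z] by (simp add: norm_power)
  moreover have "0 \<le> conv_radius ?f" by (rule conv_radius_nonneg)
  ultimately obtain x where x: "conv_radius ?f = ereal x" "0 \<le> x" "x \<le> exp (- a)"
    by (cases "conv_radius ?f") auto
  show ?thesis
  proof (cases "x = 0")
    case False
    then have "ln x \<le> ln (exp (- a))" using x by (subst ln_le_cancel_iff) auto
    then show ?thesis using x False by (simp add: fps_conv_radius_def ext_log_def)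
  qed (use x in \<open>simp add: fps_conv_radius_def ext_log_def\<close>)
qed

text \<open>Inside the disc of radius \<open>exp (- a)\<close> the terms are dominated by a
  geometric series of ratio \<open>r * exp a\<close>. An infinite radius is sent to minus
  infinity.\<close>

lemma zeta_exponent_le:
  fixes Z :: "nat \<Rightarrow> real" and a :: real
  assumes nonneg: "\<And>n. 0 < n \<Longrightarrow> 0 \<le> Z n" and le: "\<forall>\<^sub>F n in sequentially. Z n \<le> exp (n * a)"
  shows "- ext_log (fps_conv_radius (Abs_fps (\<lambda>n. if n = 0 then 0 else complex_of_real (Z n / real n)))) \<le> ereal a"
proof -
  let ?f = "\<lambda>n. if n = 0 then 0 else complex_of_real (Z n / real n)"
  have "ereal (exp (- a)) \<le> conv_radius ?f"
  proof (rule conv_radius_geI_ex')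
    fix r assume r: "0 < r" "ereal r < ereal (exp (- a))"
    have q: "r * exp a < 1" using r by (simp add: exp_minus field_simps)
    have "\<forall>\<^sub>F n in sequentially. norm (?f n * complex_of_real r ^ n) \<le> (r * exp a) ^ n"
      using le eventually_gt_at_top[of 0]
    proof eventually_elim
      fix n :: nat assume n: "Z n \<le> exp (n * a)" "0 < n"
      have "norm (?f n * complex_of_real r ^ n) = Z n / n * r ^ n"
        using n(2) r(1) nonneg[OF n(2)] by (simp add: norm_mult norm_divide norm_power)
      also have "\<dots> \<le> Z n * r ^ n"
        using n(2) r(1) nonneg[OF n(2)] divide_left_mono[of 1 "real n" "Z n"] by (intro mult_right_mono) auto
      also have "\<dots> \<le> exp (n * a) * r ^ n" using n(1) r(1) by (intro mult_right_mono) auto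
      also have "\<dots> = (r * exp a) ^ n" by (simp add: exp_of_nat_mult power_mult_distrib)
      finally show "norm (?f n * complex_of_real r ^ n) \<le> (r * exp a) ^ n" .
    qed
    moreover have "summable (\<lambda>n. (r * exp a) ^ n)" using q r(1) by (intro summable_geometric) simp
    ultimately show "summable (\<lambda>n. ?f n * complex_of_real r ^ n)"
      by (rule summable_comparison_test_ev)
  qed
  then consider "conv_radius ?f = \<infinity>" | x where "conv_radius ?f = ereal x" "exp (- a) \<le> x"
    by (cases "conv_radius ?f") auto
  then show ?thesis
  proof cases
    case 1
    then show ?thesis by (simp add: fps_conv_radius_def ext_log_def)
  next
    case 2
    then have x: "0 < x" using exp_gt_zero[of "- a"] by linarith
    then have "ln (exp (- a)) \<le> ln x" using 2 by (subst ln_le_cancel_iff) auto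
    then show ?thesis using 2 x by (simp add: fps_conv_radius_def ext_log_def)
  qed
qed

text \<open>Real bounds \<open>a\<close> suffice even for infinite \<open>Q\<close>, by density of
  the reals in the extended order. Lower bounds are available at every radius, upper bounds only at
  small ones.\<close>

lemma tendsto_at_right_0I:
  fixes g :: "real \<Rightarrow> ereal"
  assumes lower: "\<And>a r. ereal a < Q \<Longrightarrow> 0 < r \<Longrightarrow> ereal a \<le> g r"
    and upper: "\<And>a. Q < ereal a \<Longrightarrow> \<exists>r0>0. \<forall>r. 0 < r \<and> r < r0 \<longrightarrow> g r \<le> ereal a"
  shows "(g \<longlongrightarrow> Q) (at_right 0)"
proof (rule order_tendstoI)
  fix y assume "y < Q"
  then obtain a where a: "y < ereal a" "ereal a < Q" using ereal_dense2 by blast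
  show "\<forall>\<^sub>F r in at_right 0. y < g r"
    unfolding eventually_at_right_field
    using less_le_trans[OF a(1) lower[OF a(2)]] by (intro exI[of _ 1]) auto
next
  fix y assume "Q < y"
  then obtain a where a: "Q < ereal a" "ereal a < y" using ereal_dense2 by blast
  then obtain r0 where "r0 > 0" "\<forall>r. 0 < r \<and> r < r0 \<longrightarrow> g r \<le> ereal a" using upper by blast
  then show "\<forall>\<^sub>F r in at_right 0. g r < y"
    unfolding eventually_at_right_field using a(2) by (intro exI[of _ r0]) (auto intro: le_less_trans)
qed

text \<open>Exponential bounds on \<open>Z\<close> from both sides determine all three limits, so
  the pressures and the zeta-function are treated together.\<close>

lemma pressure_limits:
  fixes Z :: "real \<Rightarrow> nat \<Rightarrow> real"
  assumes nonneg: "\<And>r n. 0 < n \<Longrightarrow> 0 \<le> Z r n"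
    and lower: "\<And>a r. ereal a < Q \<Longrightarrow> 0 < r \<Longrightarrow> \<forall>\<^sub>F n in sequentially. exp (real n * a) \<le> Z r n"
    and upper: "\<And>a. Q < ereal a \<Longrightarrow> \<exists>r0>0. \<forall>r. 0 < r \<and> r < r0 \<longrightarrow> (\<forall>\<^sub>F n in sequentially. Z r n \<le> exp (real n * a))"
  shows "((\<lambda>r. liminf (\<lambda>n. ereal (1 / real n) * ext_log (ereal (Z r n)))) \<longlongrightarrow> Q) (at_right 0)"
    and "((\<lambda>r. limsup (\<lambda>n. ereal (1 / real n) * ext_log (ereal (Z r n)))) \<longlongrightarrow> Q) (at_right 0)"
    and "((\<lambda>r. - ext_log (fps_conv_radius (Abs_fps (\<lambda>n. if n = 0 then 0 else complex_of_real (Z r n / real n)))))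
      \<longlongrightarrow> Q) (at_right 0)"
proof -
  let ?inf = "\<lambda>r. liminf (\<lambda>n. ereal (1 / real n) * ext_log (ereal (Z r n)))"
  let ?sup = "\<lambda>r. limsup (\<lambda>n. ereal (1 / real n) * ext_log (ereal (Z r n)))"
  have inf_sup: "?inf r \<le> ?sup r" for r by (rule Liminf_le_Limsup) simp
  show "(?inf \<longlongrightarrow> Q) (at_right 0)"
  proof (rule tendsto_at_right_0I)
    show "\<exists>r0>0. \<forall>r. 0 < r \<and> r < r0 \<longrightarrow> ?inf r \<le> ereal a" if "Q < ereal a" for a
      using upper[OF that] pressure_le[OF nonneg] order.trans[OF inf_sup] by meson
  qed (rule pressure_ge[OF lower])
  show "(?sup \<longlongrightarrow> Q) (at_right 0)"
  proof (rule tendsto_at_right_0I)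
    show "\<exists>r0>0. \<forall>r. 0 < r \<and> r < r0 \<longrightarrow> ?sup r \<le> ereal a" if "Q < ereal a" for a
      using upper[OF that] pressure_le[OF nonneg] by meson
  qed (rule order.trans[OF pressure_ge[OF lower] inf_sup])
  show "((\<lambda>r. - ext_log (fps_conv_radius (Abs_fps (\<lambda>n. if n = 0 then 0 else complex_of_real (Z r n / real n)))))
      \<longlongrightarrow> Q) (at_right 0)"
  proof (rule tendsto_at_right_0I)
    show "\<exists>r0>0. \<forall>r. 0 < r \<and> r < r0 \<longrightarrow>
        - ext_log (fps_conv_radius (Abs_fps (\<lambda>n. if n = 0 then 0 else complex_of_real (Z r n / real n)))) \<le> ereal a"
      if "Q < ereal a" for a
      using upper[OF that] zeta_exponent_le[OF nonneg] by meson
  qed (rule zeta_exponent_ge[OF lower])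
qed

section \<open>Graphs without arcs, and the combined exponential bounds\<close>

lemma Z_sum_no_arcs:
  assumes "arcs G = {}" "0 < n"
  shows "Z_sum G U \<phi> D n = 0"
proof -
  have "finite_paths G n = {}" using assms by (auto simp: finite_paths_def)
  then show ?thesis by (simp add: Z_sum_def)
qed

text \<open>The path space is empty and carries no probability measure. The supremum over the empty
  set is minus infinity, in agreement with the vanishing of \<open>Z_sum\<close> at positive
  lengths.\<close>

lemma invariant_probs_no_arcs:
  assumes "arcs G = {}"
  shows "invariant_probs (path_topology G) T = {}"
proof -
  have "infinite_paths G = {}" using assms by (auto simp: infinite_paths_def)
  then show ?thesis
    using borel_probsD(1,3) prob_space.not_empty unfolding invariant_probs_def by blast
qed

lemma Z_sum_limits:
  fixes G :: "('v, 'e) pre_digraph"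
    and U :: "(nat \<Rightarrow> 'e) measure \<Rightarrow> 'x::metric_space"
    and C :: "'x set"
    and \<phi> :: "(nat \<Rightarrow> 'e) \<Rightarrow> real"
    and a :: real
  assumes G: "fin_digraph G" "strongly_connected G"
    and U: "continuous_map (path_weak_topology G) euclidean U"
    and \<phi>: "path_continuous G \<phi>"
  defines "Q \<equiv> (SUP \<mu>\<in>{\<mu> \<in> shift_probs G. U \<mu> \<in> closure C}.
           ks_entropy shift_map \<mu> + ereal (\<integral>u. \<phi> u \<partial>\<mu>))"
  shows Z_sum_nonnegative: "0 < n \<Longrightarrow> 0 \<le> Z_sum G U \<phi> D n"
    and Z_sum_eventually_ge: "ereal a < Q \<Longrightarrow> 0 < r \<Longrightarrow>
      \<forall>\<^sub>F n in sequentially. exp (n * a) \<le> Z_sum G U \<phi> (set_ball C r) n"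
    and Z_sum_eventually_le: "Q < ereal a \<Longrightarrow> \<exists>r0>0. \<forall>r. 0 < r \<and> r < r0 \<longrightarrow>
      (\<forall>\<^sub>F n in sequentially. Z_sum G U \<phi> (set_ball C r) n \<le> exp (n * a))"
proof -
  have ps: "path_system G" if "arcs G \<noteq> {}"
    using G that by (intro path_system.intro path_system_axioms.intro)
  show "0 \<le> Z_sum G U \<phi> D n" if "0 < n"
  proof (cases "arcs G = {}")
    case True
    show ?thesis unfolding Z_sum_no_arcs[OF True that] by simp
  next
    case False
    show ?thesis by (rule path_system.Z_sum_nonneg[OF ps[OF False] \<phi>])
  qed
  show "\<forall>\<^sub>F n in sequentially. exp (n * a) \<le> Z_sum G U \<phi> (set_ball C r) n" if "ereal a < Q" "0 < r"
  proof -
    obtain \<nu> where \<nu>: "\<nu> \<in> shift_probs G" "U \<nu> \<in> closure C"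
        "ereal a < ks_entropy shift_map \<nu> + ereal (\<integral>u. \<phi> u \<partial>\<nu>)"
      using \<open>ereal a < Q\<close> unfolding Q_def less_SUP_iff by auto
    then have "arcs G \<noteq> {}" using invariant_probs_no_arcs by blast
    then show ?thesis using path_system.Z_sum_lower[OF ps U \<phi> \<nu> \<open>0 < r\<close>] by blast
  qed
  show "\<exists>r0>0. \<forall>r. 0 < r \<and> r < r0 \<longrightarrow>
      (\<forall>\<^sub>F n in sequentially. Z_sum G U \<phi> (set_ball C r) n \<le> exp (n * a))" if Qa: "Q < ereal a"
  proof (cases "arcs G = {}")
    case True
    have "\<forall>\<^sub>F n in sequentially. Z_sum G U \<phi> (set_ball C r) n \<le> exp (n * a)" for r
      using eventually_gt_at_top[of 0] by eventually_elim (simp add: Z_sum_no_arcs[OF True])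
    then show ?thesis by (intro exI[of _ "1::real"]) simp
  next
    case False
    interpret path_system G by (rule ps[OF False])
    \<comment> \<open>The gap between \<open>b\<close> and \<open>a\<close> absorbs the constant
      \<open>K\<close> of the upper bound.\<close>
    obtain b where b: "Q < ereal b" "b < a" using ereal_dense2[OF Qa] by auto
    have "ks_entropy shift_map \<nu> + ereal (\<integral>u. \<phi> u \<partial>\<nu>) < ereal b"
      if "\<nu> \<in> shift_probs G" "U \<nu> \<in> closure C" for \<nu>
    proof -
      have "\<nu> \<in> {\<mu> \<in> shift_probs G. U \<mu> \<in> closure C}" using that by simp
      then have "ks_entropy shift_map \<nu> + ereal (\<integral>u. \<phi> u \<partial>\<nu>) \<le> Q"
        unfolding Q_def
        by (rule SUP_upper[where f = "\<lambda>\<mu>. ks_entropy shift_map \<mu> + ereal (\<integral>u. \<phi> u \<partial>\<mu>)"])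
      then show ?thesis using b(1) by (rule le_less_trans)
    qed
    then have "\<exists>r>0. \<exists>K\<ge>0. \<forall>\<^sub>F n in sequentially. Z_sum G U \<phi> (set_ball C r) n \<le> K * exp (n * b)"
      by (rule Z_sum_upper[OF U \<phi>])
    then obtain r0 K where r0: "r0 > 0" "K \<ge> 0"
        "\<forall>\<^sub>F n in sequentially. Z_sum G U \<phi> (set_ball C r0) n \<le> K * exp (n * b)" by blast
    have "\<forall>\<^sub>F n in sequentially. K \<le> exp (n * (a - b))"
    proof -
      have "filterlim (\<lambda>n. exp (real n * (a - b))) at_top sequentially"
        using b(2) by (intro filterlim_compose[OF exp_at_top]
            filterlim_at_top_mult_tendsto_pos[OF tendsto_const] filterlim_real_sequentially) simp
      then show ?thesis unfolding filterlim_at_top by blast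
    qed
    then have ev: "\<forall>\<^sub>F n in sequentially. Z_sum G U \<phi> (set_ball C r0) n \<le> exp (n * a)"
      using r0(3)
    proof eventually_elim
      fix n :: nat assume n: "K \<le> exp (n * (a - b))" "Z_sum G U \<phi> (set_ball C r0) n \<le> K * exp (n * b)"
      have "K * exp (n * b) \<le> exp (n * (a - b)) * exp (n * b)" using n(1) by (intro mult_right_mono) auto
      also have "\<dots> = exp (n * a)" by (simp add: exp_add[symmetric] algebra_simps)
      finally show "Z_sum G U \<phi> (set_ball C r0) n \<le> exp (n * a)" using n(2) by linarith
    qed
    have "\<forall>\<^sub>F n in sequentially. Z_sum G U \<phi> (set_ball C r) n \<le> exp (n * a)" if "r < r0" for r
      using ev
    proof eventually_elim
      fix n :: nat assume "Z_sum G U \<phi> (set_ball C r0) n \<le> exp (n * a)"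
      then show "Z_sum G U \<phi> (set_ball C r) n \<le> exp (n * a)"
        using Z_sum_mono[OF \<phi> set_ball_mono[OF less_imp_le[OF that]], of U C n] by linarith
    qed
    then show ?thesis using r0(1) by blast
  qed
qed

theorem theorem4p4:
  fixes G :: "('v, 'e) pre_digraph"
    and U :: "(nat \<Rightarrow> 'e) measure \<Rightarrow> 'x::metric_space"
    and C :: "'x set"
    and \<phi> :: "(nat \<Rightarrow> 'e) \<Rightarrow> real"
  assumes "fin_digraph G"
    and "strongly_connected G"
    and "continuous_map (weak_topology (path_topology G)) euclidean U"
    and "continuous_map (path_topology G) euclideanreal \<phi>"
  shows
    "(((\<lambda>r. lower_pressure G U \<phi> (set_ball C r)) \<longlongrightarrow>
        (SUP \<mu>\<in>{\<mu> \<in> invariant_probs (path_topology G) shift_map. U \<mu> \<in> closure C}.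
           ks_entropy shift_map \<mu> + ereal (\<integral>u. \<phi> u \<partial>\<mu>))) (at_right 0) \<and>
      ((\<lambda>r. upper_pressure G U \<phi> (set_ball C r)) \<longlongrightarrow>
        (SUP \<mu>\<in>{\<mu> \<in> invariant_probs (path_topology G) shift_map. U \<mu> \<in> closure C}.
           ks_entropy shift_map \<mu> + ereal (\<integral>u. \<phi> u \<partial>\<mu>))) (at_right 0)) \<and>
     ((\<lambda>r. - ext_log (fps_conv_radius (dyn_zeta G U \<phi> (set_ball C r)))) \<longlongrightarrow>
        (SUP \<mu>\<in>{\<mu> \<in> invariant_probs (path_topology G) shift_map. U \<mu> \<in> closure C}.
           ks_entropy shift_map \<mu> + ereal (\<integral>u. \<phi> u \<partial>\<mu>))) (at_right 0)"
  unfolding lower_pressure_def upper_pressure_def dyn_zeta_def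
  using pressure_limits[of "\<lambda>r. Z_sum G U \<phi> (set_ball C r)",
      OF Z_sum_nonnegative[OF assms] Z_sum_eventually_ge[OF assms] Z_sum_eventually_le[OF assms]]
  by (intro conjI)

end
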